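(* Consider the Gaussian MAC with user cooperation $$Y=\sqrt{h_{10}}X_1+\sqrt{h_{20}}X_2+Z,\quad Y_{F_1}=\sqrt{h_{21}}X_2+Z_1,\quad Y_{F_2}=\sqrt{h_{12}}X_1+Z_2,$$ where $Z,Z_1,Z_2$ are independent zero-mean Gaussian random variables with variances $\sigma_Z^2,\sigma_{Z_1}^2,\sigma_{Z_2}^2$, with fixed nonnegative gains and average power constraints $E[X_1^2]\le P_1$, $E[X_2^2]\le P_2$, and its dependence balance outer bound $$\mathcal{DB}=\bigcup_{(\rho_{1T},\rho_{2T})\in[0,1]\times[0,1]}\Big\{(R_1,R_2):\ R_1\le\tfrac12\log(1+f_1),\ R_2\le\tfrac12\log(1+f_2),\ R_1+R_2\le\tfrac12\log(1+f_3),\ R_1+R_2\le\tfrac12\log(1+f_4)\Big\},$$ where $$f_1=(1-\rho_{1T}^2)P_1\Big(\frac{h_{10}}{\sigma_Z^2}+\frac{h_{12}}{\sigma_{Z_2}^2}\Big),\qquad f_2=(1-\rho_{2T}^2)P_2\Big(\frac{h_{20}}{\sigma_Z^2}+\frac{h_{21}}{\sigma_{Z_1}^2}\Big),$$ $$f_3=f_1+f_2+(1-\rho_{1T}^2)(1-\rho_{2T}^2)P_1P_2\,\frac{h_{12}h_{21}\sigma_Z^2+h_{20}h_{12}\sigma_{Z_1}^2+h_{10}h_{21}\sigma_{Z_2}^2}{\sigma_Z^2\sigma_{Z_1}^2\sigma_{Z_2}^2},$$ $$f_4=\frac{h_{10}P_1+h_{20}P_2+2\rho_{1T}\rho_{2T}\sqrt{h_{10}h_{20}P_1P_2}}{\sigma_Z^2}.$$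 In the limit $\sigma_{Z_1}^2,\sigma_{Z_2}^2\to\infty$ (very noisy cooperation links), in which $$f_1=\frac{(1-\rho_{1T}^2)h_{10}P_1}{\sigma_Z^2},\qquad f_2=\frac{(1-\rho_{2T}^2)h_{20}P_2}{\sigma_Z^2},\qquad f_3=f_1+f_2,$$ the outer bound $\mathcal{DB}$ collapses to the capacity region of the Gaussian MAC with no cooperation.
   Context: Rates are nonnegative and logarithms are natural. The Gaussian MAC with no cooperation is the channel $Y=\sqrt{h_{10}}X_1+\sqrt{h_{20}}X_2+Z$ with the same power constraints in which each transmitter's inputs depend only on its own message. The set $\mathcal{DB}$ is called an outer bound because it contains the capacity region of the channel with user cooperation, where the $i$-th input of transmitter $k$ may depend on its message and on its past overheard signals $Y_{F_k}^{i-1}$. *)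

theory Defs
  imports "HOL-Probability.Probability"
begin

section \<open>The dependence balance bound\<close>

text \<open>
  Throughout, \<open>P1\<close>, \<open>P2\<close> are the power constraints and \<open>N\<close>, \<open>N1\<close>, \<open>N2\<close> stand for the
  noise variances \<open>\<sigma>\<^sub>Z\<^sup>2\<close>, \<open>\<sigma>\<^sub>Z\<^sub>1\<^sup>2\<close>, \<open>\<sigma>\<^sub>Z\<^sub>2\<^sup>2\<close> (variances, not standard deviations).
\<close>

definition db_f1 :: "real \<Rightarrow> real \<Rightarrow> real \<Rightarrow> real \<Rightarrow> real \<Rightarrow> real \<Rightarrow> real" where
  "db_f1 h10 h12 P1 N N2 \<rho>1 = (1 - \<rho>1\<^sup>2) * P1 * (h10 / N + h12 / N2)"

definition db_f2 :: "real \<Rightarrow> real \<Rightarrow> real \<Rightarrow> real \<Rightarrow> real \<Rightarrow> real \<Rightarrow> real" where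
  "db_f2 h20 h21 P2 N N1 \<rho>2 = (1 - \<rho>2\<^sup>2) * P2 * (h20 / N + h21 / N1)"

definition db_f3 ::
  "real \<Rightarrow> real \<Rightarrow> real \<Rightarrow> real \<Rightarrow> real \<Rightarrow> real \<Rightarrow> real \<Rightarrow> real \<Rightarrow> real \<Rightarrow> real \<Rightarrow> real \<Rightarrow> real" where
  "db_f3 h10 h20 h12 h21 P1 P2 N N1 N2 \<rho>1 \<rho>2 =
     db_f1 h10 h12 P1 N N2 \<rho>1 + db_f2 h20 h21 P2 N N1 \<rho>2
     + (1 - \<rho>1\<^sup>2) * (1 - \<rho>2\<^sup>2) * P1 * P2
       * ((h12 * h21 * N + h20 * h12 * N1 + h10 * h21 * N2) / (N * N1 * N2))"

definition db_f4 :: "real \<Rightarrow> real \<Rightarrow> real \<Rightarrow> real \<Rightarrow> real \<Rightarrow> real \<Rightarrow> real \<Rightarrow> real" where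
  "db_f4 h10 h20 P1 P2 N \<rho>1 \<rho>2 =
     (h10 * P1 + h20 * P2 + 2 * \<rho>1 * \<rho>2 * sqrt (h10 * h20 * P1 * P2)) / N"

definition rate_union ::
  "(real \<Rightarrow> real) \<Rightarrow> (real \<Rightarrow> real) \<Rightarrow> (real \<Rightarrow> real \<Rightarrow> real) \<Rightarrow> (real \<Rightarrow> real \<Rightarrow> real) \<Rightarrow> (real \<times> real) set" where
  "rate_union f1 f2 f3 f4 =
     (\<Union>(\<rho>1, \<rho>2) \<in> {0..1} \<times> {0..1}.
        {(R1, R2). 0 \<le> R1 \<and> 0 \<le> R2
           \<and> R1 \<le> 1 / 2 * ln (1 + f1 \<rho>1)
           \<and> R2 \<le> 1 / 2 * ln (1 + f2 \<rho>2)
           \<and> R1 + R2 \<le> 1 / 2 * ln (1 + f3 \<rho>1 \<rho>2)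
           \<and> R1 + R2 \<le> 1 / 2 * ln (1 + f4 \<rho>1 \<rho>2)})"

definition DB ::
  "real \<Rightarrow> real \<Rightarrow> real \<Rightarrow> real \<Rightarrow> real \<Rightarrow> real \<Rightarrow> real \<Rightarrow> real \<Rightarrow> real \<Rightarrow> (real \<times> real) set" where
  "DB h10 h20 h12 h21 P1 P2 N N1 N2 =
     rate_union (db_f1 h10 h12 P1 N N2) (db_f2 h20 h21 P2 N N1)
       (db_f3 h10 h20 h12 h21 P1 P2 N N1 N2) (db_f4 h10 h20 P1 P2 N)"

definition hausdorff_tendsto :: "('b \<Rightarrow> 'a::metric_space set) \<Rightarrow> 'a set \<Rightarrow> 'b filter \<Rightarrow> bool" where
  "hausdorff_tendsto A C F \<longleftrightarrow>
     (\<forall>\<epsilon>>0. \<forall>\<^sub>F t in F. A t \<subseteq> (\<Union>x\<in>C. ball x \<epsilon>) \<and> C \<subseteq> (\<Union>x\<in>A t. ball x \<epsilon>))"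

section \<open>Capacity region of the Gaussian MAC without cooperation\<close>

text \<open>
  In a code of blocklength \<open>n\<close>, message \<open>w < msgs1 c\<close> of transmitter 1 is sent as the codeword
  \<open>enc1 c w 0, \<dots>, enc1 c w (n - 1)\<close>, and likewise for transmitter 2; the two messages are
  independent and uniformly distributed.
\<close>

record mac_code =
  msgs1 :: nat
  msgs2 :: nat
  enc1 :: "nat \<Rightarrow> nat \<Rightarrow> real"
  enc2 :: "nat \<Rightarrow> nat \<Rightarrow> real"
  dec :: "(nat \<Rightarrow> real) \<Rightarrow> nat \<times> nat"

definition gaussian_noise :: "real \<Rightarrow> nat \<Rightarrow> (nat \<Rightarrow> real) measure" where
  "gaussian_noise N n = (\<Pi>\<^sub>M i\<in>{..<n}. density lborel (\<lambda>z. ennreal (normal_density 0 (sqrt N) z)))"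

definition mac_output :: "real \<Rightarrow> real \<Rightarrow> nat \<Rightarrow> (nat \<Rightarrow> real) \<Rightarrow> (nat \<Rightarrow> real) \<Rightarrow> (nat \<Rightarrow> real) \<Rightarrow> nat \<Rightarrow> real" where
  "mac_output h10 h20 n x1 x2 z = (\<lambda>i\<in>{..<n}. sqrt h10 * x1 i + sqrt h20 * x2 i + z i)"

definition mac_error :: "real \<Rightarrow> real \<Rightarrow> real \<Rightarrow> nat \<Rightarrow> mac_code \<Rightarrow> real" where
  "mac_error h10 h20 N n c =
     (\<Sum>w1<msgs1 c. \<Sum>w2<msgs2 c.
        measure (gaussian_noise N n)
          {z \<in> space (gaussian_noise N n).
             dec c (mac_output h10 h20 n (enc1 c w1) (enc2 c w2) z) \<noteq> (w1, w2)})
     / (real (msgs1 c) * real (msgs2 c))"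

text \<open>
  The average power of a transmitter is \<open>1/n \<cdot> \<Sum>\<^sub>i E[X\<^sub>i\<^sup>2]\<close>, the expectation being over its
  uniformly distributed message.
\<close>

definition avg_power :: "nat \<Rightarrow> nat \<Rightarrow> (nat \<Rightarrow> nat \<Rightarrow> real) \<Rightarrow> real" where
  "avg_power n M x = (\<Sum>i<n. (\<Sum>w<M. (x w i)\<^sup>2) / real M) / real n"

definition is_mac_code :: "real \<Rightarrow> real \<Rightarrow> nat \<Rightarrow> mac_code \<Rightarrow> bool" where
  "is_mac_code P1 P2 n c \<longleftrightarrow>
     0 < msgs1 c \<and> 0 < msgs2 c
     \<and> avg_power n (msgs1 c) (enc1 c) \<le> P1
     \<and> avg_power n (msgs2 c) (enc2 c) \<le> P2
     \<and> dec c \<in> (\<Pi>\<^sub>M i\<in>{..<n}. borel) \<rightarrow>\<^sub>M count_space UNIV"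

definition mac_achievable :: "real \<Rightarrow> real \<Rightarrow> real \<Rightarrow> real \<Rightarrow> real \<Rightarrow> (real \<times> real) set" where
  "mac_achievable h10 h20 P1 P2 N =
     {(R1, R2). 0 \<le> R1 \<and> 0 \<le> R2 \<and>
        (\<forall>\<epsilon>>0. \<forall>\<^sub>F n in sequentially. \<exists>c. is_mac_code P1 P2 n c
            \<and> R1 \<le> ln (real (msgs1 c)) / real n
            \<and> R2 \<le> ln (real (msgs2 c)) / real n
            \<and> mac_error h10 h20 N n c \<le> \<epsilon>)}"

definition mac_capacity_region :: "real \<Rightarrow> real \<Rightarrow> real \<Rightarrow> real \<Rightarrow> real \<Rightarrow> (real \<times> real) set" where
  "mac_capacity_region h10 h20 P1 P2 N = closure (mac_achievable h10 h20 P1 P2 N)"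

end

theory Submission
  imports Defs
begin

text \<open>
  Each of the first three bounds is decreasing in the correlation parameters, so in the limit the
  union is attained at zero correlation, where it is the pentagon of the multiple access channel;
  the point is that this pentagon is the operationally defined capacity region.

  Converse. Compare the output law \<open>p\<close> of a message pair with a Gaussian law \<open>q\<close> that ignores the
  messages to be bounded, using \<open>1 + u \<le> exp u\<close> for \<open>u = L \<cdot> 1\<^sub>A - ln (p / q) - ln 2\<close>, where \<open>A\<close> is the
  event of correct decoding and \<open>L\<close> the logarithm of the number of messages. Under \<open>q\<close> the decoder can
  only guess, and centring \<open>q\<close> at the mean of the codewords makes the relative entropy equal to
  \<open>n\<close> times the claimed rate.

  Achievability. Draw i.i.d. Gaussian codebooks and decode by comparing energies. The law of
  the output given only some of the codewords is again Gaussian, so one change of measure bounds both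
  the probability that the true codewords look atypical (a Chernoff bound) and the probability
  that independent codewords look typical.
\<close>

section \<open>Gaussian vectors\<close>

text \<open>The converse treats each message pair separately: given the pair, the output is a single
  Gaussian vector, so no mixture density, conditional entropy or mutual information has to be
  formed. Averaging over the messages comes afterwards, as it must, because the power constraint
  holds only on average over the messages and not for each codeword. The \<open>ln 2\<close>
  normalises an exponential moment: with \<open>M\<close> messages, \<open>L = ln M\<close> and a
  guessing probability of at most \<open>1 / M\<close>, half of \<open>1 + (M - 1) / M\<close> stays
  below 1. It costs an additive constant that disappears after division by the blocklength.

  For random coding the obstacle is that Gaussian codewords respect the power constraint only
  approximately; the power is lowered by the factor \<open>1 + \<delta>\<close> to make room for the
  excess.

  The set limit requires no uniformity in the correlation parameters. For every finite pair of link
  noises, \<open>DB\<close> lies between the capacity pentagon and a pentagon built from its own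
  first three bounds at zero correlation, so that only three numbers have to converge.\<close>

definition gauss1 :: "real \<Rightarrow> real \<Rightarrow> real measure" where
  "gauss1 m s = density lborel (\<lambda>z. ennreal (normal_density m (sqrt s) z))"

text \<open>The mean depends on the coordinate because it will be the noiseless output of the
  channel; \<open>s\<close> is a variance, not a standard deviation.\<close>

definition gauss :: "(nat \<Rightarrow> real) \<Rightarrow> real \<Rightarrow> nat \<Rightarrow> (nat \<Rightarrow> real) measure" where
  "gauss m s n = (\<Pi>\<^sub>M i\<in>{..<n}. gauss1 (m i) s)"

lemma gaussian_noise_eq_gauss: "gaussian_noise N n = gauss (\<lambda>_. 0) N n"
  by (simp add: gaussian_noise_def gauss_def gauss1_def)

lemma sets_gauss1 [measurable_cong, simp]: "sets (gauss1 m s) = sets borel"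
  by (simp add: gauss1_def)

lemma space_gauss1 [simp]: "space (gauss1 m s) = UNIV"
  by (simp add: gauss1_def)

lemma prob_space_gauss1: "0 < s \<Longrightarrow> prob_space (gauss1 m s)"
  unfolding gauss1_def by (rule prob_space_normal_density) simp

lemma sets_gauss [measurable_cong, simp]: "sets (gauss m s n) = sets (\<Pi>\<^sub>M i\<in>{..<n}. borel)"
  unfolding gauss_def by (rule sets_PiM_cong) auto

lemma space_gauss: "space (gauss m s n) = {..<n} \<rightarrow>\<^sub>E UNIV"
  by (simp add: gauss_def space_PiM)

lemma prob_space_gauss: "0 < s \<Longrightarrow> prob_space (gauss m s n)"
  unfolding gauss_def by (intro prob_space_PiM prob_space_gauss1)

lemma product_sigma_finite_gauss1: "0 < s \<Longrightarrow> product_sigma_finite (\<lambda>i. gauss1 (m i) s)"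
  by (simp add: product_sigma_finite_def prob_space_gauss1 prob_space_imp_sigma_finite)

text \<open>The log-likelihood with respect to Lebesgue measure. In this form likelihood ratios are
  differences of energies, which is what both the relative entropy and the typicality tests
  evaluate.\<close>

definition gauss_logdens :: "(nat \<Rightarrow> real) \<Rightarrow> real \<Rightarrow> nat \<Rightarrow> (nat \<Rightarrow> real) \<Rightarrow> real" where
  "gauss_logdens m s n z = - (real n / 2 * ln (2 * pi * s)) - (\<Sum>i<n. (z i - m i)\<^sup>2) / (2 * s)"

lemma gauss_logdens_measurable [measurable]:
  "gauss_logdens m s n \<in> borel_measurable (\<Pi>\<^sub>M i\<in>{..<n}. borel)"
  unfolding gauss_logdens_def[abs_def] by measurable

lemma prod_normal_density:
  assumes "0 < s"
  shows "(\<Prod>i<n. normal_density (m i) (sqrt s) (z i)) = exp (gauss_logdens m s n z)"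
proof -
  have "normal_density (m i) (sqrt s) (z i) = exp (- (ln (2 * pi * s) / 2) - (z i - m i)\<^sup>2 / (2 * s))" for i
  proof -
    have "1 / sqrt (2 * pi * s) = exp (- (ln (2 * pi * s) / 2))"
      using assms by (simp add: exp_minus ln_sqrt[symmetric] inverse_eq_divide)
    then have "normal_density (m i) (sqrt s) (z i)
        = exp (- (ln (2 * pi * s) / 2)) * exp (- ((z i - m i)\<^sup>2 / (2 * s)))"
      using assms by (simp add: normal_density_def)
    then show ?thesis
      by (simp add: exp_add[symmetric])
  qed
  then show ?thesis
    by (simp add: exp_sum[symmetric] gauss_logdens_def sum_subtractf sum_divide_distrib)
qed

text \<open>A product measure is determined by its values on boxes, and on a box the integral of the
  product density factorises over the coordinates.\<close>

lemma gauss_density: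
  assumes s: "0 < s"
  shows "gauss m s n = density (\<Pi>\<^sub>M i\<in>{..<n}. lborel) (\<lambda>z. ennreal (exp (gauss_logdens m s n z)))"
proof -
  interpret L: product_sigma_finite "\<lambda>i::nat. lborel :: real measure"
    by standard
  have "density (\<Pi>\<^sub>M i\<in>{..<n}. lborel) (\<lambda>z. ennreal (exp (gauss_logdens m s n z))) = gauss m s n"
    unfolding gauss_def
  proof (rule product_sigma_finite.PiM_eqI[OF product_sigma_finite_gauss1[OF s]])
    show "sets (density (\<Pi>\<^sub>M i\<in>{..<n}. lborel) (\<lambda>z. ennreal (exp (gauss_logdens m s n z)))) =
      sets (\<Pi>\<^sub>M i\<in>{..<n}. gauss1 (m i) s)"
      by (simp, rule sets_PiM_cong) auto
    fix A assume A: "\<And>i. i \<in> {..<n} \<Longrightarrow> A i \<in> sets (gauss1 (m i) s)"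
    have [measurable]: "Pi\<^sub>E {..<n} A \<in> sets (\<Pi>\<^sub>M i\<in>{..<n}. lborel)"
      using A by (intro sets_PiM_I_finite) auto
    have "emeasure (density (\<Pi>\<^sub>M i\<in>{..<n}. lborel) (\<lambda>z. ennreal (exp (gauss_logdens m s n z)))) (Pi\<^sub>E {..<n} A)
      = (\<integral>\<^sup>+z. ennreal (exp (gauss_logdens m s n z)) * indicator (Pi\<^sub>E {..<n} A) z \<partial>(\<Pi>\<^sub>M i\<in>{..<n}. lborel))"
      by (rule emeasure_density) measurable
    also have "\<dots> = (\<integral>\<^sup>+z. (\<Prod>i<n. ennreal (normal_density (m i) (sqrt s) (z i)) * indicator (A i) (z i))
         \<partial>(\<Pi>\<^sub>M i\<in>{..<n}. lborel))"
    proof (rule nn_integral_cong)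
      fix z :: "nat \<Rightarrow> real" assume "z \<in> space (\<Pi>\<^sub>M i\<in>{..<n}. lborel)"
      then have "indicator (Pi\<^sub>E {..<n} A) z = (\<Prod>i<n. indicator (A i) (z i) :: ennreal)"
        by (cases "\<forall>i<n. z i \<in> A i") (auto simp: space_PiM PiE_def Pi_iff indicator_def)
      then show "ennreal (exp (gauss_logdens m s n z)) * indicator (Pi\<^sub>E {..<n} A) z
         = (\<Prod>i<n. ennreal (normal_density (m i) (sqrt s) (z i)) * indicator (A i) (z i))"
        by (simp add: prod.distrib prod_ennreal prod_normal_density[OF s])
    qed
    also have "\<dots> = (\<Prod>i<n. \<integral>\<^sup>+z. ennreal (normal_density (m i) (sqrt s) z) * indicator (A i) z \<partial>lborel)"
      using A by (intro L.product_nn_integral_prod) auto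
    also have "\<dots> = (\<Prod>i<n. emeasure (gauss1 (m i) s) (A i))"
      using A by (intro prod.cong refl) (simp add: gauss1_def emeasure_density)
    finally show "emeasure (density (\<Pi>\<^sub>M i\<in>{..<n}. lborel) (\<lambda>z. ennreal (exp (gauss_logdens m s n z)))) (Pi\<^sub>E {..<n} A)
      = (\<Prod>i<n. emeasure (gauss1 (m i) s) (A i))" .
  qed simp
  then show ?thesis ..
qed

text \<open>
  The workhorse of the achievability part: as the law on the right is a probability measure, a
  pointwise bound on the likelihood ratio over \<open>A\<close> bounds the probability of \<open>A\<close>.
\<close>

lemma gauss_tilt:
  assumes s: "0 < s" "0 < t" and A [measurable]: "A \<in> sets (\<Pi>\<^sub>M i\<in>{..<n}. borel)"
    and le: "\<And>z. z \<in> A \<Longrightarrow> gauss_logdens m s n z \<le> k + gauss_logdens m' t n z"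
  shows "emeasure (gauss m s n) A \<le> ennreal (exp k)"
proof -
  let ?L = "\<Pi>\<^sub>M i\<in>{..<n}. lborel :: real measure"
  have [measurable]: "A \<in> sets ?L"
    using A by (simp cong: sets_PiM_cong)
  have "emeasure (gauss m s n) A = (\<integral>\<^sup>+z. ennreal (exp (gauss_logdens m s n z)) * indicator A z \<partial>?L)"
    unfolding gauss_density[OF s(1)] by (rule emeasure_density) measurable
  also have "\<dots> \<le> (\<integral>\<^sup>+z. ennreal (exp k) * (ennreal (exp (gauss_logdens m' t n z)) * indicator A z) \<partial>?L)"
  proof (rule nn_integral_mono)
    fix z
    show "ennreal (exp (gauss_logdens m s n z)) * indicator A z
      \<le> ennreal (exp k) * (ennreal (exp (gauss_logdens m' t n z)) * indicator A z)"
      using le[of z] by (auto simp: indicator_def ennreal_mult'[symmetric] mult_exp_exp)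
  qed
  also have "\<dots> = ennreal (exp k) * (\<integral>\<^sup>+z. ennreal (exp (gauss_logdens m' t n z)) * indicator A z \<partial>?L)"
    by (rule nn_integral_cmult) measurable
  also have "\<dots> = ennreal (exp k) * emeasure (gauss m' t n) A"
    unfolding gauss_density[OF s(2)] by (subst emeasure_density) measurable
  also have "\<dots> \<le> ennreal (exp k) * 1"
    using prob_space.emeasure_le_1[OF prob_space_gauss[OF s(2)]] by (intro mult_left_mono) auto
  finally show ?thesis by simp
qed

text \<open>Translation acts coordinatewise, so a comparison on boxes suffices. This is how the
  channel output for fixed codewords becomes a Gaussian vector centred at the noiseless
  output.\<close>

lemma gauss_shift:
  assumes s: "0 < s" and [measurable]: "f \<in> borel_measurable (\<Pi>\<^sub>M i\<in>{..<n}. borel)"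
  shows "(\<integral>\<^sup>+z. f (\<lambda>i\<in>{..<n}. m i + z i) \<partial>gauss (\<lambda>_. 0) s n) = (\<integral>\<^sup>+y. f y \<partial>gauss m s n)"
proof -
  have 1: "distr (gauss1 0 s) borel (\<lambda>z. c + z) = gauss1 c s" for c
  proof (rule measure_eqI)
    fix A assume "A \<in> sets (distr (gauss1 0 s) borel ((+) c))"
    then have [measurable]: "A \<in> sets borel" by simp
    have "emeasure (distr (gauss1 0 s) borel ((+) c)) A = emeasure (gauss1 0 s) ((\<lambda>z. c + z) -` A)"
      by (subst emeasure_distr) (auto simp: space_gauss1)
    also have "\<dots> = (\<integral>\<^sup>+z. ennreal (normal_density 0 (sqrt s) z) * indicator A (c + z) \<partial>lborel)"
      unfolding gauss1_def using measurable_sets[of "(+) c" borel borel A]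
      by (subst emeasure_density) (auto intro!: nn_integral_cong simp: indicator_def)
    also have "\<dots> = (\<integral>\<^sup>+z. ennreal (normal_density c (sqrt s) z) * indicator A z \<partial>lborel)"
      by (subst nn_integral_real_affine[where c=1 and t="c"]) (auto simp: normal_density_def)
    also have "\<dots> = emeasure (gauss1 c s) A"
      unfolding gauss1_def by (subst emeasure_density) auto
    finally show "emeasure (distr (gauss1 0 s) borel ((+) c)) A = emeasure (gauss1 c s) A" .
  qed simp
  have "gauss m s n = distr (gauss (\<lambda>_. 0) s n) (\<Pi>\<^sub>M i\<in>{..<n}. borel) (\<lambda>z. \<lambda>i\<in>{..<n}. m i + z i)"
    (is "_ = ?D")
  proof -
    have "?D = (\<Pi>\<^sub>M i\<in>{..<n}. gauss1 (m i) s)"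
    proof (rule product_sigma_finite.PiM_eqI[OF product_sigma_finite_gauss1[OF s]])
      show "sets ?D = sets (\<Pi>\<^sub>M i\<in>{..<n}. gauss1 (m i) s)"
        using sets_gauss[of m s n] by (simp add: gauss_def)
      fix A assume A: "\<And>i. i \<in> {..<n} \<Longrightarrow> A i \<in> sets (gauss1 (m i) s)"
      have [measurable]: "Pi\<^sub>E {..<n} A \<in> sets (\<Pi>\<^sub>M i\<in>{..<n}. borel)"
        using A by (intro sets_PiM_I_finite) auto
      have "emeasure ?D (Pi\<^sub>E {..<n} A) = emeasure (gauss (\<lambda>_. 0) s n) (Pi\<^sub>E {..<n} (\<lambda>i. (\<lambda>z. m i + z) -` A i))"
        by (subst emeasure_distr) (auto intro!: arg_cong2[where f=emeasure] simp: space_gauss PiE_iff)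
      also have "\<dots> = (\<Prod>i<n. emeasure (gauss1 0 s) ((\<lambda>z. m i + z) -` A i))"
        unfolding gauss_def
        using A by (subst product_sigma_finite.emeasure_PiM[OF product_sigma_finite_gauss1[OF s]])
          (auto intro!: measurable_sets[of "(+) _" borel borel, simplified])
      also have "\<dots> = (\<Prod>i<n. emeasure (gauss1 (m i) s) (A i))"
        using A by (intro prod.cong refl, subst (2) 1[symmetric], subst emeasure_distr) auto
      finally show "emeasure ?D (Pi\<^sub>E {..<n} A) = (\<Prod>i<n. emeasure (gauss1 (m i) s) (A i))" .
    qed simp
    then show ?thesis by (simp add: gauss_def)
  qed
  then show ?thesis
    by (simp add: nn_integral_distr)
qed

text \<open>A zero gain is separated because \<open>a * x\<close> then has no density. Otherwise the
  order of integration is exchanged, and the inner integral is the convolution of two normal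
  densities with deviations \<open>\<bar>a\<bar>\<close> and \<open>sqrt s\<close>.\<close>

lemma gauss1_convolution:
  assumes s: "0 < s" and A [measurable]: "A \<in> sets borel"
  shows "(\<integral>\<^sup>+x. emeasure (gauss1 0 s) {z. a * x + z \<in> A} \<partial>gauss1 0 1) = emeasure (gauss1 0 (a\<^sup>2 + s)) A"
proof (cases "a = 0")
  case True
  interpret prob_space "gauss1 0 1" by (rule prob_space_gauss1) simp
  show ?thesis using True by (simp add: emeasure_space_1[simplified])
next
  case False
  have eq: "emeasure (gauss1 0 s) {z. a * x + z \<in> A}
      = (\<integral>\<^sup>+y. ennreal (normal_density 0 (sqrt s) (y - a * x)) * indicator A y \<partial>lborel)" for x
  proof -
    have [measurable]: "{z. a * x + z \<in> A} \<in> sets borel"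
      using measurable_sets[of "\<lambda>z. a * x + z" borel borel A] by (simp add: vimage_def)
    show ?thesis
      unfolding gauss1_def
      by (subst emeasure_density, simp, simp, subst (2) nn_integral_real_affine[where c=1 and t="a*x"])
         (auto simp: indicator_def)
  qed
  \<comment> \<open>The factor \<open>\<bar>a\<bar>\<close> is the Jacobian of
    \<open>x \<mapsto> a * x\<close>; it is made explicit here so that the affine substitution below
    can absorb it.\<close>
  have dens: "normal_density 0 1 x * normal_density 0 (sqrt s) (y - a * x)
      = \<bar>a\<bar> * (normal_density 0 \<bar>a\<bar> (a * x) * normal_density 0 (sqrt s) (y - a * x))" for x y
    using False by (simp add: normal_density_def real_sqrt_mult power_mult_distrib)
  have "(\<integral>\<^sup>+x. emeasure (gauss1 0 s) {z. a * x + z \<in> A} \<partial>gauss1 0 1)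
    = (\<integral>\<^sup>+x. \<integral>\<^sup>+y. ennreal (normal_density 0 1 x * normal_density 0 (sqrt s) (y - a * x)) * indicator A y \<partial>lborel \<partial>lborel)"
    unfolding eq unfolding gauss1_def
    by (subst nn_integral_density)
       (auto simp: nn_integral_cmult[symmetric] ennreal_mult mult_ac intro!: nn_integral_cong)
  also have "\<dots> = (\<integral>\<^sup>+y. \<integral>\<^sup>+x. ennreal (normal_density 0 1 x * normal_density 0 (sqrt s) (y - a * x)) * indicator A y \<partial>lborel \<partial>lborel)"
    by (rule lborel_pair.Fubini') measurable
  also have "\<dots> = (\<integral>\<^sup>+y. (\<integral>\<^sup>+x. ennreal (normal_density 0 1 x * normal_density 0 (sqrt s) (y - a * x)) \<partial>lborel) * indicator A y \<partial>lborel)"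
    by (intro nn_integral_cong nn_integral_multc) measurable
  also have "\<dots> = (\<integral>\<^sup>+y. ennreal (normal_density 0 (sqrt (a\<^sup>2 + s)) y) * indicator A y \<partial>lborel)"
  proof (intro nn_integral_cong arg_cong2[where f="(*)"] refl)
    fix y
    have "(\<integral>\<^sup>+x. ennreal (normal_density 0 1 x * normal_density 0 (sqrt s) (y - a * x)) \<partial>lborel)
      = (\<integral>\<^sup>+x. ennreal (normal_density 0 (sqrt s) (y - x) * normal_density 0 \<bar>a\<bar> x) \<partial>lborel)"
      unfolding dens using False
      by (subst (2) nn_integral_real_affine[where c=a and t=0])
         (simp_all add: ennreal_mult'[of "\<bar>a\<bar>"] nn_integral_cmult mult_ac)
    also have "\<dots> = ennreal (normal_density 0 (sqrt (a\<^sup>2 + s)) y)"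
      using False s conv_normal_density_zero_mean[of "sqrt s" "\<bar>a\<bar>"]
      by (auto dest!: fun_cong[where x=y] simp: add.commute)
    finally show "(\<integral>\<^sup>+x. ennreal (normal_density 0 1 x * normal_density 0 (sqrt s) (y - a * x)) \<partial>lborel)
      = ennreal (normal_density 0 (sqrt (a\<^sup>2 + s)) y)" .
  qed
  also have "\<dots> = emeasure (gauss1 0 (a\<^sup>2 + s)) A"
    unfolding gauss1_def by (subst emeasure_density) auto
  finally show ?thesis .
qed

text \<open>On a box both sides factorise, which leaves the one-dimensional case. Codewords are
  integrated out one at a time with this rule; hence the nesting
  \<open>a\<^sup>2 + (b\<^sup>2 + N)\<close> of the output variance later on.\<close>

lemma gauss_convolution:
  assumes s: "0 < s" and f [measurable]: "f \<in> borel_measurable (\<Pi>\<^sub>M i\<in>{..<n}. borel)"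
  shows "(\<integral>\<^sup>+x. \<integral>\<^sup>+z. f (\<lambda>i\<in>{..<n}. a * x i + z i) \<partial>gauss (\<lambda>_. 0) s n \<partial>gauss (\<lambda>_. 0) 1 n)
    = (\<integral>\<^sup>+y. f y \<partial>gauss (\<lambda>_. 0) (a\<^sup>2 + s) n)"
proof -
  let ?G = "gauss (\<lambda>_. 0) 1 n" and ?S = "gauss (\<lambda>_. 0) s n"
  let ?g = "\<lambda>(x, z). \<lambda>i\<in>{..<n}. a * x i + z i"
  have s': "0 < a\<^sup>2 + s" using s by (simp add: add_nonneg_pos)
  interpret G: prob_space ?G by (rule prob_space_gauss) simp
  interpret S: prob_space ?S by (rule prob_space_gauss) fact
  have gm [measurable]: "?g \<in> (?G \<Otimes>\<^sub>M ?S) \<rightarrow>\<^sub>M (\<Pi>\<^sub>M i\<in>{..<n}. borel)"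
    by measurable
  have "distr (?G \<Otimes>\<^sub>M ?S) (\<Pi>\<^sub>M i\<in>{..<n}. borel) ?g = (\<Pi>\<^sub>M i\<in>{..<n}. gauss1 0 (a\<^sup>2 + s))" (is "?D = _")
  proof (rule product_sigma_finite.PiM_eqI[OF product_sigma_finite_gauss1[OF s', of "\<lambda>_. 0"]])
    show "sets ?D = sets (\<Pi>\<^sub>M i\<in>{..<n}. gauss1 0 (a\<^sup>2 + s))"
      using sets_gauss[of "\<lambda>_. 0" "a\<^sup>2 + s" n] by (simp add: gauss_def)
    fix A assume A: "\<And>i. i \<in> {..<n} \<Longrightarrow> A i \<in> sets (gauss1 0 (a\<^sup>2 + s))"
    have meas: "{z. a * x + z \<in> A i} \<in> sets borel" if "i < n" for x i
      using measurable_sets[of "\<lambda>z. a * x + z" borel borel "A i"] A that by (simp add: vimage_def)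
    have [measurable]: "Pi\<^sub>E {..<n} A \<in> sets (\<Pi>\<^sub>M i\<in>{..<n}. borel)"
      using A by (intro sets_PiM_I_finite) auto
    have "emeasure ?D (Pi\<^sub>E {..<n} A)
      = (\<integral>\<^sup>+x. emeasure ?S (Pair x -` (?g -` (Pi\<^sub>E {..<n} A) \<inter> space (?G \<Otimes>\<^sub>M ?S))) \<partial>?G)"
      by (subst emeasure_distr, simp, simp, rule S.emeasure_pair_measure_alt) measurable
    also have "\<dots> = (\<integral>\<^sup>+x. emeasure ?S (\<Pi>\<^sub>E i\<in>{..<n}. {z. a * x i + z \<in> A i}) \<partial>?G)"
    proof (rule nn_integral_cong)
      fix x assume "x \<in> space ?G"
      then have "Pair x -` (?g -` (Pi\<^sub>E {..<n} A) \<inter> space (?G \<Otimes>\<^sub>M ?S))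
          = (\<Pi>\<^sub>E i\<in>{..<n}. {z. a * x i + z \<in> A i})"
      proof (intro set_eqI)
        fix z
        have "z \<in> Pair x -` (?g -` (Pi\<^sub>E {..<n} A) \<inter> space (?G \<Otimes>\<^sub>M ?S))
          \<longleftrightarrow> (\<lambda>i\<in>{..<n}. a * x i + z i) \<in> Pi\<^sub>E {..<n} A \<and> z \<in> {..<n} \<rightarrow>\<^sub>E UNIV"
          using \<open>x \<in> space ?G\<close>
          by (simp only: vimage_eq Int_iff case_prod_conv mem_Sigma_iff space_pair_measure space_gauss simp_thms)
        also have "\<dots> \<longleftrightarrow> z \<in> (\<Pi>\<^sub>E i\<in>{..<n}. {z. a * x i + z \<in> A i})"
          unfolding PiE_iff by simp
        finally show "z \<in> Pair x -` (?g -` (Pi\<^sub>E {..<n} A) \<inter> space (?G \<Otimes>\<^sub>M ?S))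
          \<longleftrightarrow> z \<in> (\<Pi>\<^sub>E i\<in>{..<n}. {z. a * x i + z \<in> A i})" .
      qed
      then show "emeasure ?S (Pair x -` (?g -` (Pi\<^sub>E {..<n} A) \<inter> space (?G \<Otimes>\<^sub>M ?S)))
          = emeasure ?S (\<Pi>\<^sub>E i\<in>{..<n}. {z. a * x i + z \<in> A i})" by simp
    qed
    also have "\<dots> = (\<integral>\<^sup>+x. (\<Prod>i<n. emeasure (gauss1 0 s) {z. a * x i + z \<in> A i}) \<partial>?G)"
      unfolding gauss_def
      using meas by (subst product_sigma_finite.emeasure_PiM[OF product_sigma_finite_gauss1[OF s]]) auto
    also have "\<dots> = (\<Prod>i<n. \<integral>\<^sup>+x. emeasure (gauss1 0 s) {z. a * x + z \<in> A i} \<partial>gauss1 0 1)"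
      unfolding gauss_def
    proof (rule product_sigma_finite.product_nn_integral_prod[OF product_sigma_finite_gauss1])
      fix i assume "i \<in> {..<n}"
      then have [measurable]: "A i \<in> sets borel" using A by auto
      interpret g: sigma_finite_measure "gauss1 0 s"
        by (intro prob_space_imp_sigma_finite prob_space_gauss1 s)
      have "(\<lambda>(x, z). a * x + z) \<in> (gauss1 0 1 \<Otimes>\<^sub>M gauss1 0 s) \<rightarrow>\<^sub>M (borel :: real measure)"
        by measurable
      from g.measurable_emeasure_Pair[OF measurable_sets[OF this, of "A i"]]
      show "(\<lambda>x. emeasure (gauss1 0 s) {z. a * x + z \<in> A i}) \<in> borel_measurable (gauss1 0 1)"
        by (simp add: vimage_def space_pair_measure)
    qed auto
    also have "\<dots> = (\<Prod>i<n. emeasure (gauss1 0 (a\<^sup>2 + s)) (A i))"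
      using A by (intro prod.cong refl gauss1_convolution s) auto
    finally show "emeasure ?D (Pi\<^sub>E {..<n} A) = (\<Prod>i<n. emeasure (gauss1 0 (a\<^sup>2 + s)) (A i))" .
  qed simp
  then have "(\<integral>\<^sup>+y. f y \<partial>gauss (\<lambda>_. 0) (a\<^sup>2 + s) n) = (\<integral>\<^sup>+y. f y \<partial>?D)"
    by (simp add: gauss_def)
  also have "\<dots> = (\<integral>\<^sup>+x. \<integral>\<^sup>+z. f (?g (x, z)) \<partial>?S \<partial>?G)"
    by (subst nn_integral_distr, simp, simp, rule S.nn_integral_fst[symmetric]) measurable
  finally show ?thesis by simp
qed

section \<open>The converse\<close>

lemma (in prob_space) has_bochner_integral_const: "has_bochner_integral M (\<lambda>_. c) (c :: real)"
  by (simp add: has_bochner_integral_iff prob_space)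

text \<open>Expanding around the mean \<open>m\<close> leaves the variance, a cross term that is an
  odd central moment and vanishes, and the squared offset.\<close>

lemma gauss1_second_moment:
  assumes s: "0 < s"
  shows "has_bochner_integral (gauss1 m s) (\<lambda>y. (y - c)\<^sup>2) (s + (m - c)\<^sup>2)"
proof -
  let ?\<phi> = "normal_density m (sqrt s)"
  have *: "?\<phi> y * (y - c)\<^sup>2 = ?\<phi> y * (y - m)\<^sup>2 + (2 * (m - c)) * (?\<phi> y * (y - m) ^ 1) + (m - c)\<^sup>2 * ?\<phi> y" for y
    by (simp add: power2_eq_square algebra_simps)
  have "has_bochner_integral lborel (\<lambda>y. ?\<phi> y * (y - m)\<^sup>2) s"
    using normal_moment_even[of "sqrt s" m 1] s by simp
  moreover have "has_bochner_integral lborel (\<lambda>y. ?\<phi> y * (y - m) ^ 1) 0"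
    using normal_moment_odd[of "sqrt s" m 0] s by simp
  moreover have "has_bochner_integral lborel ?\<phi> 1"
    using s by (simp add: has_bochner_integral_iff)
  ultimately have "has_bochner_integral lborel (\<lambda>y. ?\<phi> y * (y - c)\<^sup>2) (s + (2 * (m - c)) * 0 + (m - c)\<^sup>2 * 1)"
    unfolding * by (intro has_bochner_integral_add has_bochner_integral_mult_right) auto
  then show ?thesis
    unfolding gauss1_def by (intro has_bochner_integral_density) auto
qed

lemma measurable_gauss_component: "i < n \<Longrightarrow> (\<lambda>\<omega>. \<omega> i) \<in> gauss m s n \<rightarrow>\<^sub>M gauss1 (m i) s"
  unfolding gauss_def by (rule measurable_component_singleton) simp

lemma gauss_second_moment:
  assumes s: "0 < s" and i: "i < n"
  shows "has_bochner_integral (gauss m s n) (\<lambda>y. (y i - c)\<^sup>2) (s + (m i - c)\<^sup>2)"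
proof -
  have "distr (gauss m s n) (gauss1 (m i) s) (\<lambda>\<omega>. \<omega> i) = gauss1 (m i) s"
    unfolding gauss_def using i s
    by (intro distr_PiM_component prob_space_gauss1) auto
  with gauss1_second_moment[OF s, of "m i" c]
  have "has_bochner_integral (distr (gauss m s n) (gauss1 (m i) s) (\<lambda>\<omega>. \<omega> i)) (\<lambda>y. (y - c)\<^sup>2) (s + (m i - c)\<^sup>2)"
    by simp
  moreover have "(\<lambda>\<omega>. \<omega> i) \<in> gauss m s n \<rightarrow>\<^sub>M gauss1 (m i) s"
    using i by (intro measurable_gauss_component)
  ultimately show ?thesis
    by (simp add: has_bochner_integral_iff integrable_distr_eq integral_distr)
qed

text \<open>The value is the Kullback-Leibler divergence of the two laws. Log-densities are affine
  in the energies, whose means are known from the second moments.\<close>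

lemma gauss_relative_entropy:
  assumes s: "0 < s" and t: "0 < t"
  shows "has_bochner_integral (gauss m s n) (\<lambda>z. gauss_logdens m s n z - gauss_logdens m' t n z)
    (real n / 2 * (ln (t / s) + s / t - 1) + (\<Sum>i<n. (m i - m' i)\<^sup>2) / (2 * t))"
proof -
  interpret prob_space "gauss m s n" by (rule prob_space_gauss) fact
  have 1: "has_bochner_integral (gauss m s n) (\<lambda>z. \<Sum>i<n. (z i - c i)\<^sup>2) (\<Sum>i<n. s + (m i - c i)\<^sup>2)" for c
    by (intro has_bochner_integral_sum gauss_second_moment s) auto
  have 2: "has_bochner_integral (gauss m s n) (\<lambda>z. gauss_logdens c r n z)
    (- (real n / 2 * ln (2 * pi * r)) - (\<Sum>i<n. s + (m i - c i)\<^sup>2) / (2 * r))" for c r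
    unfolding gauss_logdens_def
    by (intro has_bochner_integral_diff has_bochner_integral_divide_zero has_bochner_integral_const 1)
  have "(- (real n / 2 * ln (2 * pi * s)) - (\<Sum>i<n. s + (m i - m i)\<^sup>2) / (2 * s))
     - (- (real n / 2 * ln (2 * pi * t)) - (\<Sum>i<n. s + (m i - m' i)\<^sup>2) / (2 * t))
    = real n / 2 * (ln (t / s) + s / t - 1) + (\<Sum>i<n. (m i - m' i)\<^sup>2) / (2 * t)"
    using s t by (simp add: sum.distrib ln_mult ln_div) (simp add: field_simps)
  with has_bochner_integral_diff[OF 2[of m s] 2[of m' t]] show ?thesis by simp
qed

text \<open>
  A Donsker--Varadhan type bound that plays the role of Fano's inequality and data processing.
\<close>

lemma gauss_variational_bound:
  assumes s: "0 < s" and t: "0 < t" and A [measurable]: "A \<in> sets (\<Pi>\<^sub>M i\<in>{..<n}. borel)"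
  shows "L * measure (gauss m s n) A
    \<le> real n / 2 * (ln (t / s) + s / t - 1) + (\<Sum>i<n. (m i - m' i)\<^sup>2) / (2 * t)
      + ln 2 + (exp L - 1) * measure (gauss m' t n) A / 2 - 1 / 2"
proof -
  let ?P = "gauss m s n" and ?Q = "gauss m' t n" and ?L = "\<Pi>\<^sub>M i\<in>{..<n}. lborel :: real measure"
  interpret P: prob_space ?P by (rule prob_space_gauss) fact
  interpret Q: prob_space ?Q by (rule prob_space_gauss) fact
  let ?d = "gauss_logdens m s n" and ?d' = "gauss_logdens m' t n"
  define D where "D = real n / 2 * (ln (t / s) + s / t - 1) + (\<Sum>i<n. (m i - m' i)\<^sup>2) / (2 * t)"
  define f where "f z = L * indicator A z - (?d z - ?d' z) - ln 2" for z
  have indP: "has_bochner_integral ?P (\<lambda>z. indicator A z :: real) (measure ?P A)"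
    by (intro has_bochner_integral_real_indicator) (auto simp: P.emeasure_eq_measure)
  have indQ: "has_bochner_integral ?Q (\<lambda>z. indicator A z :: real) (measure ?Q A)"
    by (intro has_bochner_integral_real_indicator) (auto simp: Q.emeasure_eq_measure)
  have D: "has_bochner_integral ?P (\<lambda>z. ?d z - ?d' z) D"
    unfolding D_def by (rule gauss_relative_entropy[OF s t])
  have f: "has_bochner_integral ?P f (L * measure ?P A - D - ln 2)"
    unfolding f_def
    by (intro has_bochner_integral_diff has_bochner_integral_mult_right P.has_bochner_integral_const
        D indP)
  have "has_bochner_integral ?Q (\<lambda>z. 1 / 2 + (exp L - 1) / 2 * indicator A z) (1 / 2 + (exp L - 1) / 2 * measure ?Q A)"
    by (intro has_bochner_integral_add has_bochner_integral_mult_right Q.has_bochner_integral_const indQ)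
  \<comment> \<open>An exponential of an indicator takes two values only, so it is affine in the
    indicator and integrates to an expression in the probability of \<open>A\<close>.\<close>
  moreover have "(\<lambda>z. 1 / 2 + (exp L - 1) / 2 * indicator A z) = (\<lambda>z. exp (L * indicator A z - ln 2))"
    by (auto simp: indicator_def exp_diff fun_eq_iff exp_minus field_simps)
  ultimately have "has_bochner_integral ?Q (\<lambda>z. exp (L * indicator A z - ln 2)) (1 / 2 + (exp L - 1) / 2 * measure ?Q A)"
    by simp
  \<comment> \<open>Change of measure: \<open>exp (f z)\<close> contains the ratio of the second
    density to the first, so its mean under the first law is the mean of
    \<open>exp (L * indicator A z - ln 2)\<close> under the second.\<close>
  then have "has_bochner_integral ?L (\<lambda>z. exp (?d' z) *\<^sub>R exp (L * indicator A z - ln 2)) (1 / 2 + (exp L - 1) / 2 * measure ?Q A)"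
    unfolding gauss_density[OF t] has_bochner_integral_iff
    by (auto simp: integrable_density integral_density)
  also have "(\<lambda>z. exp (?d' z) *\<^sub>R exp (L * indicator A z - ln 2)) = (\<lambda>z. exp (?d z) *\<^sub>R exp (f z))"
    by (simp add: f_def mult_exp_exp algebra_simps)
  finally have g: "has_bochner_integral ?P (\<lambda>z. exp (f z)) (1 / 2 + (exp L - 1) / 2 * measure ?Q A)"
    unfolding gauss_density[OF s] f_def
    by (intro has_bochner_integral_density) auto
  have "L * measure ?P A - D - ln 2 + 1 = (\<integral>z. f z + 1 \<partial>?P)"
    using f by (simp add: has_bochner_integral_iff P.prob_space)
  also have "\<dots> \<le> (\<integral>z. exp (f z) \<partial>?P)"
    using f g exp_ge_add_one_self[of "f _"]
    by (intro integral_mono) (auto simp: has_bochner_integral_iff add.commute)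
  also have "\<dots> = 1 / 2 + (exp L - 1) / 2 * measure ?Q A"
    using g by (simp add: has_bochner_integral_iff)
  finally show ?thesis unfolding D_def[symmetric] by (simp add: field_simps)
qed

text \<open>The reference variance \<open>t\<close> exceeds the noise variance \<open>s\<close> by
  at least the mean squared displacement of the centres, so after averaging over \<open>W\<close>
  the displacement term is absorbed by \<open>s / t - 1\<close> and \<open>ln (t / s)\<close>
  remains. Assumption \<open>Q\<close> says that under the reference laws the decoder can do no
  better than guess among \<open>M\<close> candidates.\<close>

lemma gauss_converse:
  assumes s: "0 < s" and t: "0 < t" and W: "finite W" "W \<noteq> {}" and M: "1 \<le> M"
    and A: "\<And>w. w \<in> W \<Longrightarrow> A w \<in> sets (\<Pi>\<^sub>M i\<in>{..<n}. borel)"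
    and Q: "(\<Sum>w\<in>W. measure (gauss (m' w) t n) (A w)) \<le> real (card W) / M"
    and var: "(\<Sum>w\<in>W. \<Sum>i<n. (m w i - m' w i)\<^sup>2) \<le> real (card W) * (real n * (t - s))"
  shows "ln M * ((\<Sum>w\<in>W. measure (gauss (m w) s n) (A w)) / real (card W)) \<le> real n / 2 * ln (t / s) + ln 2"
proof -
  define K where "K = real (card W)"
  have K: "0 < K" using W by (simp add: K_def card_gt_0_iff)
  have "(\<Sum>w\<in>W. ln M * measure (gauss (m w) s n) (A w))
    \<le> (\<Sum>w\<in>W. real n / 2 * (ln (t / s) + s / t - 1) + (\<Sum>i<n. (m w i - m' w i)\<^sup>2) / (2 * t)
      + ln 2 + (exp (ln M) - 1) * measure (gauss (m' w) t n) (A w) / 2 - 1 / 2)"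
    by (intro sum_mono gauss_variational_bound s t A)
  also have "\<dots> = K * (real n / 2 * (ln (t / s) + s / t - 1) + ln 2 - 1 / 2)
      + (\<Sum>w\<in>W. \<Sum>i<n. (m w i - m' w i)\<^sup>2) / (2 * t)
      + (M - 1) / 2 * (\<Sum>w\<in>W. measure (gauss (m' w) t n) (A w))"
    using M by (simp add: sum.distrib sum_subtractf sum_divide_distrib sum_distrib_left K_def algebra_simps)
  also have "\<dots> \<le> K * (real n / 2 * (ln (t / s) + s / t - 1) + ln 2 - 1 / 2)
      + (K * (real n * (t - s))) / (2 * t) + (M - 1) / 2 * (K / M)"
    using M t var Q by (intro add_mono divide_right_mono mult_left_mono) (auto simp: K_def)
  \<comment> \<open>The terms in \<open>s / t\<close> cancel, and the constants combine as
    \<open>- 1 / 2 + (M - 1) / (2 * M) = - 1 / (2 * M)\<close>.\<close>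
  also have "\<dots> = K * (real n / 2 * ln (t / s) + ln 2 - 1 / (2 * M))"
    using M t by (simp add: field_simps)
  also have "\<dots> \<le> K * (real n / 2 * ln (t / s) + ln 2)"
    using M K by (intro mult_left_mono) auto
  finally show ?thesis
    using K by (simp add: sum_distrib_left[symmetric] K_def[symmetric] field_simps)
qed

text \<open>Passing from the noise to the output by \<open>gauss_shift\<close> turns correct
  decoding of \<open>w\<close> into the probability of a fixed decoding region. The intersection
  with \<open>{..<n} \<rightarrow>\<^sub>E UNIV\<close> confines the regions to the product space,
  outside of which measurability of the decoder says nothing.\<close>

lemma mac_error_eq:
  assumes N: "0 < N" and c: "is_mac_code P1 P2 n c"
  shows "mac_error h10 h20 N n c = 1 -
    (\<Sum>w\<in>{..<msgs1 c} \<times> {..<msgs2 c}.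
        measure (gauss (\<lambda>i. sqrt h10 * enc1 c (fst w) i + sqrt h20 * enc2 c (snd w) i) N n)
          (dec c -` {w} \<inter> ({..<n} \<rightarrow>\<^sub>E UNIV)))
     / real (card ({..<msgs1 c} \<times> {..<msgs2 c}))"
proof -
  let ?m = "\<lambda>w i. sqrt h10 * enc1 c (fst w) i + sqrt h20 * enc2 c (snd w) i"
  let ?A = "\<lambda>w. dec c -` {w} \<inter> ({..<n} \<rightarrow>\<^sub>E UNIV)"
  let ?\<nu> = "gaussian_noise N n"
  interpret prob_space ?\<nu> unfolding gaussian_noise_eq_gauss by (rule prob_space_gauss) fact
  have [measurable]: "dec c \<in> (\<Pi>\<^sub>M i\<in>{..<n}. borel) \<rightarrow>\<^sub>M count_space UNIV"
    and pos: "0 < msgs1 c" "0 < msgs2 c"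
    using c by (auto simp: is_mac_code_def)
  have A [measurable]: "?A w \<in> sets (\<Pi>\<^sub>M i\<in>{..<n}. borel)" for w
    using measurable_sets[of "dec c" "\<Pi>\<^sub>M i\<in>{..<n}. borel" "count_space UNIV" "{w}"]
    by (simp add: space_PiM)
  have sets_\<nu> [measurable_cong]: "sets ?\<nu> = sets (\<Pi>\<^sub>M i\<in>{..<n}. borel)"
    by (simp add: gaussian_noise_eq_gauss)
  have out [measurable]: "mac_output h10 h20 n x1 x2 \<in> ?\<nu> \<rightarrow>\<^sub>M (\<Pi>\<^sub>M i\<in>{..<n}. borel)" for x1 x2
    unfolding mac_output_def by measurable
  have 1: "measure ?\<nu> {z \<in> space ?\<nu>. dec c (mac_output h10 h20 n (enc1 c (fst w)) (enc2 c (snd w)) z) \<noteq> w}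
      = 1 - measure (gauss (?m w) N n) (?A w)" for w
  proof -
    let ?o = "mac_output h10 h20 n (enc1 c (fst w)) (enc2 c (snd w))"
    have "(\<integral>\<^sup>+z. indicator (?A w) (?o z) \<partial>?\<nu>) = (\<integral>\<^sup>+y. indicator (?A w) y \<partial>gauss (?m w) N n)"
      unfolding gaussian_noise_eq_gauss mac_output_def by (rule gauss_shift[OF N]) measurable
    then have "emeasure (gauss (?m w) N n) (?A w) = (\<integral>\<^sup>+z. indicator (?A w) (?o z) \<partial>?\<nu>)"
      by simp
    also have "\<dots> = emeasure ?\<nu> {z \<in> space ?\<nu>. dec c (?o z) = w}"
      by (rule trans[OF nn_integral_cong nn_integral_indicator]) (auto simp: indicator_def mac_output_def)
    finally have "measure (gauss (?m w) N n) (?A w) = measure ?\<nu> {z \<in> space ?\<nu>. dec c (?o z) = w}"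
      by (simp add: measure_def)
    then show ?thesis
      by (subst prob_neg) auto
  qed
  show ?thesis
    unfolding mac_error_def sum.cartesian_product
    using pos 1[of "(_, _)"]
    by (simp add: 1[of "(_, _)", simplified] case_prod_beta' sum_subtractf diff_divide_distrib)
qed

section \<open>Power, decoding regions and the three rate bounds of a single code\<close>

lemma avg_power_leD:
  assumes "avg_power n M x \<le> P" "0 < M"
  shows "(\<Sum>w<M. \<Sum>i<n. (x w i)\<^sup>2) \<le> real M * (real n * P)"
proof (cases "n = 0")
  case False
  have "(\<Sum>w<M. \<Sum>i<n. (x w i)\<^sup>2) = (\<Sum>i<n. \<Sum>w<M. (x w i)\<^sup>2)"
    by (rule sum.swap)
  also have "\<dots> = real M * (real n * avg_power n M x)"
    using assms False by (simp add: avg_power_def sum_divide_distrib[symmetric])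
  also have "\<dots> \<le> real M * (real n * P)"
    using assms by (intro mult_left_mono) auto
  finally show ?thesis .
\<comment> \<open>At blocklength zero \<open>avg_power\<close> is a division by zero and carries no
  information, but both sides of the claim are zero.\<close>
qed simp

lemma sum_sq_centered_le:
  fixes x :: "nat \<Rightarrow> real"
  assumes "0 < M"
  defines "\<mu> \<equiv> (\<Sum>w<M. x w) / real M"
  shows "(\<Sum>w<M. x w - \<mu>) = 0" "(\<Sum>w<M. (x w - \<mu>)\<^sup>2) \<le> (\<Sum>w<M. (x w)\<^sup>2)"
proof -
  have sum: "(\<Sum>w<M. x w) = real M * \<mu>" using assms(1) by (simp add: \<mu>_def)
  then show "(\<Sum>w<M. x w - \<mu>) = 0" by (simp add: sum_subtractf)
  have "(\<Sum>w<M. (x w - \<mu>)\<^sup>2) = (\<Sum>w<M. (x w)\<^sup>2) - 2 * \<mu> * (\<Sum>w<M. x w) + real M * \<mu>\<^sup>2"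
    by (simp add: power2_diff sum.distrib sum_subtractf sum_distrib_left mult_ac)
  also have "\<dots> = (\<Sum>w<M. (x w)\<^sup>2) - real M * \<mu>\<^sup>2"
    unfolding sum by (simp add: power2_eq_square)
  finally show "(\<Sum>w<M. (x w - \<mu>)\<^sup>2) \<le> (\<Sum>w<M. (x w)\<^sup>2)" by simp
qed

text \<open>The cross term factorises into a product of sums over the two messages, one of which
  vanishes. Independence of the messages enters here: without it the users could add coherently,
  which is what the term with \<open>\<rho>1 * \<rho>2\<close> in \<open>db_f4\<close> accounts
  for.\<close>

lemma sum_sq_cartesian:
  fixes f g :: "nat \<Rightarrow> real"
  assumes "(\<Sum>w<A. f w) = 0"
  shows "(\<Sum>w\<in>{..<A} \<times> {..<B}. (f (fst w) + g (snd w))\<^sup>2) = real B * (\<Sum>w<A. (f w)\<^sup>2) + real A * (\<Sum>w<B. (g w)\<^sup>2)"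
proof -
  have "(\<Sum>w\<in>{..<A} \<times> {..<B}. (f (fst w) + g (snd w))\<^sup>2) = (\<Sum>v<A. \<Sum>w<B. (f v + g w)\<^sup>2)"
    by (simp add: sum.cartesian_product case_prod_beta')
  also have "\<dots> = (\<Sum>v<A. real B * (f v)\<^sup>2 + (\<Sum>w<B. (g w)\<^sup>2) + f v * (2 * (\<Sum>w<B. g w)))"
    by (simp add: power2_sum sum.distrib sum_distrib_left mult_ac)
  also have "\<dots> = real B * (\<Sum>w<A. (f w)\<^sup>2) + real A * (\<Sum>w<B. (g w)\<^sup>2)"
    by (simp only: sum.distrib sum_distrib_right[symmetric] assms) (simp add: sum_distrib_left)
  finally show ?thesis .
qed

text \<open>Applied to decoding regions, which are disjoint: under a law that ignores the message,
  the probabilities of a correct guess add up to at most one.\<close>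

lemma (in prob_space) sum_prob_disjoint_le_1:
  assumes "finite I" "disjoint_family_on A I" "\<And>i. i \<in> I \<Longrightarrow> A i \<in> events"
  shows "(\<Sum>i\<in>I. prob (A i)) \<le> 1"
proof -
  have "(\<Sum>i\<in>I. prob (A i)) = prob (\<Union>i\<in>I. A i)"
    using assms by (intro finite_measure_finite_Union[symmetric]) auto
  then show ?thesis by simp
qed

text \<open>The three bounds differ in what the reference law knows. For an individual rate it is
  centred at the codeword of the other user, and the regions are summed over one message with the
  other held fixed; for the sum rate it knows neither message.\<close>

lemma mac_code_converse:
  assumes N: "0 < N" and h: "0 \<le> h10" "0 \<le> h20" and P: "0 \<le> P1" "0 \<le> P2"
    and c: "is_mac_code P1 P2 n c"
  defines "\<eta> \<equiv> 1 - mac_error h10 h20 N n c"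
  shows "ln (real (msgs1 c)) * \<eta> \<le> real n / 2 * ln ((N + h10 * P1) / N) + ln 2"
    and "ln (real (msgs2 c)) * \<eta> \<le> real n / 2 * ln ((N + h20 * P2) / N) + ln 2"
    and "ln (real (msgs1 c) * real (msgs2 c)) * \<eta> \<le> real n / 2 * ln ((N + (h10 * P1 + h20 * P2)) / N) + ln 2"
proof -
  let ?M1 = "msgs1 c" and ?M2 = "msgs2 c"
  let ?W = "{..<?M1} \<times> {..<?M2}"
  let ?A = "\<lambda>w. dec c -` {w} \<inter> ({..<n} \<rightarrow>\<^sub>E UNIV)"
  let ?x1 = "\<lambda>w i. sqrt h10 * enc1 c w i" and ?x2 = "\<lambda>w i. sqrt h20 * enc2 c w i"
  let ?m = "\<lambda>w i. ?x1 (fst w) i + ?x2 (snd w) i"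
  have M: "0 < ?M1" "0 < ?M2" and pw: "avg_power n ?M1 (enc1 c) \<le> P1" "avg_power n ?M2 (enc2 c) \<le> P2"
    and [measurable]: "dec c \<in> (\<Pi>\<^sub>M i\<in>{..<n}. borel) \<rightarrow>\<^sub>M count_space UNIV"
    using c by (auto simp: is_mac_code_def)
  have A: "?A w \<in> sets (\<Pi>\<^sub>M i\<in>{..<n}. borel)" for w
    using measurable_sets[of "dec c" "\<Pi>\<^sub>M i\<in>{..<n}. borel" "count_space UNIV" "{w}"]
    by (simp add: space_PiM)
  have W: "finite ?W" "?W \<noteq> {}" using M by (auto simp: lessThan_empty_iff)
  have \<eta>: "\<eta> = (\<Sum>w\<in>?W. measure (gauss (?m w) N n) (?A w)) / real (card ?W)"
    unfolding \<eta>_def mac_error_eq[OF N c] by simp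
  \<comment> \<open>The injection \<open>f\<close> lets one statement cover both the regions with
    one message held fixed and those of all pairs.\<close>
  have Qle: "(\<Sum>i\<in>I. measure (gauss \<mu> t n) (?A (f i))) \<le> 1" if "0 < t" "finite I" "inj_on f I" for \<mu> t f and I :: "'i set"
    using that A
    by (intro prob_space.sum_prob_disjoint_le_1 prob_space_gauss)
      (auto simp: disjoint_family_on_def inj_on_def)
  have e1: "(\<Sum>w<?M1. \<Sum>i<n. (?x1 w i)\<^sup>2) \<le> real ?M1 * (real n * (h10 * P1))"
    using mult_left_mono[OF avg_power_leD[OF pw(1) M(1)] h(1)] h
    by (simp add: power_mult_distrib sum_distrib_left mult_ac)
  have e2: "(\<Sum>w<?M2. \<Sum>i<n. (?x2 w i)\<^sup>2) \<le> real ?M2 * (real n * (h20 * P2))"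
    using mult_left_mono[OF avg_power_leD[OF pw(2) M(2)] h(2)] h
    by (simp add: power_mult_distrib sum_distrib_left mult_ac)

  have t: "0 < N + h10 * P1" using N h P by (simp add: add_pos_nonneg)
  show "ln (real (msgs1 c)) * \<eta> \<le> real n / 2 * ln ((N + h10 * P1) / N) + ln 2"
    unfolding \<eta>
  proof (rule gauss_converse[where m' = "\<lambda>w. ?x2 (snd w)", OF N t W _ A])
    have "(\<Sum>w\<in>?W. measure (gauss (?x2 (snd w)) (N + h10 * P1) n) (?A w))
      = (\<Sum>w2<?M2. \<Sum>w1<?M1. measure (gauss (?x2 w2) (N + h10 * P1) n) (?A (w1, w2)))"
      by (subst sum.swap) (simp add: sum.cartesian_product case_prod_beta')
    also have "\<dots> \<le> (\<Sum>w2<?M2. 1)"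
      by (intro sum_mono Qle t) (auto simp: inj_on_def)
    finally show "(\<Sum>w\<in>?W. measure (gauss (?x2 (snd w)) (N + h10 * P1) n) (?A w)) \<le> real (card ?W) / real ?M1"
      using M by (simp add: card_cartesian_product)
    have "(\<Sum>w\<in>?W. \<Sum>i<n. (?m w i - ?x2 (snd w) i)\<^sup>2) = real ?M2 * (\<Sum>w<?M1. \<Sum>i<n. (?x1 w i)\<^sup>2)"
      by (simp add: sum.cartesian_product' sum_distrib_left)
    also have "\<dots> \<le> real ?M2 * (real ?M1 * (real n * (h10 * P1)))"
      by (intro mult_left_mono e1) auto
    finally show "(\<Sum>w\<in>?W. \<Sum>i<n. (?m w i - ?x2 (snd w) i)\<^sup>2) \<le> real (card ?W) * (real n * (N + h10 * P1 - N))"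
      by (simp add: card_cartesian_product mult_ac)
  qed (use M in auto)

  have t: "0 < N + h20 * P2" using N h P by (simp add: add_pos_nonneg)
  show "ln (real (msgs2 c)) * \<eta> \<le> real n / 2 * ln ((N + h20 * P2) / N) + ln 2"
    unfolding \<eta>
  proof (rule gauss_converse[where m' = "\<lambda>w. ?x1 (fst w)", OF N t W _ A])
    have "(\<Sum>w\<in>?W. measure (gauss (?x1 (fst w)) (N + h20 * P2) n) (?A w))
      = (\<Sum>w1<?M1. \<Sum>w2<?M2. measure (gauss (?x1 w1) (N + h20 * P2) n) (?A (w1, w2)))"
      by (simp add: sum.cartesian_product case_prod_beta')
    also have "\<dots> \<le> (\<Sum>w1<?M1. 1)"
      by (intro sum_mono Qle t) (auto simp: inj_on_def)
    finally show "(\<Sum>w\<in>?W. measure (gauss (?x1 (fst w)) (N + h20 * P2) n) (?A w)) \<le> real (card ?W) / real ?M2"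
      using M by (simp add: card_cartesian_product)
    have "(\<Sum>w\<in>?W. \<Sum>i<n. (?m w i - ?x1 (fst w) i)\<^sup>2) = real ?M1 * (\<Sum>w<?M2. \<Sum>i<n. (?x2 w i)\<^sup>2)"
      by (simp add: sum.cartesian_product' sum_distrib_left)
    also have "\<dots> \<le> real ?M1 * (real ?M2 * (real n * (h20 * P2)))"
      by (intro mult_left_mono e2) auto
    finally show "(\<Sum>w\<in>?W. \<Sum>i<n. (?m w i - ?x1 (fst w) i)\<^sup>2) \<le> real (card ?W) * (real n * (N + h20 * P2 - N))"
      by (simp add: card_cartesian_product mult_ac)
  qed (use M in auto)

  \<comment> \<open>Codebooks may have nonzero means, and these would add coherently in the received
    power. Centring the reference law at the sum of the means removes them.\<close>
  define \<mu>1 where "\<mu>1 i = (\<Sum>w<?M1. ?x1 w i) / real ?M1" for i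
  define \<mu>2 where "\<mu>2 i = (\<Sum>w<?M2. ?x2 w i) / real ?M2" for i
  have t: "0 < N + (h10 * P1 + h20 * P2)" using N h P by (simp add: add_pos_nonneg)
  show "ln (real (msgs1 c) * real (msgs2 c)) * \<eta> \<le> real n / 2 * ln ((N + (h10 * P1 + h20 * P2)) / N) + ln 2"
    unfolding \<eta>
  proof (rule gauss_converse[where m' = "\<lambda>w i. \<mu>1 i + \<mu>2 i", OF N t W _ A])
    have "(\<Sum>w\<in>?W. measure (gauss (\<lambda>i. \<mu>1 i + \<mu>2 i) (N + (h10 * P1 + h20 * P2)) n) (?A w)) \<le> 1"
      by (intro Qle t W) auto
    then show "(\<Sum>w\<in>?W. measure (gauss (\<lambda>i. \<mu>1 i + \<mu>2 i) (N + (h10 * P1 + h20 * P2)) n) (?A w))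
        \<le> real (card ?W) / (real ?M1 * real ?M2)"
      using M by (simp add: card_cartesian_product)
    have "(\<Sum>w\<in>?W. \<Sum>i<n. (?m w i - (\<mu>1 i + \<mu>2 i))\<^sup>2)
      = (\<Sum>i<n. \<Sum>w\<in>?W. ((?x1 (fst w) i - \<mu>1 i) + (?x2 (snd w) i - \<mu>2 i))\<^sup>2)"
      by (subst sum.swap) (simp add: algebra_simps)
    also have "\<dots> = (\<Sum>i<n. real ?M2 * (\<Sum>w<?M1. (?x1 w i - \<mu>1 i)\<^sup>2) + real ?M1 * (\<Sum>w<?M2. (?x2 w i - \<mu>2 i)\<^sup>2))"
      unfolding \<mu>1_def by (intro sum.cong refl sum_sq_cartesian sum_sq_centered_le M)
    also have "\<dots> \<le> (\<Sum>i<n. real ?M2 * (\<Sum>w<?M1. (?x1 w i)\<^sup>2) + real ?M1 * (\<Sum>w<?M2. (?x2 w i)\<^sup>2))"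
      unfolding \<mu>1_def \<mu>2_def by (intro sum_mono add_mono mult_left_mono sum_sq_centered_le M) auto
    also have "\<dots> = real ?M2 * (\<Sum>w<?M1. \<Sum>i<n. (?x1 w i)\<^sup>2) + real ?M1 * (\<Sum>w<?M2. \<Sum>i<n. (?x2 w i)\<^sup>2)"
      by (simp add: sum.distrib sum_distrib_left sum.swap[where B = "{..<n}"])
    also have "\<dots> \<le> real ?M2 * (real ?M1 * (real n * (h10 * P1))) + real ?M1 * (real ?M2 * (real n * (h20 * P2)))"
      by (intro add_mono mult_left_mono e1 e2) auto
    finally show "(\<Sum>w\<in>?W. \<Sum>i<n. (?m w i - (\<mu>1 i + \<mu>2 i))\<^sup>2)
        \<le> real (card ?W) * (real n * (N + (h10 * P1 + h20 * P2) - N))"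
      by (simp add: card_cartesian_product algebra_simps)
  next
    have "1 * 1 \<le> real ?M1 * real ?M2" using M by (intro mult_mono) auto
    then show "1 \<le> real ?M1 * real ?M2" by simp
  qed
qed

text \<open>Two limits in succession: the blocklength grows at a fixed error level, which removes
  \<open>ln 2 / real n\<close>, and only afterwards the error level tends to zero.\<close>

lemma weak_converse_limit:
  assumes "\<And>\<epsilon>. 0 < \<epsilon> \<Longrightarrow> \<epsilon> < 1 \<Longrightarrow> \<forall>\<^sub>F n in sequentially. (1 - \<epsilon>) * R \<le> C + ln 2 / real n"
  shows "R \<le> (C :: real)"
proof -
  have "(1 - \<epsilon>) * R \<le> C" if "0 < \<epsilon>" "\<epsilon> < 1" for \<epsilon>
  proof (rule tendsto_lowerbound)
    show "(\<lambda>n. C + ln 2 / real n) \<longlonglongrightarrow> C"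
      by (intro tendsto_eq_intros lim_const_over_n) auto
  qed (use assms[OF that] in auto)
  then have "\<forall>\<^sub>F \<epsilon> in at_right 0. (1 - \<epsilon>) * R \<le> C"
    unfolding eventually_at_right_field by (intro exI[of _ 1]) auto
  moreover have "((\<lambda>\<epsilon>. (1 - \<epsilon>) * R) \<longlongrightarrow> (1 - 0) * R) (at_right 0)"
    by (intro tendsto_intros)
  ultimately show ?thesis
    using tendsto_upperbound[of "\<lambda>\<epsilon>. (1 - \<epsilon>) * R" "(1 - 0) * R" "at_right 0" C] by simp
qed

text \<open>The parameters are signal-to-noise ratios. They are kept independent of each other so
  that the same shape describes both the capacity region and the envelope of \<open>DB\<close> at
  finite link noises.\<close>

definition mac_pentagon :: "real \<Rightarrow> real \<Rightarrow> real \<Rightarrow> (real \<times> real) set" where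
  "mac_pentagon S1 S2 S = {(R1, R2). 0 \<le> R1 \<and> 0 \<le> R2 \<and> R1 \<le> 1 / 2 * ln (1 + S1) \<and>
     R2 \<le> 1 / 2 * ln (1 + S2) \<and> R1 + R2 \<le> 1 / 2 * ln (1 + S)}"

lemma mac_achievable_subset_pentagon:
  assumes N: "0 < N" and h: "0 \<le> h10" "0 \<le> h20" and P: "0 \<le> P1" "0 \<le> P2"
  shows "mac_achievable h10 h20 P1 P2 N \<subseteq> mac_pentagon (h10 * P1 / N) (h20 * P2 / N) ((h10 * P1 + h20 * P2) / N)"
proof clarify
  fix R1 R2 assume "(R1, R2) \<in> mac_achievable h10 h20 P1 P2 N"
  then have R: "0 \<le> R1" "0 \<le> R2" and ach: "\<And>\<epsilon>. 0 < \<epsilon> \<Longrightarrow> \<forall>\<^sub>F n in sequentially. \<exists>c. is_mac_code P1 P2 n c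
            \<and> R1 \<le> ln (real (msgs1 c)) / real n
            \<and> R2 \<le> ln (real (msgs2 c)) / real n
            \<and> mac_error h10 h20 N n c \<le> \<epsilon>"
    by (auto simp: mac_achievable_def)
  \<comment> \<open>One computation for all three bounds: \<open>L\<close> is the logarithm of a
    number of messages, \<open>e\<close> the error of the code, and \<open>S\<close> a
    signal-to-noise ratio, so that \<open>S * N\<close> is the received power.\<close>
  have scale: "(1 - \<epsilon>) * R \<le> 1 / 2 * ln (1 + S) + ln 2 / real n"
    if "R \<le> L / real n" "0 < n" "e \<le> \<epsilon>" "\<epsilon> < 1" "0 \<le> L" "L * (1 - e) \<le> real n / 2 * ln ((N + S * N) / N) + ln 2"
    for R L e \<epsilon> S and n :: nat
  proof -
    have "(1 - \<epsilon>) * R \<le> (1 - \<epsilon>) * (L / real n)"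
      using that by (intro mult_left_mono) auto
    also have "\<dots> \<le> (1 - e) * (L / real n)"
      using that by (intro mult_right_mono) auto
    also have "\<dots> = L * (1 - e) / real n" by simp
    also have "\<dots> \<le> (real n / 2 * ln ((N + S * N) / N) + ln 2) / real n"
      using that by (intro divide_right_mono) auto
    also have "\<dots> = 1 / 2 * ln (1 + S) + ln 2 / real n"
      using that N by (simp add: add_divide_distrib)
    finally show ?thesis .
  qed
  have ev: "\<forall>\<^sub>F n in sequentially. (1 - \<epsilon>) * R1 \<le> 1 / 2 * ln (1 + h10 * P1 / N) + ln 2 / real n
      \<and> (1 - \<epsilon>) * R2 \<le> 1 / 2 * ln (1 + h20 * P2 / N) + ln 2 / real n
      \<and> (1 - \<epsilon>) * (R1 + R2) \<le> 1 / 2 * ln (1 + (h10 * P1 + h20 * P2) / N) + ln 2 / real n"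
    if \<epsilon>: "0 < \<epsilon>" "\<epsilon> < 1" for \<epsilon>
    using ach[OF \<epsilon>(1)] eventually_gt_at_top[of 0]
  proof eventually_elim
    case (elim n)
    then obtain c where c: "is_mac_code P1 P2 n c" and r: "R1 \<le> ln (real (msgs1 c)) / real n"
      "R2 \<le> ln (real (msgs2 c)) / real n" and e: "mac_error h10 h20 N n c \<le> \<epsilon>" by auto
    have M: "1 \<le> real (msgs1 c)" "1 \<le> real (msgs2 c)" using c by (auto simp: is_mac_code_def)
    have r12: "R1 + R2 \<le> ln (real (msgs1 c) * real (msgs2 c)) / real n"
      using r M by (simp add: ln_mult add_divide_distrib)
    have "0 \<le> ln (real (msgs1 c) * real (msgs2 c))"
      using M by (simp add: ln_mult)
    with M N mac_code_converse[OF N h P c] show ?case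
      by (intro conjI scale[OF r(1) elim(2) e \<epsilon>(2)] scale[OF r(2) elim(2) e \<epsilon>(2)] scale[OF r12 elim(2) e \<epsilon>(2)]) auto
  qed
  have "R1 \<le> 1 / 2 * ln (1 + h10 * P1 / N)" "R2 \<le> 1 / 2 * ln (1 + h20 * P2 / N)"
    "R1 + R2 \<le> 1 / 2 * ln (1 + (h10 * P1 + h20 * P2) / N)"
    by (rule weak_converse_limit, drule (1) ev, erule eventually_mono, simp)+
  with R show "(R1, R2) \<in> mac_pentagon (h10 * P1 / N) (h20 * P2 / N) ((h10 * P1 + h20 * P2) / N)"
    by (simp add: mac_pentagon_def)
qed

section \<open>Typical sequences and confusion probabilities\<close>

text \<open>
  For \<open>\<tau> > 0\<close> this is the upper and for \<open>\<tau> < 0\<close> the lower chi-square tail. The optimal Chernoff tilt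
  changes the variance from \<open>s\<close> to \<open>s (1 + \<tau>)\<close>.
\<close>

lemma gauss_energy_tail:
  assumes s: "0 < s" and \<tau>: "-1 < \<tau>" and A: "A \<in> sets (\<Pi>\<^sub>M i\<in>{..<n}. borel)"
    and en: "\<And>z. z \<in> A \<Longrightarrow> \<tau> * (real n * s * (1 + \<tau>)) \<le> \<tau> * (\<Sum>i<n. (z i)\<^sup>2)"
  shows "emeasure (gauss (\<lambda>_. 0) s n) A \<le> ennreal (exp (real n / 2 * (ln (1 + \<tau>) - \<tau>)))"
proof (rule gauss_tilt[OF s _ A])
  show t: "0 < s * (1 + \<tau>)" using s \<tau> by simp
  fix z assume "z \<in> A"
  let ?E = "\<Sum>i<n. (z i)\<^sup>2"
  have "real n * \<tau> / 2 = \<tau> * (real n * s * (1 + \<tau>)) / (2 * (s * (1 + \<tau>)))"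
    using t nonzero_mult_divide_mult_cancel_right[of "s * (1 + \<tau>)" "real n * \<tau>" 2]
    by (simp only: mult_ac)
  also have "\<dots> \<le> \<tau> * ?E / (2 * (s * (1 + \<tau>)))"
    using en[OF \<open>z \<in> A\<close>] t by (intro divide_right_mono) auto
  also have "\<dots> = (?E * (1 + \<tau>)) / ((2 * s) * (1 + \<tau>)) - ?E / (2 * (s * (1 + \<tau>)))"
    by (simp add: diff_divide_distrib[symmetric] algebra_simps)
  also have "(?E * (1 + \<tau>)) / ((2 * s) * (1 + \<tau>)) = ?E / (2 * s)"
    using \<tau> by simp
  finally have "real n * \<tau> / 2 \<le> ?E / (2 * s) - ?E / (2 * (s * (1 + \<tau>)))" .
  moreover have "ln (2 * pi * (s * (1 + \<tau>))) = ln (2 * pi * s) + ln (1 + \<tau>)"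
    using s \<tau> by (simp add: ln_mult mult.assoc[symmetric])
  ultimately show "gauss_logdens (\<lambda>_. 0) s n z
      \<le> real n / 2 * (ln (1 + \<tau>) - \<tau>) + gauss_logdens (\<lambda>_. 0) (s * (1 + \<tau>)) n z"
    by (simp add: gauss_logdens_def algebra_simps)
qed

text \<open>Here \<open>m\<close> is the contribution of a wrong codeword, fixed while the vector is
  random with the larger variance \<open>s\<close>. On \<open>A\<close> the two energy conditions
  bound the log-likelihood ratio; each contributes \<open>real n * \<delta> / 2\<close> to the loss,
  and \<open>ln (s / t) / 2\<close> is the Gaussian mutual information per symbol.\<close>

lemma gauss_confusion:
  assumes s: "0 < s" and t: "0 < t" and A: "A \<in> sets (\<Pi>\<^sub>M i\<in>{..<n}. borel)"
    and en: "\<And>z. z \<in> A \<Longrightarrow> real n * s * (1 - \<delta>) \<le> (\<Sum>i<n. (z i)\<^sup>2)"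
      "\<And>z. z \<in> A \<Longrightarrow> (\<Sum>i<n. (z i - m i)\<^sup>2) \<le> real n * t * (1 + \<delta>)"
  shows "emeasure (gauss (\<lambda>_. 0) s n) A \<le> ennreal (exp (- real n * (ln (s / t) / 2 - \<delta>)))"
proof (rule gauss_tilt[OF s t A])
  fix z assume z: "z \<in> A"
  have "(\<Sum>i<n. (z i - m i)\<^sup>2) / (2 * t) \<le> real n * (1 + \<delta>) / 2"
    using en(2)[OF z] t by (simp add: field_simps)
  moreover have "real n * (1 - \<delta>) / 2 \<le> (\<Sum>i<n. (z i)\<^sup>2) / (2 * s)"
    using en(1)[OF z] s by (simp add: field_simps)
  ultimately show "gauss_logdens (\<lambda>_. 0) s n z \<le> - real n * (ln (s / t) / 2 - \<delta>) + gauss_logdens m t n z"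
    using s t by (simp add: gauss_logdens_def ln_mult ln_div diff_divide_distrib algebra_simps)
qed

text \<open>The factors \<open>a\<close> and \<open>b\<close> combine channel gain and transmit
  amplitude, so that all codewords can be drawn with unit variance.\<close>

definition superpose :: "real \<Rightarrow> real \<Rightarrow> nat \<Rightarrow> (nat \<Rightarrow> real) \<Rightarrow> (nat \<Rightarrow> real) \<Rightarrow> (nat \<Rightarrow> real) \<Rightarrow> nat \<Rightarrow> real" where
  "superpose a b n x1 x2 z = (\<lambda>i\<in>{..<n}. a * x1 i + b * x2 i + z i)"

definition energy :: "nat \<Rightarrow> (nat \<Rightarrow> real) \<Rightarrow> real" where
  "energy n z = (\<Sum>i<n. (z i)\<^sup>2)"

text \<open>
  The third energy is that of the noise; the last three are those of the output after
  subtraction of one codeword or none. Together they bound the three information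
  densities from below.
\<close>

definition typical ::
  "real \<Rightarrow> real \<Rightarrow> real \<Rightarrow> real \<Rightarrow> nat \<Rightarrow> (nat \<Rightarrow> real) \<Rightarrow> (nat \<Rightarrow> real) \<Rightarrow> (nat \<Rightarrow> real) \<Rightarrow> bool" where
  "typical a b N \<delta> n x1 x2 y \<longleftrightarrow>
     energy n x1 \<le> real n * (1 + \<delta>) \<and> energy n x2 \<le> real n * (1 + \<delta>)
     \<and> energy n (\<lambda>i. y i - a * x1 i - b * x2 i) \<le> real n * N * (1 + \<delta>)
     \<and> real n * (a\<^sup>2 + N) * (1 - \<delta>) \<le> energy n (\<lambda>i. y i - b * x2 i)
     \<and> real n * (b\<^sup>2 + N) * (1 - \<delta>) \<le> energy n (\<lambda>i. y i - a * x1 i)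
     \<and> real n * (a\<^sup>2 + (b\<^sup>2 + N)) * (1 - \<delta>) \<le> energy n y"

section \<open>Measurability of energies and of the typicality test\<close>

lemma energy_cong: "(\<And>i. i < n \<Longrightarrow> x i = y i) \<Longrightarrow> energy n x = energy n y"
  by (simp add: energy_def)

lemma energy_measurable [measurable (raw)]:
  assumes "\<And>i. i < n \<Longrightarrow> (\<lambda>\<omega>. f \<omega> i) \<in> borel_measurable M"
  shows "(\<lambda>\<omega>. energy n (f \<omega>)) \<in> borel_measurable M"
  unfolding energy_def using assms by (intro borel_measurable_sum borel_measurable_power) auto

lemma measurable_PiM_componentD:
  assumes "f \<in> M \<rightarrow>\<^sub>M (\<Pi>\<^sub>M i\<in>{..<n}. borel)" "i < n"
  shows "(\<lambda>\<omega>. f \<omega> i) \<in> M \<rightarrow>\<^sub>M borel"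
  using assms by (intro measurable_compose[OF assms(1)] measurable_component_singleton) auto

lemma superpose_measurable [measurable (raw)]:
  assumes "f \<in> M \<rightarrow>\<^sub>M (\<Pi>\<^sub>M i\<in>{..<n}. borel)" "g \<in> M \<rightarrow>\<^sub>M (\<Pi>\<^sub>M i\<in>{..<n}. borel)"
    "h \<in> M \<rightarrow>\<^sub>M (\<Pi>\<^sub>M i\<in>{..<n}. borel)"
  shows "(\<lambda>\<omega>. superpose a b n (f \<omega>) (g \<omega>) (h \<omega>)) \<in> M \<rightarrow>\<^sub>M (\<Pi>\<^sub>M i\<in>{..<n}. borel)"
  unfolding superpose_def
  by (intro measurable_restrict borel_measurable_add borel_measurable_times borel_measurable_const
      assms[THEN measurable_PiM_componentD]) auto

lemma scaled_add_measurable [measurable (raw)]: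
  assumes "f \<in> M \<rightarrow>\<^sub>M (\<Pi>\<^sub>M i\<in>{..<n}. borel)" "g \<in> M \<rightarrow>\<^sub>M (\<Pi>\<^sub>M i\<in>{..<n}. borel)"
  shows "(\<lambda>\<omega>. \<lambda>i\<in>{..<n}. a * f \<omega> i + g \<omega> i :: real) \<in> M \<rightarrow>\<^sub>M (\<Pi>\<^sub>M i\<in>{..<n}. borel)"
  by (intro measurable_restrict borel_measurable_add borel_measurable_times borel_measurable_const
      assms[THEN measurable_PiM_componentD]) auto

lemma indicator_energy_measurable:
  assumes f: "f \<in> M \<rightarrow>\<^sub>M (\<Pi>\<^sub>M i\<in>{..<n}. borel)"
  shows "(\<lambda>\<omega>. indicator {z. c < energy n z} (f \<omega>) :: ennreal) \<in> borel_measurable M"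
    and "(\<lambda>\<omega>. indicator {z. energy n z < c} (f \<omega>) :: ennreal) \<in> borel_measurable M"
proof -
  have [measurable]: "(\<lambda>\<omega>. energy n (f \<omega>)) \<in> borel_measurable M"
    by (intro energy_measurable measurable_PiM_componentD[OF f])
  have "(\<lambda>\<omega>. indicator {c<..} (energy n (f \<omega>)) :: ennreal) \<in> borel_measurable M" by measurable
  then show "(\<lambda>\<omega>. indicator {z. c < energy n z} (f \<omega>) :: ennreal) \<in> borel_measurable M"
    by (simp add: indicator_def)
  have "(\<lambda>\<omega>. indicator {..<c} (energy n (f \<omega>)) :: ennreal) \<in> borel_measurable M" by measurable
  then show "(\<lambda>\<omega>. indicator {z. energy n z < c} (f \<omega>) :: ennreal) \<in> borel_measurable M"
    by (simp add: indicator_def)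
qed

lemma typical_measurable [measurable (raw)]:
  assumes "f \<in> M \<rightarrow>\<^sub>M (\<Pi>\<^sub>M i\<in>{..<n}. borel)" "g \<in> M \<rightarrow>\<^sub>M (\<Pi>\<^sub>M i\<in>{..<n}. borel)"
    "h \<in> M \<rightarrow>\<^sub>M (\<Pi>\<^sub>M i\<in>{..<n}. borel)"
  shows "Measurable.pred M (\<lambda>\<omega>. typical a b N \<delta> n (f \<omega>) (g \<omega>) (h \<omega>))"
proof -
  note [measurable] = assms[THEN measurable_PiM_componentD]
  show ?thesis unfolding typical_def by measurable
qed

text \<open>For the true codewords each test concerns the energy of a sum of independent Gaussian
  vectors. The nested restriction in the last case has the shape required for two successive uses of
  \<open>gauss_convolution\<close>.\<close>

lemma not_typical_cases:
  assumes "\<not> typical a b N \<delta> n x1 x2 (superpose a b n x1 x2 z)"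
  shows "real n * (1 + \<delta>) < energy n x1 \<or> real n * (1 + \<delta>) < energy n x2
    \<or> real n * N * (1 + \<delta>) < energy n z
    \<or> energy n (\<lambda>i\<in>{..<n}. a * x1 i + z i) < real n * (a\<^sup>2 + N) * (1 - \<delta>)
    \<or> energy n (\<lambda>i\<in>{..<n}. b * x2 i + z i) < real n * (b\<^sup>2 + N) * (1 - \<delta>)
    \<or> energy n (\<lambda>i\<in>{..<n}. a * x1 i + (\<lambda>i\<in>{..<n}. b * x2 i + z i) i) < real n * (a\<^sup>2 + (b\<^sup>2 + N)) * (1 - \<delta>)"
proof -
  let ?y = "superpose a b n x1 x2 z"
  have "energy n (\<lambda>i. ?y i - a * x1 i - b * x2 i) = energy n z"
    "energy n (\<lambda>i. ?y i - b * x2 i) = energy n (\<lambda>i\<in>{..<n}. a * x1 i + z i)"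
    "energy n (\<lambda>i. ?y i - a * x1 i) = energy n (\<lambda>i\<in>{..<n}. b * x2 i + z i)"
    "energy n ?y = energy n (\<lambda>i\<in>{..<n}. a * x1 i + (\<lambda>i\<in>{..<n}. b * x2 i + z i) i)"
    by (auto intro!: energy_cong simp: superpose_def)
  then show ?thesis using assms by (auto simp: typical_def not_le)
qed

section \<open>Iterated integrals over two codewords and the noise\<close>

lemma nn_integral_triple:
  assumes "sigma_finite_measure M2" "sigma_finite_measure M3"
    and [measurable]: "(\<lambda>(x, y, z). f x y z) \<in> borel_measurable (M1 \<Otimes>\<^sub>M M2 \<Otimes>\<^sub>M M3)"
  shows "(\<integral>\<^sup>+x. \<integral>\<^sup>+y. \<integral>\<^sup>+z. f x y z \<partial>M3 \<partial>M2 \<partial>M1) = (\<integral>\<^sup>+(x, y, z). f x y z \<partial>(M1 \<Otimes>\<^sub>M M2 \<Otimes>\<^sub>M M3))"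
proof -
  interpret M2: sigma_finite_measure M2 by fact
  interpret M3: sigma_finite_measure M3 by fact
  interpret M23: pair_sigma_finite M2 M3 ..
  have "(\<integral>\<^sup>+(x, y, z). f x y z \<partial>(M1 \<Otimes>\<^sub>M M2 \<Otimes>\<^sub>M M3)) = (\<integral>\<^sup>+x. (\<integral>\<^sup>+(y, z). f x y z \<partial>(M2 \<Otimes>\<^sub>M M3)) \<partial>M1)"
    using M23.nn_integral_fst[OF assms(3)] by (simp add: case_prod_beta')
  also have "\<dots> = (\<integral>\<^sup>+x. \<integral>\<^sup>+y. \<integral>\<^sup>+z. f x y z \<partial>M3 \<partial>M2 \<partial>M1)"
  proof (rule nn_integral_cong)
    fix x assume "x \<in> space M1"
    from measurable_compose[OF measurable_Pair1'[OF this] assms(3)]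
    have "(\<lambda>(y, z). f x y z) \<in> borel_measurable (M2 \<Otimes>\<^sub>M M3)" by (simp add: case_prod_beta')
    from M3.nn_integral_fst[OF this] show "(\<integral>\<^sup>+(y, z). f x y z \<partial>(M2 \<Otimes>\<^sub>M M3)) = (\<integral>\<^sup>+y. \<integral>\<^sup>+z. f x y z \<partial>M3 \<partial>M2)"
      by simp
  qed
  finally show ?thesis ..
qed

text \<open>Additivity is obtained on the product space from joint measurability. The second claim
  returns joint measurability of the sum, so that the rule can be iterated over many
  summands.\<close>

lemma nn_integral_triple_add:
  assumes "sigma_finite_measure M2" "sigma_finite_measure M3"
    and [measurable]: "(\<lambda>(x, y, z). f x y z) \<in> borel_measurable (M1 \<Otimes>\<^sub>M M2 \<Otimes>\<^sub>M M3)"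
      "(\<lambda>(x, y, z). g x y z) \<in> borel_measurable (M1 \<Otimes>\<^sub>M M2 \<Otimes>\<^sub>M M3)"
  shows "(\<integral>\<^sup>+x. \<integral>\<^sup>+y. \<integral>\<^sup>+z. f x y z + g x y z \<partial>M3 \<partial>M2 \<partial>M1)
    = (\<integral>\<^sup>+x. \<integral>\<^sup>+y. \<integral>\<^sup>+z. f x y z \<partial>M3 \<partial>M2 \<partial>M1) + (\<integral>\<^sup>+x. \<integral>\<^sup>+y. \<integral>\<^sup>+z. g x y z \<partial>M3 \<partial>M2 \<partial>M1)"
    and "(\<lambda>(x, y, z). f x y z + g x y z) \<in> borel_measurable (M1 \<Otimes>\<^sub>M M2 \<Otimes>\<^sub>M M3)"
proof -
  have "(\<lambda>w. (case w of (x, y, z) \<Rightarrow> f x y z) + (case w of (x, y, z) \<Rightarrow> g x y z)) \<in> borel_measurable (M1 \<Otimes>\<^sub>M M2 \<Otimes>\<^sub>M M3)"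
    by measurable
  then show m: "(\<lambda>(x, y, z). f x y z + g x y z) \<in> borel_measurable (M1 \<Otimes>\<^sub>M M2 \<Otimes>\<^sub>M M3)"
    by (simp add: case_prod_beta')
  show "(\<integral>\<^sup>+x. \<integral>\<^sup>+y. \<integral>\<^sup>+z. f x y z + g x y z \<partial>M3 \<partial>M2 \<partial>M1)
    = (\<integral>\<^sup>+x. \<integral>\<^sup>+y. \<integral>\<^sup>+z. f x y z \<partial>M3 \<partial>M2 \<partial>M1) + (\<integral>\<^sup>+x. \<integral>\<^sup>+y. \<integral>\<^sup>+z. g x y z \<partial>M3 \<partial>M2 \<partial>M1)"
    unfolding nn_integral_triple[OF assms(1-3)] nn_integral_triple[OF assms(1,2,4)]
      nn_integral_triple[OF assms(1,2) m]
    by (subst nn_integral_add[symmetric, OF assms(3,4)]) (simp add: case_prod_beta')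
qed

section \<open>Error events for independent Gaussian codewords\<close>

locale gauss_mac =
  fixes a b N \<delta> :: real and n :: nat
  assumes N: "0 < N" and \<delta>: "0 < \<delta>" "\<delta> < 1"
begin

abbreviation G :: "(nat \<Rightarrow> real) measure" where "G \<equiv> gauss (\<lambda>_. 0) 1 n"
abbreviation \<nu> :: "(nat \<Rightarrow> real) measure" where "\<nu> \<equiv> gauss (\<lambda>_. 0) N n"
abbreviation T where "T \<equiv> typical a b N \<delta> n"

sublocale G: prob_space G by (rule prob_space_gauss) simp
sublocale \<nu>: prob_space \<nu> by (rule prob_space_gauss) (rule N)
sublocale GG: pair_prob_space G G ..

lemma a2N: "0 < a\<^sup>2 + N" "0 < b\<^sup>2 + N" "0 < a\<^sup>2 + (b\<^sup>2 + N)"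
  using N by (auto intro!: add_nonneg_pos)

lemma upper_tail:
  assumes "0 < s"
  shows "(\<integral>\<^sup>+z. indicator {z. real n * s * (1 + \<delta>) < energy n z} z \<partial>gauss (\<lambda>_. 0) s n)
    \<le> ennreal (exp (real n / 2 * (ln (1 + \<delta>) - \<delta>)))"
proof -
  let ?A = "{z \<in> space (\<Pi>\<^sub>M i\<in>{..<n}. borel). real n * s * (1 + \<delta>) < energy n z}"
  have [measurable]: "?A \<in> sets (\<Pi>\<^sub>M i\<in>{..<n}. borel)" by measurable
  have "(\<integral>\<^sup>+z. indicator {z. real n * s * (1 + \<delta>) < energy n z} z \<partial>gauss (\<lambda>_. 0) s n)
      = (\<integral>\<^sup>+z. indicator ?A z \<partial>gauss (\<lambda>_. 0) s n)"
    by (intro nn_integral_cong) (auto simp: indicator_def space_gauss space_PiM)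
  also have "\<dots> = emeasure (gauss (\<lambda>_. 0) s n) ?A"
    by (rule nn_integral_indicator) measurable
  also have "\<dots> \<le> ennreal (exp (real n / 2 * (ln (1 + \<delta>) - \<delta>)))"
    using \<delta> by (intro gauss_energy_tail assms) (auto simp: energy_def)
  finally show ?thesis .
qed

lemma lower_tail:
  assumes "0 < s"
  shows "(\<integral>\<^sup>+z. indicator {z. energy n z < real n * s * (1 - \<delta>)} z \<partial>gauss (\<lambda>_. 0) s n)
    \<le> ennreal (exp (real n / 2 * (ln (1 - \<delta>) + \<delta>)))"
proof -
  let ?A = "{z \<in> space (\<Pi>\<^sub>M i\<in>{..<n}. borel). energy n z < real n * s * (1 - \<delta>)}"
  have [measurable]: "?A \<in> sets (\<Pi>\<^sub>M i\<in>{..<n}. borel)" by measurable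
  have "(\<integral>\<^sup>+z. indicator {z. energy n z < real n * s * (1 - \<delta>)} z \<partial>gauss (\<lambda>_. 0) s n)
      = (\<integral>\<^sup>+z. indicator ?A z \<partial>gauss (\<lambda>_. 0) s n)"
    by (intro nn_integral_cong) (auto simp: indicator_def space_gauss space_PiM)
  also have "\<dots> = emeasure (gauss (\<lambda>_. 0) s n) ?A"
    by (rule nn_integral_indicator) measurable
  \<comment> \<open>The same Chernoff bound at \<open>\<tau> = - \<delta>\<close>; the negative
    factor reverses the energy inequality.\<close>
  also have "\<dots> \<le> ennreal (exp (real n / 2 * (ln (1 + - \<delta>) - - \<delta>)))"
    using \<delta> by (intro gauss_energy_tail assms) (auto simp: energy_def)
  finally show ?thesis by simp
qed

text \<open>Exponentially small in \<open>n\<close>, since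
  \<open>ln (1 + \<delta>) < \<delta>\<close> and \<open>ln (1 - \<delta>) < - \<delta>\<close>.
  Three upper and three lower tails make up the six tests, hence the factor 3 in the bounds
  below.\<close>

definition tail :: real where
  "tail = exp (real n / 2 * (ln (1 + \<delta>) - \<delta>)) + exp (real n / 2 * (ln (1 - \<delta>) + \<delta>))"

lemma true_codeword_atypical:
  "(\<integral>\<^sup>+x1. \<integral>\<^sup>+x2. \<integral>\<^sup>+z. indicator {z. \<not> T x1 x2 (superpose a b n x1 x2 z)} z \<partial>\<nu> \<partial>G \<partial>G)
    \<le> ennreal (3 * tail)" (is "?I \<le> _")
proof -
  let ?u = "\<lambda>s z. indicator {z. real n * s * (1 + \<delta>) < energy n z} z :: ennreal"
  let ?l = "\<lambda>s z. indicator {z. energy n z < real n * s * (1 - \<delta>)} z :: ennreal"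
  let ?U = "ennreal (exp (real n / 2 * (ln (1 + \<delta>) - \<delta>)))" and ?L = "ennreal (exp (real n / 2 * (ln (1 - \<delta>) + \<delta>)))"
  have [measurable]: "?u s \<in> borel_measurable (\<Pi>\<^sub>M i\<in>{..<n}. borel)" for s
    by measurable
  have [measurable]: "?l s \<in> borel_measurable (\<Pi>\<^sub>M i\<in>{..<n}. borel)" for s
    by measurable
  let ?t1 = "\<lambda>x1 x2 z. ?u 1 x1" and ?t2 = "\<lambda>x1 x2 z. ?u 1 x2" and ?t3 = "\<lambda>x1 x2 z. ?u N z"
    and ?t4 = "\<lambda>x1 x2 z. ?l (a\<^sup>2 + N) (\<lambda>i\<in>{..<n}. a * x1 i + z i)"
    and ?t5 = "\<lambda>x1 x2 z. ?l (b\<^sup>2 + N) (\<lambda>i\<in>{..<n}. b * x2 i + z i)"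
    and ?t6 ="\<lambda>x1 x2 z. ?l (a\<^sup>2 + (b\<^sup>2 + N)) (\<lambda>i\<in>{..<n}. a * x1 i + (\<lambda>i\<in>{..<n}. b * x2 i + z i) i)"
  have proj: "fst \<in> (G \<Otimes>\<^sub>M G \<Otimes>\<^sub>M \<nu>) \<rightarrow>\<^sub>M (\<Pi>\<^sub>M i\<in>{..<n}. borel)"
    "(\<lambda>w. fst (snd w)) \<in> (G \<Otimes>\<^sub>M G \<Otimes>\<^sub>M \<nu>) \<rightarrow>\<^sub>M (\<Pi>\<^sub>M i\<in>{..<n}. borel)"
    "(\<lambda>w. snd (snd w)) \<in> (G \<Otimes>\<^sub>M G \<Otimes>\<^sub>M \<nu>) \<rightarrow>\<^sub>M (\<Pi>\<^sub>M i\<in>{..<n}. borel)"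
    by measurable
  have measm: "(\<lambda>(x1, x2, z). ?t1 x1 x2 z) \<in> borel_measurable (G \<Otimes>\<^sub>M G \<Otimes>\<^sub>M \<nu>)"
    "(\<lambda>(x1, x2, z). ?t2 x1 x2 z) \<in> borel_measurable (G \<Otimes>\<^sub>M G \<Otimes>\<^sub>M \<nu>)"
    "(\<lambda>(x1, x2, z). ?t3 x1 x2 z) \<in> borel_measurable (G \<Otimes>\<^sub>M G \<Otimes>\<^sub>M \<nu>)"
    "(\<lambda>(x1, x2, z). ?t4 x1 x2 z) \<in> borel_measurable (G \<Otimes>\<^sub>M G \<Otimes>\<^sub>M \<nu>)"
    "(\<lambda>(x1, x2, z). ?t5 x1 x2 z) \<in> borel_measurable (G \<Otimes>\<^sub>M G \<Otimes>\<^sub>M \<nu>)"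
    "(\<lambda>(x1, x2, z). ?t6 x1 x2 z) \<in> borel_measurable (G \<Otimes>\<^sub>M G \<Otimes>\<^sub>M \<nu>)"
    unfolding case_prod_beta'
    by (intro proj indicator_energy_measurable scaled_add_measurable)+
  note triple_add = nn_integral_triple_add[OF G.sigma_finite_measure_axioms \<nu>.sigma_finite_measure_axioms]
  have "?I \<le> (\<integral>\<^sup>+x1. \<integral>\<^sup>+x2. \<integral>\<^sup>+z. ?t1 x1 x2 z + (?t2 x1 x2 z + (?t3 x1 x2 z + (?t4 x1 x2 z + (?t5 x1 x2 z + ?t6 x1 x2 z)))) \<partial>\<nu> \<partial>G \<partial>G)"
  proof (intro nn_integral_mono)
    fix x1 x2 z
    show "indicator {z. \<not> T x1 x2 (superpose a b n x1 x2 z)} z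
      \<le> ?t1 x1 x2 z + (?t2 x1 x2 z + (?t3 x1 x2 z + (?t4 x1 x2 z + (?t5 x1 x2 z + ?t6 x1 x2 z))))"
    proof (cases "T x1 x2 (superpose a b n x1 x2 z)")
      case False
      from not_typical_cases[OF this] show ?thesis using False
        by (elim disjE) (simp_all add: add_increasing add_increasing2)
    qed simp
  qed
  also have "\<dots> = (\<integral>\<^sup>+x1. \<integral>\<^sup>+x2. \<integral>\<^sup>+z. ?t1 x1 x2 z \<partial>\<nu> \<partial>G \<partial>G) + ((\<integral>\<^sup>+x1. \<integral>\<^sup>+x2. \<integral>\<^sup>+z. ?t2 x1 x2 z \<partial>\<nu> \<partial>G \<partial>G)
      + ((\<integral>\<^sup>+x1. \<integral>\<^sup>+x2. \<integral>\<^sup>+z. ?t3 x1 x2 z \<partial>\<nu> \<partial>G \<partial>G) + ((\<integral>\<^sup>+x1. \<integral>\<^sup>+x2. \<integral>\<^sup>+z. ?t4 x1 x2 z \<partial>\<nu> \<partial>G \<partial>G)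
      + ((\<integral>\<^sup>+x1. \<integral>\<^sup>+x2. \<integral>\<^sup>+z. ?t5 x1 x2 z \<partial>\<nu> \<partial>G \<partial>G) + (\<integral>\<^sup>+x1. \<integral>\<^sup>+x2. \<integral>\<^sup>+z. ?t6 x1 x2 z \<partial>\<nu> \<partial>G \<partial>G)))))"
    by (simp only: triple_add measm)
  also have "\<dots> \<le> ?U + (?U + (?U + (?L + (?L + ?L))))"
  proof (intro add_mono)
    show "(\<integral>\<^sup>+x1. \<integral>\<^sup>+x2. \<integral>\<^sup>+z. ?t1 x1 x2 z \<partial>\<nu> \<partial>G \<partial>G) \<le> ?U"
      using upper_tail[of 1] by (simp add: \<nu>.emeasure_space_1 G.emeasure_space_1)
    show "(\<integral>\<^sup>+x1. \<integral>\<^sup>+x2. \<integral>\<^sup>+z. ?t2 x1 x2 z \<partial>\<nu> \<partial>G \<partial>G) \<le> ?U"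
      using upper_tail[of 1] by (simp add: \<nu>.emeasure_space_1 G.emeasure_space_1)
    show "(\<integral>\<^sup>+x1. \<integral>\<^sup>+x2. \<integral>\<^sup>+z. ?t3 x1 x2 z \<partial>\<nu> \<partial>G \<partial>G) \<le> ?U"
      using upper_tail[OF N] by (simp add: \<nu>.emeasure_space_1 G.emeasure_space_1)
    \<comment> \<open>The term \<open>?t4\<close> does not depend on \<open>x2\<close>, whose
      integral is therefore trivial; \<open>x1\<close> is repeated merely to fill the argument. For
      \<open>?t5\<close> it is the outer variable that drops out.\<close>
    have "(\<integral>\<^sup>+x1. \<integral>\<^sup>+x2. \<integral>\<^sup>+z. ?t4 x1 x2 z \<partial>\<nu> \<partial>G \<partial>G) = (\<integral>\<^sup>+x1. \<integral>\<^sup>+z. ?t4 x1 x1 z \<partial>\<nu> \<partial>G)"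
      by (simp add: G.emeasure_space_1)
    then show "(\<integral>\<^sup>+x1. \<integral>\<^sup>+x2. \<integral>\<^sup>+z. ?t4 x1 x2 z \<partial>\<nu> \<partial>G \<partial>G) \<le> ?L"
      using lower_tail[OF a2N(1)] by (simp only: gauss_convolution[OF N \<open>?l _ \<in> _\<close>])
    have "(\<integral>\<^sup>+x1. \<integral>\<^sup>+x2. \<integral>\<^sup>+z. ?t5 x1 x2 z \<partial>\<nu> \<partial>G \<partial>G) = (\<integral>\<^sup>+x1. \<integral>\<^sup>+z. ?t5 x1 x1 z \<partial>\<nu> \<partial>G)"
      by (simp add: G.emeasure_space_1)
    then show "(\<integral>\<^sup>+x1. \<integral>\<^sup>+x2. \<integral>\<^sup>+z. ?t5 x1 x2 z \<partial>\<nu> \<partial>G \<partial>G) \<le> ?L"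
      using lower_tail[OF a2N(2)] by (simp only: gauss_convolution[OF N \<open>?l _ \<in> _\<close>])
    have "(\<integral>\<^sup>+x1. \<integral>\<^sup>+x2. \<integral>\<^sup>+z. ?t6 x1 x2 z \<partial>\<nu> \<partial>G \<partial>G)
      = (\<integral>\<^sup>+x1. \<integral>\<^sup>+u. ?l (a\<^sup>2 + (b\<^sup>2 + N)) (\<lambda>i\<in>{..<n}. a * x1 i + u i) \<partial>gauss (\<lambda>_. 0) (b\<^sup>2 + N) n \<partial>G)"
    proof (rule nn_integral_cong)
      fix x1 assume "x1 \<in> space G"
      show "(\<integral>\<^sup>+x2. \<integral>\<^sup>+z. ?t6 x1 x2 z \<partial>\<nu> \<partial>G)
        = (\<integral>\<^sup>+u. ?l (a\<^sup>2 + (b\<^sup>2 + N)) (\<lambda>i\<in>{..<n}. a * x1 i + u i) \<partial>gauss (\<lambda>_. 0) (b\<^sup>2 + N) n)"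
        by (rule gauss_convolution[OF N]) measurable
    qed
    also have "\<dots> = (\<integral>\<^sup>+u. ?l (a\<^sup>2 + (b\<^sup>2 + N)) u \<partial>gauss (\<lambda>_. 0) (a\<^sup>2 + (b\<^sup>2 + N)) n)"
      by (rule gauss_convolution[OF a2N(2)]) measurable
    also have "\<dots> \<le> ?L" by (rule lower_tail[OF a2N(3)])
    finally show "(\<integral>\<^sup>+x1. \<integral>\<^sup>+x2. \<integral>\<^sup>+z. ?t6 x1 x2 z \<partial>\<nu> \<partial>G \<partial>G) \<le> ?L" .
  qed
  also have "\<dots> = ennreal (3 * tail)"
    by (simp add: tail_def ennreal_plus[symmetric] del: ennreal_plus)
  finally show ?thesis .
qed

lemma confusion_bound:
  assumes s: "0 < s" "0 < t" and [measurable]: "Measurable.pred (\<Pi>\<^sub>M i\<in>{..<n}. borel) Q"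
    and "\<And>u. Q u \<Longrightarrow> real n * s * (1 - \<delta>) \<le> energy n u"
      "\<And>u. Q u \<Longrightarrow> energy n (\<lambda>i. u i - m i) \<le> real n * t * (1 + \<delta>)"
  shows "(\<integral>\<^sup>+u. indicator {u. Q u} u \<partial>gauss (\<lambda>_. 0) s n) \<le> ennreal (exp (- real n * (ln (s / t) / 2 - \<delta>)))"
proof -
  let ?A = "{z \<in> space (\<Pi>\<^sub>M i\<in>{..<n}. borel). Q z}"
  have "(\<integral>\<^sup>+u. indicator {u. Q u} u \<partial>gauss (\<lambda>_. 0) s n) = (\<integral>\<^sup>+u. indicator ?A u \<partial>gauss (\<lambda>_. 0) s n)"
    by (intro nn_integral_cong) (auto simp: indicator_def space_gauss space_PiM)
  also have "\<dots> = emeasure (gauss (\<lambda>_. 0) s n) ?A"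
    by (rule nn_integral_indicator) measurable
  also have "\<dots> \<le> ennreal (exp (- real n * (ln (s / t) / 2 - \<delta>)))"
    using assms by (intro gauss_confusion) (auto simp: energy_def)
  finally show ?thesis .
qed

text \<open>Subtracting the correct \<open>x2\<close> leaves a vector of variance
  \<open>a\<^sup>2 + N\<close> that has nothing to do with \<open>x1'\<close>. Typicality would
  require it to have full energy and yet to lie close to \<open>a * x1'\<close>, which is the
  situation of \<open>gauss_confusion\<close>.\<close>

lemma confusion1:
  assumes [measurable]: "x1' \<in> space (\<Pi>\<^sub>M i\<in>{..<n}. borel)" "x2 \<in> space (\<Pi>\<^sub>M i\<in>{..<n}. borel)"
  shows "(\<integral>\<^sup>+x1. \<integral>\<^sup>+z. indicator {z. T x1' x2 (superpose a b n x1 x2 z)} z \<partial>\<nu> \<partial>G)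
    \<le> ennreal (exp (- real n * (ln ((a\<^sup>2 + N) / N) / 2 - \<delta>)))"
proof -
  let ?Q = "\<lambda>u. T x1' x2 (\<lambda>i\<in>{..<n}. b * x2 i + u i)"
  have [measurable]: "(\<lambda>u. \<lambda>i\<in>{..<n}. b * x2 i + u i) \<in> (\<Pi>\<^sub>M i\<in>{..<n}. borel) \<rightarrow>\<^sub>M (\<Pi>\<^sub>M i\<in>{..<n}. borel)"
    by measurable
  have [measurable]: "Measurable.pred (\<Pi>\<^sub>M i\<in>{..<n}. borel) ?Q" by measurable
  have "(\<integral>\<^sup>+x1. \<integral>\<^sup>+z. indicator {z. T x1' x2 (superpose a b n x1 x2 z)} z \<partial>\<nu> \<partial>G)
    = (\<integral>\<^sup>+x1. \<integral>\<^sup>+z. indicator {u. ?Q u} (\<lambda>i\<in>{..<n}. a * x1 i + z i) \<partial>\<nu> \<partial>G)"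
  proof (intro nn_integral_cong)
    fix x1 z
    have "superpose a b n x1 x2 z = (\<lambda>i\<in>{..<n}. b * x2 i + (\<lambda>i\<in>{..<n}. a * x1 i + z i) i)"
      by (auto simp: superpose_def fun_eq_iff)
    then show "(indicator {z. T x1' x2 (superpose a b n x1 x2 z)} z :: ennreal)
      = indicator {u. ?Q u} (\<lambda>i\<in>{..<n}. a * x1 i + z i)"
      by (simp only: indicator_def mem_Collect_eq)
  qed
  also have "\<dots> = (\<integral>\<^sup>+u. indicator {u. ?Q u} u \<partial>gauss (\<lambda>_. 0) (a\<^sup>2 + N) n)"
    by (rule gauss_convolution[OF N]) measurable
  also have "\<dots> \<le> ennreal (exp (- real n * (ln ((a\<^sup>2 + N) / N) / 2 - \<delta>)))"
  proof (rule confusion_bound[where m = "\<lambda>i. a * x1' i"])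
    fix u assume u: "?Q u"
    have "energy n (\<lambda>i. (\<lambda>i\<in>{..<n}. b * x2 i + u i) i - b * x2 i) = energy n u"
      "energy n (\<lambda>i. (\<lambda>i\<in>{..<n}. b * x2 i + u i) i - a * x1' i - b * x2 i) = energy n (\<lambda>i. u i - a * x1' i)"
      by (auto intro!: energy_cong)
    with u show "real n * (a\<^sup>2 + N) * (1 - \<delta>) \<le> energy n u"
      "energy n (\<lambda>i. u i - a * x1' i) \<le> real n * N * (1 + \<delta>)"
      by (simp_all add: typical_def)
  qed (use a2N N in auto)
  finally show ?thesis .
qed

lemma confusion2:
  assumes [measurable]: "x1 \<in> space (\<Pi>\<^sub>M i\<in>{..<n}. borel)" "x2' \<in> space (\<Pi>\<^sub>M i\<in>{..<n}. borel)"
  shows "(\<integral>\<^sup>+x2. \<integral>\<^sup>+z. indicator {z. T x1 x2' (superpose a b n x1 x2 z)} z \<partial>\<nu> \<partial>G)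
    \<le> ennreal (exp (- real n * (ln ((b\<^sup>2 + N) / N) / 2 - \<delta>)))"
proof -
  let ?Q = "\<lambda>u. T x1 x2' (\<lambda>i\<in>{..<n}. a * x1 i + u i)"
  have [measurable]: "(\<lambda>u. \<lambda>i\<in>{..<n}. a * x1 i + u i) \<in> (\<Pi>\<^sub>M i\<in>{..<n}. borel) \<rightarrow>\<^sub>M (\<Pi>\<^sub>M i\<in>{..<n}. borel)"
    by measurable
  have [measurable]: "Measurable.pred (\<Pi>\<^sub>M i\<in>{..<n}. borel) ?Q" by measurable
  have "(\<integral>\<^sup>+x2. \<integral>\<^sup>+z. indicator {z. T x1 x2' (superpose a b n x1 x2 z)} z \<partial>\<nu> \<partial>G)
    = (\<integral>\<^sup>+x2. \<integral>\<^sup>+z. indicator {u. ?Q u} (\<lambda>i\<in>{..<n}. b * x2 i + z i) \<partial>\<nu> \<partial>G)"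
  proof (intro nn_integral_cong)
    fix x2 z
    have "superpose a b n x1 x2 z = (\<lambda>i\<in>{..<n}. a * x1 i + (\<lambda>i\<in>{..<n}. b * x2 i + z i) i)"
      by (auto simp: superpose_def fun_eq_iff)
    then show "(indicator {z. T x1 x2' (superpose a b n x1 x2 z)} z :: ennreal)
      = indicator {u. ?Q u} (\<lambda>i\<in>{..<n}. b * x2 i + z i)"
      by (simp only: indicator_def mem_Collect_eq)
  qed
  also have "\<dots> = (\<integral>\<^sup>+u. indicator {u. ?Q u} u \<partial>gauss (\<lambda>_. 0) (b\<^sup>2 + N) n)"
    by (rule gauss_convolution[OF N]) measurable
  also have "\<dots> \<le> ennreal (exp (- real n * (ln ((b\<^sup>2 + N) / N) / 2 - \<delta>)))"
  proof (rule confusion_bound[where m = "\<lambda>i. b * x2' i"])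
    fix u assume u: "?Q u"
    have "energy n (\<lambda>i. (\<lambda>i\<in>{..<n}. a * x1 i + u i) i - a * x1 i) = energy n u"
      "energy n (\<lambda>i. (\<lambda>i\<in>{..<n}. a * x1 i + u i) i - a * x1 i - b * x2' i) = energy n (\<lambda>i. u i - b * x2' i)"
      by (auto intro!: energy_cong)
    with u show "real n * (b\<^sup>2 + N) * (1 - \<delta>) \<le> energy n u"
      "energy n (\<lambda>i. u i - b * x2' i) \<le> real n * N * (1 + \<delta>)"
      by (simp_all add: typical_def)
  qed (use a2N N in auto)
  finally show ?thesis .
qed

text \<open>With both candidates wrong, nothing can be subtracted: both true codewords act as noise,
  and the whole output of variance \<open>a\<^sup>2 + (b\<^sup>2 + N)\<close> has to lie close to an
  unrelated centre.\<close>

lemma confusion12: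
  assumes [measurable]: "x1' \<in> space (\<Pi>\<^sub>M i\<in>{..<n}. borel)" "x2' \<in> space (\<Pi>\<^sub>M i\<in>{..<n}. borel)"
  shows "(\<integral>\<^sup>+x1. \<integral>\<^sup>+x2. \<integral>\<^sup>+z. indicator {z. T x1' x2' (superpose a b n x1 x2 z)} z \<partial>\<nu> \<partial>G \<partial>G)
    \<le> ennreal (exp (- real n * (ln ((a\<^sup>2 + (b\<^sup>2 + N)) / N) / 2 - \<delta>)))"
proof -
  let ?Q = "\<lambda>u. T x1' x2' u"
  have [measurable]: "Measurable.pred (\<Pi>\<^sub>M i\<in>{..<n}. borel) ?Q" by measurable
  have "(\<integral>\<^sup>+x1. \<integral>\<^sup>+x2. \<integral>\<^sup>+z. indicator {z. T x1' x2' (superpose a b n x1 x2 z)} z \<partial>\<nu> \<partial>G \<partial>G)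
    = (\<integral>\<^sup>+x1. \<integral>\<^sup>+v. indicator {u. ?Q u} (\<lambda>i\<in>{..<n}. a * x1 i + v i) \<partial>gauss (\<lambda>_. 0) (b\<^sup>2 + N) n \<partial>G)"
  proof (rule nn_integral_cong)
    fix x1 assume [measurable]: "x1 \<in> space G"
    have [measurable]: "(\<lambda>v. \<lambda>i\<in>{..<n}. a * x1 i + v i) \<in> (\<Pi>\<^sub>M i\<in>{..<n}. borel) \<rightarrow>\<^sub>M (\<Pi>\<^sub>M i\<in>{..<n}. borel)"
      by measurable
    have "superpose a b n x1 x2 z = (\<lambda>i\<in>{..<n}. a * x1 i + (\<lambda>i\<in>{..<n}. b * x2 i + z i) i)" for x2 z
      by (auto simp: superpose_def fun_eq_iff)
    then have "(\<integral>\<^sup>+x2. \<integral>\<^sup>+z. indicator {z. T x1' x2' (superpose a b n x1 x2 z)} z \<partial>\<nu> \<partial>G)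
      = (\<integral>\<^sup>+x2. \<integral>\<^sup>+z. indicator {u. ?Q u} (\<lambda>i\<in>{..<n}. a * x1 i + (\<lambda>i\<in>{..<n}. b * x2 i + z i) i) \<partial>\<nu> \<partial>G)"
      by (simp only: indicator_def mem_Collect_eq)
    also have "\<dots> = (\<integral>\<^sup>+v. indicator {u. ?Q u} (\<lambda>i\<in>{..<n}. a * x1 i + v i) \<partial>gauss (\<lambda>_. 0) (b\<^sup>2 + N) n)"
      by (rule gauss_convolution[OF N]) measurable
    finally show "(\<integral>\<^sup>+x2. \<integral>\<^sup>+z. indicator {z. T x1' x2' (superpose a b n x1 x2 z)} z \<partial>\<nu> \<partial>G)
      = (\<integral>\<^sup>+v. indicator {u. ?Q u} (\<lambda>i\<in>{..<n}. a * x1 i + v i) \<partial>gauss (\<lambda>_. 0) (b\<^sup>2 + N) n)" .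
  qed
  also have "\<dots> = (\<integral>\<^sup>+u. indicator {u. ?Q u} u \<partial>gauss (\<lambda>_. 0) (a\<^sup>2 + (b\<^sup>2 + N)) n)"
    by (rule gauss_convolution[OF a2N(2)]) measurable
  also have "\<dots> \<le> ennreal (exp (- real n * (ln ((a\<^sup>2 + (b\<^sup>2 + N)) / N) / 2 - \<delta>)))"
  proof (rule confusion_bound[where m = "\<lambda>i. a * x1' i + b * x2' i"])
    fix u assume u: "?Q u"
    then show "real n * (a\<^sup>2 + (b\<^sup>2 + N)) * (1 - \<delta>) \<le> energy n u"
      "energy n (\<lambda>i. u i - (a * x1' i + b * x2' i)) \<le> real n * N * (1 + \<delta>)"
      by (simp_all add: typical_def diff_diff_eq)
  qed (use a2N N in auto)
  finally show ?thesis .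
qed

end

section \<open>Averages over random codebooks\<close>

lemma nn_integral_PiM_component:
  assumes G: "prob_space G" and I: "finite I" "w \<in> I" and f: "f \<in> borel_measurable G"
  shows "(\<integral>\<^sup>+c. f (c w) \<partial>(\<Pi>\<^sub>M i\<in>I. G)) = (\<integral>\<^sup>+x. f x \<partial>G)"
proof -
  have "distr (\<Pi>\<^sub>M i\<in>I. G) G (\<lambda>c. c w) = G"
    using I G by (intro distr_PiM_component) auto
  then have "(\<integral>\<^sup>+x. f x \<partial>G) = (\<integral>\<^sup>+x. f x \<partial>distr (\<Pi>\<^sub>M i\<in>I. G) G (\<lambda>c. c w))" by simp
  also have "\<dots> = (\<integral>\<^sup>+c. f (c w) \<partial>(\<Pi>\<^sub>M i\<in>I. G))"
    using I f by (intro nn_integral_distr measurable_component_singleton) auto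
  finally show ?thesis ..
qed

text \<open>Codewords of distinct messages are independent draws: splitting off coordinate
  \<open>w\<close> leaves a product measure in which \<open>w'\<close> is still an ordinary
  coordinate.\<close>

lemma nn_integral_PiM_two_components:
  assumes G: "prob_space G" and I: "finite I" "w \<in> I" "w' \<in> I" "w \<noteq> w'"
    and f: "(\<lambda>(x, x'). f x x') \<in> borel_measurable (G \<Otimes>\<^sub>M G)"
  shows "(\<integral>\<^sup>+c. f (c w) (c w') \<partial>(\<Pi>\<^sub>M i\<in>I. G)) = (\<integral>\<^sup>+x. \<integral>\<^sup>+x'. f x x' \<partial>G \<partial>G)"
proof -
  interpret G: prob_space G by fact
  interpret product_sigma_finite "\<lambda>_. G" ..
  let ?J = "I - {w}"
  have I': "I = insert w ?J" using I by auto
  have "(\<lambda>c. (c w, c w')) \<in> (\<Pi>\<^sub>M i\<in>I. G) \<rightarrow>\<^sub>M G \<Otimes>\<^sub>M G"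
    using I by (intro measurable_Pair measurable_component_singleton)
  from measurable_compose[OF this f]
  have m: "(\<lambda>c. f (c w) (c w')) \<in> borel_measurable (\<Pi>\<^sub>M i\<in>insert w ?J. G)"
    using I' by simp
  have "(\<integral>\<^sup>+c. f (c w) (c w') \<partial>(\<Pi>\<^sub>M i\<in>I. G)) = (\<integral>\<^sup>+c. f (c w) (c w') \<partial>(\<Pi>\<^sub>M i\<in>insert w ?J. G))"
    using I' by simp
  also have "\<dots> = (\<integral>\<^sup>+x. \<integral>\<^sup>+c. f ((c(w := x)) w) ((c(w := x)) w') \<partial>(\<Pi>\<^sub>M i\<in>?J. G) \<partial>G)"
    using I m by (intro product_nn_integral_insert_rev) auto
  also have "\<dots> = (\<integral>\<^sup>+x. \<integral>\<^sup>+x'. f x x' \<partial>G \<partial>G)"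
  proof (rule nn_integral_cong)
    fix x assume "x \<in> space G"
    from measurable_compose[OF measurable_Pair1'[OF this] f]
    have "(\<lambda>x'. f x x') \<in> borel_measurable G" by simp
    then show "(\<integral>\<^sup>+c. f ((c(w := x)) w) ((c(w := x)) w') \<partial>(\<Pi>\<^sub>M i\<in>?J. G)) = (\<integral>\<^sup>+x'. f x x' \<partial>G)"
      using I nn_integral_PiM_component[OF G, of ?J w' "f x"] by simp
  qed
  finally show ?thesis .
qed

text \<open>The factor 2 leaves room for a strict contradiction when the mean is only bounded
  weakly. It is harmless, as the bound to which it is applied tends to zero.\<close>

lemma (in prob_space) nn_integral_le_imp_ex:
  assumes "(\<integral>\<^sup>+x. f x \<partial>M) \<le> ennreal B" "0 < B"
  shows "\<exists>x\<in>space M. f x \<le> ennreal (2 * B)"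
proof (rule ccontr)
  assume "\<not> ?thesis"
  then have "(\<integral>\<^sup>+x. ennreal (2 * B) \<partial>M) \<le> (\<integral>\<^sup>+x. f x \<partial>M)"
    by (intro nn_integral_mono) (auto simp: not_le intro: less_imp_le)
  with assms(1) have "ennreal (2 * B) \<le> ennreal B"
    by (simp add: emeasure_space_1)
  with assms(2) show False by simp
qed

lemma indicator_typical_measurable:
  assumes "f \<in> M \<rightarrow>\<^sub>M (\<Pi>\<^sub>M i\<in>{..<n}. borel)" "g \<in> M \<rightarrow>\<^sub>M (\<Pi>\<^sub>M i\<in>{..<n}. borel)"
    "p \<in> M \<rightarrow>\<^sub>M (\<Pi>\<^sub>M i\<in>{..<n}. borel)" "q \<in> M \<rightarrow>\<^sub>M (\<Pi>\<^sub>M i\<in>{..<n}. borel)"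
    "r \<in> M \<rightarrow>\<^sub>M (\<Pi>\<^sub>M i\<in>{..<n}. borel)"
  shows "(\<lambda>\<omega>. indicator {z. typical a b N \<delta> n (f \<omega>) (g \<omega>) (superpose a b n (p \<omega>) (q \<omega>) z)} (r \<omega>) :: ennreal)
      \<in> borel_measurable M"
    and "(\<lambda>\<omega>. indicator {z. \<not> typical a b N \<delta> n (f \<omega>) (g \<omega>) (superpose a b n (p \<omega>) (q \<omega>) z)} (r \<omega>) :: ennreal)
      \<in> borel_measurable M"
proof -
  have [measurable]: "Measurable.pred M (\<lambda>\<omega>. typical a b N \<delta> n (f \<omega>) (g \<omega>) (superpose a b n (p \<omega>) (q \<omega>) (r \<omega>)))"
    using assms by (intro typical_measurable superpose_measurable)
  show "(\<lambda>\<omega>. indicator {z. typical a b N \<delta> n (f \<omega>) (g \<omega>) (superpose a b n (p \<omega>) (q \<omega>) z)} (r \<omega>) :: ennreal)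
      \<in> borel_measurable M"
    unfolding indicator_def mem_Collect_eq of_bool_def by measurable
  show "(\<lambda>\<omega>. indicator {z. \<not> typical a b N \<delta> n (f \<omega>) (g \<omega>) (superpose a b n (p \<omega>) (q \<omega>) z)} (r \<omega>) :: ennreal)
      \<in> borel_measurable M"
    unfolding indicator_def mem_Collect_eq of_bool_def by measurable
qed

context gauss_mac
begin

text \<open>The primed pair is the candidate under test, the other pair is the one
  transmitted.\<close>

definition confusion_prob :: "(nat \<Rightarrow> real) \<Rightarrow> (nat \<Rightarrow> real) \<Rightarrow> (nat \<Rightarrow> real) \<Rightarrow> (nat \<Rightarrow> real) \<Rightarrow> ennreal" where
  "confusion_prob x1' x2' x1 x2 = (\<integral>\<^sup>+z. indicator {z. T x1' x2' (superpose a b n x1 x2 z)} z \<partial>\<nu>)"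

definition atypical_prob :: "(nat \<Rightarrow> real) \<Rightarrow> (nat \<Rightarrow> real) \<Rightarrow> ennreal" where
  "atypical_prob x1 x2 = (\<integral>\<^sup>+z. indicator {z. \<not> T x1 x2 (superpose a b n x1 x2 z)} z \<partial>\<nu>)"

lemma confusion_prob_measurable [measurable (raw)]:
  assumes [measurable]: "f \<in> M \<rightarrow>\<^sub>M (\<Pi>\<^sub>M i\<in>{..<n}. borel)" "g \<in> M \<rightarrow>\<^sub>M (\<Pi>\<^sub>M i\<in>{..<n}. borel)"
    "p \<in> M \<rightarrow>\<^sub>M (\<Pi>\<^sub>M i\<in>{..<n}. borel)" "q \<in> M \<rightarrow>\<^sub>M (\<Pi>\<^sub>M i\<in>{..<n}. borel)"
  shows "(\<lambda>\<omega>. confusion_prob (f \<omega>) (g \<omega>) (p \<omega>) (q \<omega>)) \<in> borel_measurable M"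
  unfolding confusion_prob_def
  by (rule \<nu>.borel_measurable_nn_integral, unfold case_prod_beta', rule indicator_typical_measurable; measurable)

lemma atypical_prob_measurable [measurable (raw)]:
  assumes [measurable]: "f \<in> M \<rightarrow>\<^sub>M (\<Pi>\<^sub>M i\<in>{..<n}. borel)" "g \<in> M \<rightarrow>\<^sub>M (\<Pi>\<^sub>M i\<in>{..<n}. borel)"
  shows "(\<lambda>\<omega>. atypical_prob (f \<omega>) (g \<omega>)) \<in> borel_measurable M"
  unfolding atypical_prob_def
  by (rule \<nu>.borel_measurable_nn_integral, unfold case_prod_beta', rule indicator_typical_measurable; measurable)

text \<open>One quantity for each way to err: in the first message only, in the second only, in
  both. Each exponent is the corresponding Gaussian mutual information, diminished by
  \<open>\<delta>\<close>.\<close>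

definition e1 :: real where "e1 = exp (- real n * (ln ((a\<^sup>2 + N) / N) / 2 - \<delta>))"
definition e2 :: real where "e2 = exp (- real n * (ln ((b\<^sup>2 + N) / N) / 2 - \<delta>))"
definition e12 :: real where "e12 = exp (- real n * (ln ((a\<^sup>2 + (b\<^sup>2 + N)) / N) / 2 - \<delta>))"

abbreviation codebook :: "nat \<Rightarrow> (nat \<Rightarrow> nat \<Rightarrow> real) measure" where
  "codebook K \<equiv> \<Pi>\<^sub>M w\<in>{..<K}. G"

lemma prob_space_codebook: "prob_space (codebook M)"
  by (intro prob_space_PiM G.prob_space_axioms)

lemma codeword_measurable:
  assumes "f \<in> M \<rightarrow>\<^sub>M (codebook K)" "w < K"
  shows "(\<lambda>\<omega>. f \<omega> w) \<in> M \<rightarrow>\<^sub>M (\<Pi>\<^sub>M i\<in>{..<n}. borel)"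
proof -
  have "(\<lambda>\<omega>. f \<omega> w) \<in> M \<rightarrow>\<^sub>M G"
    using assms(2) by (intro measurable_compose[OF assms(1)] measurable_component_singleton) auto
  then show ?thesis
    using measurable_cong_sets[OF refl sets_gauss, of M "\<lambda>_. 0" 1 n] by blast
qed

lemma codeword_space:
  assumes "c \<in> space (codebook K)" "w < K"
  shows "c w \<in> space G"
  using assms by (auto simp: space_PiM)

lemma space_G: "space G = space (\<Pi>\<^sub>M i\<in>{..<n}. borel)"
  by (simp add: space_gauss space_PiM)

lemma average_atypical:
  assumes w: "w1 < M1" "w2 < M2"
  shows "(\<integral>\<^sup>+c1. \<integral>\<^sup>+c2. atypical_prob (c1 w1) (c2 w2) \<partial>codebook M2 \<partial>codebook M1) \<le> ennreal (3 * tail)"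
proof -
  have "(\<integral>\<^sup>+c1. \<integral>\<^sup>+c2. atypical_prob (c1 w1) (c2 w2) \<partial>codebook M2 \<partial>codebook M1) = (\<integral>\<^sup>+c1. \<integral>\<^sup>+x2. atypical_prob (c1 w1) x2 \<partial>G \<partial>codebook M1)"
  proof (rule nn_integral_cong)
    fix c1 assume c1: "c1 \<in> space (codebook M1)"
    have [measurable]: "c1 w1 \<in> space (\<Pi>\<^sub>M i\<in>{..<n}. borel)"
      using codeword_space[OF c1 w(1)] space_G by simp
    show "(\<integral>\<^sup>+c2. atypical_prob (c1 w1) (c2 w2) \<partial>codebook M2) = (\<integral>\<^sup>+x2. atypical_prob (c1 w1) x2 \<partial>G)"
      using w by (intro nn_integral_PiM_component G.prob_space_axioms) (auto, measurable)
  qed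
  also have "\<dots> = (\<integral>\<^sup>+x1. \<integral>\<^sup>+x2. atypical_prob x1 x2 \<partial>G \<partial>G)"
    using w by (intro nn_integral_PiM_component G.prob_space_axioms) (auto, measurable)
  also have "\<dots> \<le> ennreal (3 * tail)"
    unfolding atypical_prob_def by (rule true_codeword_atypical)
  finally show ?thesis .
qed

lemma average_confusion1:
  assumes w: "w1 < M1" "w1' < M1" "w1' \<noteq> w1" "w2 < M2"
  shows "(\<integral>\<^sup>+c1. \<integral>\<^sup>+c2. confusion_prob (c1 w1') (c2 w2) (c1 w1) (c2 w2) \<partial>codebook M2 \<partial>codebook M1) \<le> ennreal e1"
proof -
  have "(\<integral>\<^sup>+c1. \<integral>\<^sup>+c2. confusion_prob (c1 w1') (c2 w2) (c1 w1) (c2 w2) \<partial>codebook M2 \<partial>codebook M1)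
      = (\<integral>\<^sup>+c1. \<integral>\<^sup>+x2. confusion_prob (c1 w1') x2 (c1 w1) x2 \<partial>G \<partial>codebook M1)"
  proof (rule nn_integral_cong)
    fix c1 assume c1: "c1 \<in> space (codebook M1)"
    have [measurable]: "c1 w1 \<in> space (\<Pi>\<^sub>M i\<in>{..<n}. borel)" "c1 w1' \<in> space (\<Pi>\<^sub>M i\<in>{..<n}. borel)"
      using codeword_space[OF c1] w space_G by auto
    show "(\<integral>\<^sup>+c2. confusion_prob (c1 w1') (c2 w2) (c1 w1) (c2 w2) \<partial>codebook M2) = (\<integral>\<^sup>+x2. confusion_prob (c1 w1') x2 (c1 w1) x2 \<partial>G)"
      using w by (intro nn_integral_PiM_component[where f = "\<lambda>x. confusion_prob (c1 w1') x (c1 w1) x"] G.prob_space_axioms) (auto, measurable)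
  qed
  also have "\<dots> = (\<integral>\<^sup>+x1'. \<integral>\<^sup>+x1. \<integral>\<^sup>+x2. confusion_prob x1' x2 x1 x2 \<partial>G \<partial>G \<partial>G)"
    using w
    by (intro nn_integral_PiM_two_components[where f = "\<lambda>x1' x1. \<integral>\<^sup>+x2. confusion_prob x1' x2 x1 x2 \<partial>G"] G.prob_space_axioms)
       (auto, measurable)
  also have "\<dots> \<le> (\<integral>\<^sup>+x1'. ennreal e1 \<partial>G)"
  proof (rule nn_integral_mono)
    fix x1' assume "x1' \<in> space G"
    then have [measurable]: "x1' \<in> space (\<Pi>\<^sub>M i\<in>{..<n}. borel)" by (simp add: space_G)
    \<comment> \<open>\<open>confusion1\<close> holds for every fixed wrong codeword and every fixed
      shared one, so the transmitted \<open>x1\<close> has to be integrated before the shared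
      \<open>x2\<close>.\<close>
    have "(\<integral>\<^sup>+x1. \<integral>\<^sup>+x2. confusion_prob x1' x2 x1 x2 \<partial>G \<partial>G) = (\<integral>\<^sup>+x2. \<integral>\<^sup>+x1. confusion_prob x1' x2 x1 x2 \<partial>G \<partial>G)"
      by (rule GG.Fubini') measurable
    also have "\<dots> \<le> (\<integral>\<^sup>+x2. ennreal e1 \<partial>G)"
      unfolding confusion_prob_def e1_def
      by (intro nn_integral_mono confusion1) (simp_all add: space_G[symmetric] \<open>x1' \<in> space G\<close>)
    finally show "(\<integral>\<^sup>+x1. \<integral>\<^sup>+x2. confusion_prob x1' x2 x1 x2 \<partial>G \<partial>G) \<le> ennreal e1"
      by (simp add: G.emeasure_space_1)
  qed
  finally show ?thesis by (simp add: G.emeasure_space_1)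
qed

lemma average_confusion2:
  assumes w: "w1 < M1" "w2 < M2" "w2' < M2" "w2' \<noteq> w2"
  shows "(\<integral>\<^sup>+c1. \<integral>\<^sup>+c2. confusion_prob (c1 w1) (c2 w2') (c1 w1) (c2 w2) \<partial>codebook M2 \<partial>codebook M1) \<le> ennreal e2"
proof -
  interpret C1: prob_space "codebook M1" by (rule prob_space_codebook)
  have "(\<integral>\<^sup>+c1. \<integral>\<^sup>+c2. confusion_prob (c1 w1) (c2 w2') (c1 w1) (c2 w2) \<partial>codebook M2 \<partial>codebook M1) \<le> (\<integral>\<^sup>+c1. ennreal e2 \<partial>codebook M1)"
  proof (rule nn_integral_mono)
    fix c1 assume c1: "c1 \<in> space (codebook M1)"
    have c1w: "c1 w1 \<in> space (\<Pi>\<^sub>M i\<in>{..<n}. borel)"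
      using codeword_space[OF c1 w(1)] space_G by simp
    note [measurable] = c1w
    have "(\<integral>\<^sup>+c2. confusion_prob (c1 w1) (c2 w2') (c1 w1) (c2 w2) \<partial>codebook M2) = (\<integral>\<^sup>+x2'. \<integral>\<^sup>+x2. confusion_prob (c1 w1) x2' (c1 w1) x2 \<partial>G \<partial>G)"
      using w
      by (intro nn_integral_PiM_two_components[where f = "\<lambda>x2' x2. confusion_prob (c1 w1) x2' (c1 w1) x2"] G.prob_space_axioms)
         (auto, measurable)
    also have "\<dots> \<le> (\<integral>\<^sup>+x2'. ennreal e2 \<partial>G)"
      unfolding confusion_prob_def e2_def
      by (intro nn_integral_mono confusion2 c1w) (simp_all add: space_G[symmetric])
    finally show "(\<integral>\<^sup>+c2. confusion_prob (c1 w1) (c2 w2') (c1 w1) (c2 w2) \<partial>codebook M2) \<le> ennreal e2"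
      by (simp add: G.emeasure_space_1)
  qed
  then show ?thesis by (simp add: C1.emeasure_space_1)
qed

lemma average_confusion12:
  assumes w: "w1 < M1" "w1' < M1" "w1' \<noteq> w1" "w2 < M2" "w2' < M2" "w2' \<noteq> w2"
  shows "(\<integral>\<^sup>+c1. \<integral>\<^sup>+c2. confusion_prob (c1 w1') (c2 w2') (c1 w1) (c2 w2) \<partial>codebook M2 \<partial>codebook M1) \<le> ennreal e12"
proof -
  have "(\<integral>\<^sup>+c1. \<integral>\<^sup>+c2. confusion_prob (c1 w1') (c2 w2') (c1 w1) (c2 w2) \<partial>codebook M2 \<partial>codebook M1)
      = (\<integral>\<^sup>+c1. \<integral>\<^sup>+x2'. \<integral>\<^sup>+x2. confusion_prob (c1 w1') x2' (c1 w1) x2 \<partial>G \<partial>G \<partial>codebook M1)"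
  proof (rule nn_integral_cong)
    fix c1 assume c1: "c1 \<in> space (codebook M1)"
    have [measurable]: "c1 w1 \<in> space (\<Pi>\<^sub>M i\<in>{..<n}. borel)" "c1 w1' \<in> space (\<Pi>\<^sub>M i\<in>{..<n}. borel)"
      using codeword_space[OF c1] w space_G by auto
    show "(\<integral>\<^sup>+c2. confusion_prob (c1 w1') (c2 w2') (c1 w1) (c2 w2) \<partial>codebook M2) = (\<integral>\<^sup>+x2'. \<integral>\<^sup>+x2. confusion_prob (c1 w1') x2' (c1 w1) x2 \<partial>G \<partial>G)"
      using w
      by (intro nn_integral_PiM_two_components[where f = "\<lambda>x2' x2. confusion_prob (c1 w1') x2' (c1 w1) x2"] G.prob_space_axioms)
         (auto, measurable)
  qed
  also have "\<dots> = (\<integral>\<^sup>+x1'. \<integral>\<^sup>+x1. \<integral>\<^sup>+x2'. \<integral>\<^sup>+x2. confusion_prob x1' x2' x1 x2 \<partial>G \<partial>G \<partial>G \<partial>G)"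
    using w
    by (intro nn_integral_PiM_two_components[where f = "\<lambda>x1' x1. \<integral>\<^sup>+x2'. \<integral>\<^sup>+x2. confusion_prob x1' x2' x1 x2 \<partial>G \<partial>G"] G.prob_space_axioms)
       (auto, measurable)
  also have "\<dots> \<le> (\<integral>\<^sup>+x1'. ennreal e12 \<partial>G)"
  proof (rule nn_integral_mono)
    fix x1' assume "x1' \<in> space G"
    then have [measurable]: "x1' \<in> space (\<Pi>\<^sub>M i\<in>{..<n}. borel)" by (simp add: space_G)
    have "(\<integral>\<^sup>+x1. \<integral>\<^sup>+x2'. \<integral>\<^sup>+x2. confusion_prob x1' x2' x1 x2 \<partial>G \<partial>G \<partial>G) = (\<integral>\<^sup>+x2'. \<integral>\<^sup>+x1. \<integral>\<^sup>+x2. confusion_prob x1' x2' x1 x2 \<partial>G \<partial>G \<partial>G)"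
      by (rule GG.Fubini') measurable
    also have "\<dots> \<le> (\<integral>\<^sup>+x2'. ennreal e12 \<partial>G)"
      unfolding confusion_prob_def e12_def
      by (intro nn_integral_mono confusion12) (simp_all add: space_G[symmetric] \<open>x1' \<in> space G\<close>)
    finally show "(\<integral>\<^sup>+x1. \<integral>\<^sup>+x2'. \<integral>\<^sup>+x2. confusion_prob x1' x2' x1 x2 \<partial>G \<partial>G \<partial>G) \<le> ennreal e12"
      by (simp add: G.emeasure_space_1)
  qed
  finally show ?thesis by (simp add: G.emeasure_space_1)
qed

end

section \<open>Random codes\<close>

lemma avg_power_le:
  assumes "0 < n" "0 < M" "\<And>w. w < M \<Longrightarrow> (\<Sum>i<n. (x w i)\<^sup>2) \<le> real n * P"
  shows "avg_power n M x \<le> P"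
proof -
  have "(\<Sum>i<n. \<Sum>w<M. (x w i)\<^sup>2) = (\<Sum>w<M. \<Sum>i<n. (x w i)\<^sup>2)" by (rule sum.swap)
  also have "\<dots> \<le> (\<Sum>w<M. real n * P)" using assms(3) by (intro sum_mono) auto
  finally have "(\<Sum>i<n. \<Sum>w<M. (x w i)\<^sup>2) \<le> real M * (real n * P)" by simp
  then show ?thesis
    using assms(1,2) by (simp add: avg_power_def sum_divide_distrib[symmetric] field_simps)
qed

context gauss_mac
begin

definition union_bound :: "nat \<Rightarrow> nat \<Rightarrow> nat \<times> nat \<Rightarrow> (nat \<Rightarrow> nat \<Rightarrow> real) \<Rightarrow> (nat \<Rightarrow> nat \<Rightarrow> real) \<Rightarrow> ennreal" where
  "union_bound M1 M2 w c1 c2 = atypical_prob (c1 (fst w)) (c2 (snd w))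
     + (\<Sum>w'\<in>{..<M1} \<times> {..<M2} - {w}. confusion_prob (c1 (fst w')) (c2 (snd w')) (c1 (fst w)) (c2 (snd w)))"

text \<open>Only competitors are counted, hence \<open>M1 - 1\<close> and \<open>M2 - 1\<close>: a
  user with a single message contributes nothing, on which the treatment of zero rates
  relies.\<close>

definition err_bound :: "nat \<Rightarrow> nat \<Rightarrow> real" where
  "err_bound M1 M2 = 3 * tail + (real (M1 - 1) * e1 + real (M2 - 1) * e2 + real (M1 - 1) * real (M2 - 1) * e12)"

lemma tail_pos: "0 < tail" by (simp add: tail_def add_pos_pos)

lemma err_bound_pos: "0 < err_bound M1 M2"
  unfolding err_bound_def using tail_pos
  by (intro add_pos_nonneg add_nonneg_nonneg mult_nonneg_nonneg) (auto simp: e1_def e2_def e12_def)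

lemma sum_confusion:
  assumes w: "w1 < M1" "w2 < M2"
  shows "(\<Sum>w'\<in>{..<M1} \<times> {..<M2} - {(w1, w2)}. if snd w' = w2 then e1 else if fst w' = w1 then e2 else e12)
    = real (M1 - 1) * e1 + real (M2 - 1) * e2 + real (M1 - 1) * real (M2 - 1) * e12"
proof -
  let ?A1 = "{..<M1} - {w1}" and ?A2 = "{..<M2} - {w2}"
  let ?g = "\<lambda>w'. if snd w' = w2 then e1 else if fst w' = w1 then e2 else e12"
  have "{..<M1} \<times> {..<M2} - {(w1, w2)} = (?A1 \<times> {w2} \<union> {w1} \<times> ?A2) \<union> ?A1 \<times> ?A2"
    using w by auto
  then have "sum ?g ({..<M1} \<times> {..<M2} - {(w1, w2)}) = (sum ?g (?A1 \<times> {w2}) + sum ?g ({w1} \<times> ?A2)) + sum ?g (?A1 \<times> ?A2)"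
    by (simp only:) (subst sum.union_disjoint; (subst sum.union_disjoint)?; auto)
  also have "sum ?g (?A1 \<times> {w2}) = (\<Sum>w'\<in>?A1 \<times> {w2}. e1)" by (intro sum.cong) auto
  also have "sum ?g ({w1} \<times> ?A2) = (\<Sum>w'\<in>{w1} \<times> ?A2. e2)" by (intro sum.cong) auto
  also have "sum ?g (?A1 \<times> ?A2) = (\<Sum>w'\<in>?A1 \<times> ?A2. e12)" by (intro sum.cong) auto
  finally show ?thesis using w by (simp add: card_cartesian_product)
qed

lemma union_bound_measurable:
  assumes "w \<in> {..<M1} \<times> {..<M2}"
  shows "(\<lambda>c. union_bound M1 M2 w (fst c) (snd c)) \<in> borel_measurable (codebook M1 \<Otimes>\<^sub>M codebook M2)"
proof -
  have 1: "(\<lambda>c. fst c v) \<in> (codebook M1 \<Otimes>\<^sub>M codebook M2) \<rightarrow>\<^sub>M (\<Pi>\<^sub>M i\<in>{..<n}. borel)" if "v < M1" for v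
    using that by (intro codeword_measurable) auto
  have 2: "(\<lambda>c. snd c v) \<in> (codebook M1 \<Otimes>\<^sub>M codebook M2) \<rightarrow>\<^sub>M (\<Pi>\<^sub>M i\<in>{..<n}. borel)" if "v < M2" for v
    using that by (intro codeword_measurable) auto
  show ?thesis
    unfolding union_bound_def using assms
    by (intro borel_measurable_add borel_measurable_sum confusion_prob_measurable atypical_prob_measurable 1 2) auto
qed

text \<open>Codewords are identically distributed, so only the pattern of agreement between
  \<open>w'\<close> and \<open>w\<close> matters, and the result is the same for every
  \<open>w\<close>.\<close>

lemma union_bound_average:
  assumes w: "w \<in> {..<M1} \<times> {..<M2}"
  shows "(\<integral>\<^sup>+c. union_bound M1 M2 w (fst c) (snd c) \<partial>(codebook M1 \<Otimes>\<^sub>M codebook M2)) \<le> ennreal (err_bound M1 M2)"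
proof -
  let ?C1 = "codebook M1" and ?C2 = "codebook M2"
  obtain w1 w2 where weq: "w = (w1, w2)" and w12: "w1 < M1" "w2 < M2" using w by auto
  have fst_w: "fst w = w1" "snd w = w2" by (simp_all add: weq)
  interpret C2: prob_space ?C2 by (rule prob_space_codebook)
  have 1: "(\<lambda>c. fst c v) \<in> (?C1 \<Otimes>\<^sub>M ?C2) \<rightarrow>\<^sub>M (\<Pi>\<^sub>M i\<in>{..<n}. borel)" if "v < M1" for v
    using that by (intro codeword_measurable) auto
  have 2: "(\<lambda>c. snd c v) \<in> (?C1 \<Otimes>\<^sub>M ?C2) \<rightarrow>\<^sub>M (\<Pi>\<^sub>M i\<in>{..<n}. borel)" if "v < M2" for v
    using that by (intro codeword_measurable) auto
  let ?g = "\<lambda>w'. if snd w' = w2 then e1 else if fst w' = w1 then e2 else e12"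
  have m0: "(\<lambda>c. atypical_prob (fst c w1) (snd c w2)) \<in> borel_measurable (?C1 \<Otimes>\<^sub>M ?C2)"
    by (intro atypical_prob_measurable 1 2 w12)
  have m: "(\<lambda>c. confusion_prob (fst c (fst w')) (snd c (snd w')) (fst c w1) (snd c w2)) \<in> borel_measurable (?C1 \<Otimes>\<^sub>M ?C2)"
    if "w' \<in> {..<M1} \<times> {..<M2} - {w}" for w'
    using that by (intro confusion_prob_measurable 1 2 w12) auto
  have "(\<integral>\<^sup>+c. union_bound M1 M2 w (fst c) (snd c) \<partial>(?C1 \<Otimes>\<^sub>M ?C2))
    = (\<integral>\<^sup>+c. atypical_prob (fst c w1) (snd c w2) \<partial>(?C1 \<Otimes>\<^sub>M ?C2))
      + (\<Sum>w'\<in>{..<M1} \<times> {..<M2} - {w}. \<integral>\<^sup>+c. confusion_prob (fst c (fst w')) (snd c (snd w')) (fst c w1) (snd c w2) \<partial>(?C1 \<Otimes>\<^sub>M ?C2))"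
    unfolding union_bound_def fst_w
    by (subst nn_integral_add, rule m0, intro borel_measurable_sum m, assumption, subst nn_integral_sum, rule m, assumption) simp
  also have "\<dots> \<le> ennreal (3 * tail) + (\<Sum>w'\<in>{..<M1} \<times> {..<M2} - {w}. ennreal (?g w'))"
  proof (intro add_mono sum_mono)
    show "(\<integral>\<^sup>+c. atypical_prob (fst c w1) (snd c w2) \<partial>(?C1 \<Otimes>\<^sub>M ?C2)) \<le> ennreal (3 * tail)"
      using C2.nn_integral_fst[OF m0] average_atypical[OF w12] by simp
    fix w' assume w': "w' \<in> {..<M1} \<times> {..<M2} - {w}"
    then obtain w1' w2' where w'eq: "w' = (w1', w2')" and w12': "w1' < M1" "w2' < M2" by auto
    have "(\<integral>\<^sup>+c1. \<integral>\<^sup>+c2. confusion_prob (c1 w1') (c2 w2') (c1 w1) (c2 w2) \<partial>?C2 \<partial>?C1) \<le> ennreal (?g w')"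
    proof (cases "w2' = w2")
      case True
      then have "w1' \<noteq> w1" using w' weq w'eq by auto
      with True average_confusion1[OF w12(1) w12'(1) _ w12(2)] show ?thesis by (simp add: w'eq)
    next
      case False
      then show ?thesis
        using average_confusion2[OF w12 w12'(2)] average_confusion12[OF w12(1) w12'(1) _ w12(2) w12'(2)]
        by (cases "w1' = w1") (auto simp: w'eq)
    qed
    then show "(\<integral>\<^sup>+c. confusion_prob (fst c (fst w')) (snd c (snd w')) (fst c w1) (snd c w2) \<partial>(?C1 \<Otimes>\<^sub>M ?C2)) \<le> ennreal (?g w')"
      using C2.nn_integral_fst[OF m[OF w']] by (simp add: w'eq)
  qed
  also have "(\<Sum>w'\<in>{..<M1} \<times> {..<M2} - {w}. ennreal (?g w')) = ennreal (\<Sum>w'\<in>{..<M1} \<times> {..<M2} - {w}. ?g w')"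
    by (intro sum_ennreal) (auto simp: e1_def e2_def e12_def)
  also have "ennreal (3 * tail) + \<dots> = ennreal (err_bound M1 M2)"
    unfolding weq sum_confusion[OF w12] err_bound_def using tail_pos
    by (intro ennreal_plus[symmetric]) (auto intro!: add_nonneg_nonneg simp: e1_def e2_def e12_def)
  finally show ?thesis .
qed

text \<open>One pair of codebooks has to serve all messages at once, so the sum over the message
  pairs is averaged rather than a single term.\<close>

lemma good_codebooks:
  assumes M: "0 < M1" "0 < M2"
  obtains c1 c2 where "c1 \<in> space (codebook M1)" "c2 \<in> space (codebook M2)"
    "(\<Sum>w\<in>{..<M1} \<times> {..<M2}. union_bound M1 M2 w c1 c2) \<le> ennreal (2 * (real (M1 * M2) * err_bound M1 M2))"
proof -
  let ?C1 = "codebook M1" and ?C2 = "codebook M2"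
  interpret C1: prob_space ?C1 by (rule prob_space_codebook)
  interpret C2: prob_space ?C2 by (rule prob_space_codebook)
  interpret pair_prob_space ?C1 ?C2 ..
  have "(\<integral>\<^sup>+c. (\<Sum>w\<in>{..<M1} \<times> {..<M2}. union_bound M1 M2 w (fst c) (snd c)) \<partial>(?C1 \<Otimes>\<^sub>M ?C2))
    = (\<Sum>w\<in>{..<M1} \<times> {..<M2}. \<integral>\<^sup>+c. union_bound M1 M2 w (fst c) (snd c) \<partial>(?C1 \<Otimes>\<^sub>M ?C2))"
    by (intro nn_integral_sum union_bound_measurable)
  also have "\<dots> \<le> (\<Sum>w\<in>{..<M1} \<times> {..<M2}. ennreal (err_bound M1 M2))"
    by (intro sum_mono union_bound_average)
  also have "\<dots> = ennreal (real (M1 * M2) * err_bound M1 M2)"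
    using err_bound_pos[of M1 M2]
    by (subst sum_ennreal) (auto simp: card_cartesian_product less_imp_le)
  finally have "(\<integral>\<^sup>+c. (\<Sum>w\<in>{..<M1} \<times> {..<M2}. union_bound M1 M2 w (fst c) (snd c)) \<partial>(?C1 \<Otimes>\<^sub>M ?C2))
    \<le> ennreal (real (M1 * M2) * err_bound M1 M2)" .
  from nn_integral_le_imp_ex[OF this] M err_bound_pos[of M1 M2] that show ?thesis
    by (auto simp: space_pair_measure)
qed

text \<open>If the set of typical pairs differs from \<open>{w}\<close>, either \<open>w\<close> is
  missing from it or some other pair belongs to it. The event \<open>E\<close> is left general, so
  that the decoder may behave arbitrarily whenever the typical pair is not unique.\<close>

lemma union_bound_ge_error:
  assumes w: "w \<in> {..<M1} \<times> {..<M2}"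
    and c1: "c1 \<in> space (codebook M1)" and c2: "c2 \<in> space (codebook M2)"
    and [measurable]: "E \<in> sets \<nu>"
    and E: "\<And>z. z \<in> E \<Longrightarrow> {w' \<in> {..<M1} \<times> {..<M2}. T (c1 (fst w')) (c2 (snd w')) (superpose a b n (c1 (fst w)) (c2 (snd w)) z)} \<noteq> {w}"
  shows "emeasure \<nu> E \<le> union_bound M1 M2 w c1 c2"
proof -
  let ?x1 = "c1 (fst w)" and ?x2 = "c2 (snd w)"
  have sp: "c1 v \<in> space (\<Pi>\<^sub>M i\<in>{..<n}. borel)" if "v < M1" for v
    using codeword_space[OF c1 that] space_G by simp
  have sp': "c2 v \<in> space (\<Pi>\<^sub>M i\<in>{..<n}. borel)" if "v < M2" for v
    using codeword_space[OF c2 that] space_G by simp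
  have m: "(\<lambda>z. indicator {z. T (c1 (fst w')) (c2 (snd w')) (superpose a b n ?x1 ?x2 z)} z :: ennreal) \<in> borel_measurable \<nu>"
    "(\<lambda>z. indicator {z. \<not> T (c1 (fst w')) (c2 (snd w')) (superpose a b n ?x1 ?x2 z)} z :: ennreal) \<in> borel_measurable \<nu>"
    if "w' \<in> {..<M1} \<times> {..<M2}" for w'
    using that w by (auto intro!: indicator_typical_measurable measurable_const sp sp')
  have "emeasure \<nu> E = (\<integral>\<^sup>+z. indicator E z \<partial>\<nu>)"
    by (rule nn_integral_indicator[symmetric]) fact
  also have "\<dots> \<le> (\<integral>\<^sup>+z. indicator {z. \<not> T ?x1 ?x2 (superpose a b n ?x1 ?x2 z)} z
      + (\<Sum>w'\<in>{..<M1} \<times> {..<M2} - {w}. indicator {z. T (c1 (fst w')) (c2 (snd w')) (superpose a b n ?x1 ?x2 z)} z) \<partial>\<nu>)"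
  proof (rule nn_integral_mono)
    fix z
    let ?t = "\<lambda>w'. T (c1 (fst w')) (c2 (snd w')) (superpose a b n ?x1 ?x2 z)"
    show "indicator E z \<le> indicator {z. \<not> T ?x1 ?x2 (superpose a b n ?x1 ?x2 z)} z
      + (\<Sum>w'\<in>{..<M1} \<times> {..<M2} - {w}. indicator {z. T (c1 (fst w')) (c2 (snd w')) (superpose a b n ?x1 ?x2 z)} z :: ennreal)"
    proof (cases "z \<in> E \<and> ?t w")
      case True
      with E[of z] w obtain w' where w': "w' \<in> {..<M1} \<times> {..<M2} - {w}" "?t w'" by auto
      have "(1 :: ennreal) = indicator {z. T (c1 (fst w')) (c2 (snd w')) (superpose a b n ?x1 ?x2 z)} z"
        using w' by simp
      also have "\<dots> \<le> (\<Sum>w'\<in>{..<M1} \<times> {..<M2} - {w}. indicator {z. T (c1 (fst w')) (c2 (snd w')) (superpose a b n ?x1 ?x2 z)} z)"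
        using w' by (intro member_le_sum) auto
      finally show ?thesis
        using True by (simp add: add_increasing)
    next
      case False
      then show ?thesis
        by (cases "z \<in> E") (simp_all add: add_increasing2)
    qed
  qed
  also have "\<dots> = union_bound M1 M2 w c1 c2"
    unfolding union_bound_def confusion_prob_def atypical_prob_def
    by (subst nn_integral_add, rule m(2)[OF w], intro borel_measurable_sum m(1), erule DiffD1,
        subst nn_integral_sum, rule m(1), erule DiffD1) simp
  finally show ?thesis .
qed

text \<open>The first two typicality tests bound the energy of a unit-variance codeword by
  \<open>real n * (1 + \<delta>)\<close>; scaled by the amplitudes \<open>p1\<close> and
  \<open>p2\<close>, this becomes the stated power.\<close>

lemma random_code_exists:
  assumes n: "0 < n" and M: "0 < M1" "0 < M2" and h: "0 \<le> h10" "0 \<le> h20"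
    and a: "a = sqrt h10 * p1" and b: "b = sqrt h20 * p2"
  shows "\<exists>c. is_mac_code (p1\<^sup>2 * (1 + \<delta>)) (p2\<^sup>2 * (1 + \<delta>)) n c \<and> msgs1 c = M1 \<and> msgs2 c = M2
    \<and> mac_error h10 h20 N n c \<le> 2 * err_bound M1 M2"
proof -
  from good_codebooks[OF M] obtain c1 c2 where c: "c1 \<in> space (codebook M1)" "c2 \<in> space (codebook M2)"
    and F: "(\<Sum>w\<in>{..<M1} \<times> {..<M2}. union_bound M1 M2 w c1 c2) \<le> ennreal (2 * (real (M1 * M2) * err_bound M1 M2))" .
  let ?W = "{..<M1} \<times> {..<M2}"
  define S where "S y = {w \<in> ?W. T (c1 (fst w)) (c2 (snd w)) y}" for y
  \<comment> \<open>Silencing overlong codewords enforces the power constraint on every codebook, and costs nothing,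
    since pairs with an overlong codeword are never typical and are counted as errors anyway.\<close>
  define x1 where "x1 w i = (if energy n (c1 w) \<le> real n * (1 + \<delta>) then p1 * c1 w i else 0)" for w i
  define x2 where "x2 w i = (if energy n (c2 w) \<le> real n * (1 + \<delta>) then p2 * c2 w i else 0)" for w i
  \<comment> \<open>If the typical pair is not unique, \<open>the_elem\<close> returns an
    unspecified value; the union bound already counts such outputs as errors.\<close>
  define c where "c = \<lparr>msgs1 = M1, msgs2 = M2, enc1 = x1, enc2 = x2, dec = (\<lambda>y. the_elem (S y))\<rparr>"
  have c_simps [simp]: "msgs1 c = M1" "msgs2 c = M2" "enc1 c = x1" "enc2 c = x2" "dec c = (\<lambda>y. the_elem (S y))"
    by (simp_all add: c_def)
  have sp: "c1 v \<in> space (\<Pi>\<^sub>M i\<in>{..<n}. borel)" if "v < M1" for v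
    using codeword_space[OF c(1) that] space_G by simp
  have sp': "c2 v \<in> space (\<Pi>\<^sub>M i\<in>{..<n}. borel)" if "v < M2" for v
    using codeword_space[OF c(2) that] space_G by simp
  have pow: "energy n (\<lambda>i. if energy n x \<le> real n * (1 + \<delta>) then p * x i else 0) \<le> real n * (p\<^sup>2 * (1 + \<delta>))" for x p
  proof (cases "energy n x \<le> real n * (1 + \<delta>)")
    case True
    have "energy n (\<lambda>i. p * x i) = p\<^sup>2 * energy n x"
      by (simp add: energy_def power_mult_distrib sum_distrib_left)
    also have "\<dots> \<le> p\<^sup>2 * (real n * (1 + \<delta>))" using True by (intro mult_left_mono) auto
    finally show ?thesis using True by (simp add: mult_ac)
  next
    case False
    then show ?thesis using \<delta> by (simp add: energy_def)
  qed
  have pm: "Measurable.pred (\<Pi>\<^sub>M i\<in>{..<n}. borel) (\<lambda>y. T (c1 (fst w)) (c2 (snd w)) y)" if "w \<in> ?W" for w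
    using that by (auto intro!: typical_measurable measurable_const sp sp')
  \<comment> \<open>The set-valued map goes into a finite discrete space, from which every function
    is measurable, the underspecified \<open>the_elem\<close> included.\<close>
  have S_meas: "S \<in> (\<Pi>\<^sub>M i\<in>{..<n}. borel) \<rightarrow>\<^sub>M count_space (Pow ?W)"
  proof (subst measurable_count_space_eq2, simp, intro conjI ballI)
    show "S \<in> space (\<Pi>\<^sub>M i\<in>{..<n}. borel) \<rightarrow> Pow ?W" by (auto simp: S_def)
    fix B assume "B \<in> Pow ?W"
    then have "S -` {B} \<inter> space (\<Pi>\<^sub>M i\<in>{..<n}. borel)
      = {y \<in> space (\<Pi>\<^sub>M i\<in>{..<n}. borel). \<forall>w\<in>?W. T (c1 (fst w)) (c2 (snd w)) y \<longleftrightarrow> w \<in> B}"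
      unfolding S_def by blast
    also have "\<dots> \<in> sets (\<Pi>\<^sub>M i\<in>{..<n}. borel)"
    proof (intro sets.sets_Collect_finite_All)
      fix w assume w: "w \<in> ?W"
      note [measurable] = pm[OF w]
      show "{y \<in> space (\<Pi>\<^sub>M i\<in>{..<n}. borel). T (c1 (fst w)) (c2 (snd w)) y \<longleftrightarrow> w \<in> B} \<in> sets (\<Pi>\<^sub>M i\<in>{..<n}. borel)"
        by measurable
    qed simp
    finally show "S -` {B} \<inter> space (\<Pi>\<^sub>M i\<in>{..<n}. borel) \<in> sets (\<Pi>\<^sub>M i\<in>{..<n}. borel)" .
  qed
  have dec_meas: "(\<lambda>y. the_elem (S y)) \<in> (\<Pi>\<^sub>M i\<in>{..<n}. borel) \<rightarrow>\<^sub>M count_space UNIV"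
    by (rule measurable_compose[OF S_meas]) simp
  have code: "is_mac_code (p1\<^sup>2 * (1 + \<delta>)) (p2\<^sup>2 * (1 + \<delta>)) n c"
    unfolding is_mac_code_def using M n dec_meas pow
    by (auto intro!: avg_power_le simp: x1_def x2_def energy_def)
  have \<nu>: "gaussian_noise N n = \<nu>" by (rule gaussian_noise_eq_gauss)
  have err: "emeasure \<nu> {z \<in> space \<nu>. dec c (mac_output h10 h20 n (enc1 c (fst w)) (enc2 c (snd w)) z) \<noteq> w}
      \<le> union_bound M1 M2 w c1 c2" if w: "w \<in> ?W" for w
  proof (rule union_bound_ge_error[OF w c])
    have [measurable]: "mac_output h10 h20 n (enc1 c (fst w)) (enc2 c (snd w)) \<in> \<nu> \<rightarrow>\<^sub>M (\<Pi>\<^sub>M i\<in>{..<n}. borel)"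
      unfolding mac_output_def by measurable
    have [measurable]: "dec c \<in> (\<Pi>\<^sub>M i\<in>{..<n}. borel) \<rightarrow>\<^sub>M count_space UNIV"
      using dec_meas by simp
    show "{z \<in> space \<nu>. dec c (mac_output h10 h20 n (enc1 c (fst w)) (enc2 c (snd w)) z) \<noteq> w} \<in> sets \<nu>"
      by measurable
    fix z assume "z \<in> {z \<in> space \<nu>. dec c (mac_output h10 h20 n (enc1 c (fst w)) (enc2 c (snd w)) z) \<noteq> w}"
    then have ne: "the_elem (S (mac_output h10 h20 n (x1 (fst w)) (x2 (snd w)) z)) \<noteq> w" by simp
    show "{w' \<in> ?W. T (c1 (fst w')) (c2 (snd w')) (superpose a b n (c1 (fst w)) (c2 (snd w)) z)} \<noteq> {w}"
    proof
      assume eq: "{w' \<in> ?W. T (c1 (fst w')) (c2 (snd w')) (superpose a b n (c1 (fst w)) (c2 (snd w)) z)} = {w}"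
      then have "T (c1 (fst w)) (c2 (snd w)) (superpose a b n (c1 (fst w)) (c2 (snd w)) z)" by blast
      then have "mac_output h10 h20 n (x1 (fst w)) (x2 (snd w)) z = superpose a b n (c1 (fst w)) (c2 (snd w)) z"
        by (auto simp: typical_def mac_output_def superpose_def x1_def x2_def a b fun_eq_iff)
      with eq ne show False by (simp add: S_def)
    qed
  qed
  have "ennreal (\<Sum>w\<in>?W. measure \<nu> {z \<in> space \<nu>. dec c (mac_output h10 h20 n (enc1 c (fst w)) (enc2 c (snd w)) z) \<noteq> w})
      \<le> ennreal (2 * (real (M1 * M2) * err_bound M1 M2))"
    using order_trans[OF sum_mono[OF err] F]
    by (simp add: \<nu>.emeasure_eq_measure)
  then have "(\<Sum>w\<in>?W. measure \<nu> {z \<in> space \<nu>. dec c (mac_output h10 h20 n (enc1 c (fst w)) (enc2 c (snd w)) z) \<noteq> w})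
      \<le> 2 * (real (M1 * M2) * err_bound M1 M2)"
    using err_bound_pos[of M1 M2] by (subst (asm) ennreal_le_iff) auto
  from divide_right_mono[OF this, of "real M1 * real M2"]
  have "mac_error h10 h20 N n c \<le> 2 * (real (M1 * M2) * err_bound M1 M2) / (real M1 * real M2)"
    by (simp add: mac_error_def \<nu> sum.cartesian_product case_prod_beta')
  also have "\<dots> = 2 * err_bound M1 M2" using M by simp
  finally show ?thesis using code by (intro exI[of _ c]) auto
qed

end

section \<open>The capacity region and the limit of the outer bound\<close>

text \<open>Rounding up secures the rate, while the number \<open>K - 1\<close> of competitors still
  respects the exponential without a rounding loss. At rate zero there is exactly one message and no
  competitor.\<close>

lemma codebook_size:
  fixes r :: real
  assumes "0 \<le> r" "0 < n"
  defines "K \<equiv> nat \<lceil>exp (real n * r)\<rceil>"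
  shows "0 < K" "r \<le> ln (real K) / real n" "real (K - 1) \<le> (if r = 0 then 0 else exp (real n * r))"
proof -
  have K: "real K = of_int \<lceil>exp (real n * r)\<rceil>"
    by (simp add: K_def order.trans[OF zero_le_one])
  have le: "exp (real n * r) \<le> real K" unfolding K by (rule le_of_int_ceiling)
  then have "0 < real K" using exp_gt_zero[of "real n * r"] by linarith
  then show "0 < K" by simp
  have "real n * r \<le> ln (real K)" using le \<open>0 < real K\<close> by (simp add: ln_ge_iff)
  then show "r \<le> ln (real K) / real n" using assms(2) by (simp add: field_simps)
  have "real K < exp (real n * r) + 1" unfolding K by linarith
  moreover have "real (K - 1) = real K - 1" using \<open>0 < K\<close> by simp
  moreover have "K = 1" if "r = 0" using that by (simp add: K_def)
  ultimately show "real (K - 1) \<le> (if r = 0 then 0 else exp (real n * r))"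
    by auto
qed

lemma exp_mult_nat_tendsto_0: "c < 0 \<Longrightarrow> (\<lambda>n. exp (real n * c)) \<longlonglongrightarrow> 0"
  using LIMSEQ_power_zero[of "exp c"] by (simp add: exp_of_nat_mult)

lemma if_exp_mult_nat_tendsto_0:
  "b \<or> c < 0 \<Longrightarrow> (\<lambda>n. if b then 0 else exp (real n * c)) \<longlonglongrightarrow> 0"
  by (cases b) (simp_all add: exp_mult_nat_tendsto_0)

text \<open>
  A vanishing rate is treated separately because the corresponding bound may vanish, too, namely
  when the gain or the power is zero; one message can then be sent without error.
\<close>

lemma mac_achievableI:
  assumes N: "0 < N" and h: "0 \<le> h10" "0 \<le> h20" and P: "0 \<le> P1" "0 \<le> P2"
    and r: "0 \<le> r1" "0 \<le> r2" and \<delta>: "0 < \<delta>" "\<delta> < 1"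
    and r1: "r1 = 0 \<or> r1 < ln (1 + h10 * P1 / N / (1 + \<delta>)) / 2 - \<delta>"
    and r2: "r2 = 0 \<or> r2 < ln (1 + h20 * P2 / N / (1 + \<delta>)) / 2 - \<delta>"
    and r12: "r1 = 0 \<or> r2 = 0 \<or> r1 + r2 < ln (1 + (h10 * P1 + h20 * P2) / N / (1 + \<delta>)) / 2 - \<delta>"
  shows "(r1, r2) \<in> mac_achievable h10 h20 P1 P2 N"
proof -
  \<comment> \<open>Transmission at power \<open>P1 / (1 + \<delta>)\<close> leaves room for
    codewords whose energy exceeds its mean by the factor \<open>1 + \<delta>\<close>.\<close>
  define p1 p2 where "p1 = sqrt (P1 / (1 + \<delta>))" and "p2 = sqrt (P2 / (1 + \<delta>))"
  define a b where "a = sqrt h10 * p1" and "b = sqrt h20 * p2"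
  have p: "p1\<^sup>2 * (1 + \<delta>) = P1" "p2\<^sup>2 * (1 + \<delta>) = P2"
    using P \<delta> by (simp_all add: p1_def p2_def)
  have ab: "a\<^sup>2 = h10 * P1 / (1 + \<delta>)" "b\<^sup>2 = h20 * P2 / (1 + \<delta>)"
    using P \<delta> h by (simp_all add: a_def b_def p1_def p2_def power_mult_distrib)
  define c1 where "c1 = ln ((a\<^sup>2 + N) / N) / 2 - \<delta>"
  define c2 where "c2 = ln ((b\<^sup>2 + N) / N) / 2 - \<delta>"
  define c12 where "c12 = ln ((a\<^sup>2 + (b\<^sup>2 + N)) / N) / 2 - \<delta>"
  have "(a\<^sup>2 + N) / N = 1 + h10 * P1 / N / (1 + \<delta>)" "(b\<^sup>2 + N) / N = 1 + h20 * P2 / N / (1 + \<delta>)"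
    "(a\<^sup>2 + (b\<^sup>2 + N)) / N = 1 + (h10 * P1 + h20 * P2) / N / (1 + \<delta>)"
    using N unfolding ab by (simp_all add: add_divide_distrib mult.commute)
  then have rc: "r1 = 0 \<or> r1 < c1" "r2 = 0 \<or> r2 < c2" "r1 = 0 \<or> r2 = 0 \<or> r1 + r2 < c12"
    using r1 r2 r12 by (simp_all add: c1_def c2_def c12_def)
  \<comment> \<open>Twice \<open>err_bound\<close> with the codebook sizes inserted. Each exponent
    beyond the tails is a rate minus a diminished mutual information and is negative by the strict
    rate inequalities; a zero rate removes its terms altogether.\<close>
  define B where "B n = 2 * (3 * (exp (real n * ((ln (1 + \<delta>) - \<delta>) / 2)) + exp (real n * ((ln (1 - \<delta>) + \<delta>) / 2)))
    + ((if r1 = 0 then 0 else exp (real n * (r1 - c1))) + (if r2 = 0 then 0 else exp (real n * (r2 - c2)))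
      + (if r1 = 0 \<or> r2 = 0 then 0 else exp (real n * (r1 + r2 - c12)))))" for n :: nat
  have "ln (1 + \<delta>) < \<delta>" "ln (1 - \<delta>) < - \<delta>"
    using ln_add_one_self_less_self[of \<delta>] ln_le_minus_one[of "1 - \<delta>"] ln_eq_minus_one[of "1 - \<delta>"] \<delta>
    by (auto simp: less_le)
  moreover have "(\<lambda>n. if r1 = 0 then 0 else exp (real n * (r1 - c1))) \<longlonglongrightarrow> 0"
    "(\<lambda>n. if r2 = 0 then 0 else exp (real n * (r2 - c2))) \<longlonglongrightarrow> 0"
    "(\<lambda>n. if r1 = 0 \<or> r2 = 0 then 0 else exp (real n * (r1 + r2 - c12))) \<longlonglongrightarrow> 0"
    using rc by (auto intro!: if_exp_mult_nat_tendsto_0)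
  ultimately have "B \<longlonglongrightarrow> 2 * (3 * (0 + 0) + (0 + 0 + 0))"
    unfolding B_def by (intro tendsto_intros exp_mult_nat_tendsto_0) auto
  then have B: "B \<longlonglongrightarrow> 0" by simp
  have code: "\<exists>c. is_mac_code P1 P2 n c \<and> r1 \<le> ln (real (msgs1 c)) / real n \<and> r2 \<le> ln (real (msgs2 c)) / real n
      \<and> mac_error h10 h20 N n c \<le> B n" if n: "0 < n" for n
  proof -
    interpret gauss_mac a b N \<delta> n by unfold_locales fact+
    define M1 M2 where "M1 = nat \<lceil>exp (real n * r1)\<rceil>" and "M2 = nat \<lceil>exp (real n * r2)\<rceil>"
    note M1 = codebook_size[OF r(1) n, folded M1_def] and M2 = codebook_size[OF r(2) n, folded M2_def]
    from random_code_exists[OF n M1(1) M2(1) h a_def b_def]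
    obtain c where c: "is_mac_code P1 P2 n c" "msgs1 c = M1" "msgs2 c = M2"
      and err: "mac_error h10 h20 N n c \<le> 2 * err_bound M1 M2"
      unfolding p by blast
    have e: "e1 = exp (- (real n * c1))" "e2 = exp (- (real n * c2))" "e12 = exp (- (real n * c12))"
      by (simp_all add: e1_def e2_def e12_def c1_def c2_def c12_def)
    have "real (M1 - 1) * e1 \<le> (if r1 = 0 then 0 else exp (real n * r1)) * e1"
      using M1(3) by (intro mult_right_mono) (auto simp: e)
    also have "\<dots> = (if r1 = 0 then 0 else exp (real n * (r1 - c1)))"
      by (simp add: e mult_exp_exp algebra_simps)
    finally have b1: "real (M1 - 1) * e1 \<le> \<dots>" .
    have "real (M2 - 1) * e2 \<le> (if r2 = 0 then 0 else exp (real n * r2)) * e2"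
      using M2(3) by (intro mult_right_mono) (auto simp: e)
    also have "\<dots> = (if r2 = 0 then 0 else exp (real n * (r2 - c2)))"
      by (simp add: e mult_exp_exp algebra_simps)
    finally have b2: "real (M2 - 1) * e2 \<le> \<dots>" .
    have "real (M1 - 1) * real (M2 - 1) * e12
      \<le> (if r1 = 0 then 0 else exp (real n * r1)) * (if r2 = 0 then 0 else exp (real n * r2)) * e12"
      using M1(3) M2(3) by (intro mult_right_mono mult_mono) (auto simp: e)
    also have "\<dots> = (if r1 = 0 \<or> r2 = 0 then 0 else exp (real n * (r1 + r2 - c12)))"
      by (simp add: e mult_exp_exp algebra_simps)
    finally have b12: "real (M1 - 1) * real (M2 - 1) * e12 \<le> \<dots>" .
    have "tail = exp (real n * ((ln (1 + \<delta>) - \<delta>) / 2)) + exp (real n * ((ln (1 - \<delta>) + \<delta>) / 2))"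
      by (simp add: tail_def)
    then have "2 * err_bound M1 M2 \<le> B n"
      unfolding err_bound_def B_def
      by (intro mult_left_mono add_mono b1 b2 b12) simp_all
    with err c M1(2) M2(2) show ?thesis by (intro exI[of _ c]) auto
  qed
  have "\<forall>\<^sub>F n in sequentially. \<exists>c. is_mac_code P1 P2 n c
            \<and> r1 \<le> ln (real (msgs1 c)) / real n
            \<and> r2 \<le> ln (real (msgs2 c)) / real n
            \<and> mac_error h10 h20 N n c \<le> \<epsilon>" if "0 < \<epsilon>" for \<epsilon>
    using eventually_gt_at_top[of 0] order_tendstoD(2)[OF B that]
  proof eventually_elim
    case (elim n)
    from code[OF elim(1)] elim(2) show ?case by (meson less_imp_le order_trans)
  qed
  with r show ?thesis by (simp add: mac_achievable_def)
qed

text \<open>Scaling by \<open>t < 1\<close> turns each weak bound on a nonzero rate into a strict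
  one. The bounds with slack depend continuously on \<open>\<delta>\<close> and tend to the original
  ones, so a small \<open>\<delta>\<close> still fits below them.\<close>

lemma scaled_pentagon_achievable:
  assumes N: "0 < N" and h: "0 \<le> h10" "0 \<le> h20" and P: "0 \<le> P1" "0 \<le> P2"
    and R: "(R1, R2) \<in> mac_pentagon (h10 * P1 / N) (h20 * P2 / N) ((h10 * P1 + h20 * P2) / N)"
    and t: "0 \<le> t" "t < 1"
  shows "(t * R1, t * R2) \<in> mac_achievable h10 h20 P1 P2 N"
proof -
  from R have R: "0 \<le> R1" "0 \<le> R2" "R1 \<le> ln (1 + h10 * P1 / N) / 2" "R2 \<le> ln (1 + h20 * P2 / N) / 2"
    "R1 + R2 \<le> ln (1 + (h10 * P1 + h20 * P2) / N) / 2"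
    by (simp_all add: mac_pentagon_def)
  have ev: "\<forall>\<^sub>F \<delta> in at_right 0. r = 0 \<or> t * r < ln (1 + S / (1 + \<delta>)) / 2 - \<delta>"
    if "0 \<le> r" "r \<le> ln (1 + S) / 2" "0 \<le> S" for r S
  proof (cases "r = 0")
    case False
    have "((\<lambda>\<delta>. ln (1 + S / (1 + \<delta>)) / 2 - \<delta>) \<longlongrightarrow> ln (1 + S / (1 + 0)) / 2 - 0) (at_right 0)"
      using that by (intro tendsto_intros) auto
    moreover have "t * r < 1 * r" using that False t by (intro mult_strict_right_mono) auto
    with that have "t * r < ln (1 + S / (1 + 0)) / 2 - 0" by simp
    ultimately show ?thesis
      by (auto dest: order_tendstoD(1) elim: eventually_mono)
  qed simp
  have S: "0 \<le> h10 * P1 / N" "0 \<le> h20 * P2 / N" "0 \<le> (h10 * P1 + h20 * P2) / N"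
    using N h P by auto
  have "\<forall>\<^sub>F \<delta> in at_right (0 :: real). 0 < \<delta> \<and> \<delta> < 1"
    unfolding eventually_at_right_field by (intro exI[of _ 1]) auto
  then have "\<forall>\<^sub>F \<delta> in at_right 0. 0 < \<delta> \<and> \<delta> < 1
    \<and> (R1 = 0 \<or> t * R1 < ln (1 + h10 * P1 / N / (1 + \<delta>)) / 2 - \<delta>)
    \<and> (R2 = 0 \<or> t * R2 < ln (1 + h20 * P2 / N / (1 + \<delta>)) / 2 - \<delta>)
    \<and> (R1 + R2 = 0 \<or> t * (R1 + R2) < ln (1 + (h10 * P1 + h20 * P2) / N / (1 + \<delta>)) / 2 - \<delta>)"
    using ev[OF R(1,3) S(1)] ev[OF R(2,4) S(2)] ev[OF add_nonneg_nonneg[OF R(1,2)] R(5) S(3)]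
    by eventually_elim auto
  then obtain \<delta> where "0 < \<delta>" "\<delta> < 1"
    "R1 = 0 \<or> t * R1 < ln (1 + h10 * P1 / N / (1 + \<delta>)) / 2 - \<delta>"
    "R2 = 0 \<or> t * R2 < ln (1 + h20 * P2 / N / (1 + \<delta>)) / 2 - \<delta>"
    "R1 + R2 = 0 \<or> t * (R1 + R2) < ln (1 + (h10 * P1 + h20 * P2) / N / (1 + \<delta>)) / 2 - \<delta>"
    using eventually_happens'[OF trivial_limit_at_right_real] by blast
  with R(1,2) t show ?thesis
    by (intro mac_achievableI[OF N h P, of _ _ \<delta>]) (auto simp: distrib_left)
qed

lemma closed_mac_pentagon: "closed (mac_pentagon S1 S2 S)"
  unfolding mac_pentagon_def case_prod_beta'
  by (intro closed_Collect_conj closed_Collect_le continuous_intros)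

text \<open>The converse survives the closure because the pentagon is closed, and each of its points
  is a limit of achievable points obtained by scaling towards the origin.\<close>

theorem gaussian_mac_capacity_region:
  assumes N: "0 < N" and h: "0 \<le> h10" "0 \<le> h20" and P: "0 \<le> P1" "0 \<le> P2"
  shows "mac_capacity_region h10 h20 P1 P2 N = mac_pentagon (h10 * P1 / N) (h20 * P2 / N) ((h10 * P1 + h20 * P2) / N)"
    (is "_ = ?P")
proof (rule equalityI)
  show "mac_capacity_region h10 h20 P1 P2 N \<subseteq> ?P"
    unfolding mac_capacity_region_def
    by (intro closure_minimal mac_achievable_subset_pentagon closed_mac_pentagon assms)
  show "?P \<subseteq> mac_capacity_region h10 h20 P1 P2 N"
  proof
    fix R assume R: "R \<in> ?P"
    let ?t = "\<lambda>k::nat. 1 - inverse (real (Suc k))"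
    have "(?t k * fst R, ?t k * snd R) \<in> mac_achievable h10 h20 P1 P2 N" for k
      using R by (intro scaled_pentagon_achievable[OF N h P]) (auto simp: field_simps)
    moreover have "(\<lambda>k. (?t k * fst R, ?t k * snd R)) \<longlonglongrightarrow> ((1 - 0) * fst R, (1 - 0) * snd R)"
      by (intro tendsto_intros LIMSEQ_inverse_real_of_nat)
    ultimately show "R \<in> mac_capacity_region h10 h20 P1 P2 N"
      unfolding mac_capacity_region_def closure_sequential by (auto intro!: exI[of _ "\<lambda>k. (?t k * fst R, ?t k * snd R)"])
  qed
qed

section \<open>Comparison of the outer bound with pentagons\<close>

lemma rate_union_subset_pentagon:
  assumes "\<And>\<rho>. \<rho> \<in> {0..1} \<Longrightarrow> 0 \<le> f1 \<rho> \<and> f1 \<rho> \<le> S1" "\<And>\<rho>. \<rho> \<in> {0..1} \<Longrightarrow> 0 \<le> f2 \<rho> \<and> f2 \<rho> \<le> S2"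
    "\<And>\<rho> \<rho>'. \<rho> \<in> {0..1} \<Longrightarrow> \<rho>' \<in> {0..1} \<Longrightarrow> 0 \<le> f3 \<rho> \<rho>' \<and> f3 \<rho> \<rho>' \<le> S"
  shows "rate_union f1 f2 f3 f4 \<subseteq> mac_pentagon S1 S2 S"
proof -
  have mono: "x \<le> 1 / 2 * ln (1 + S)" if "x \<le> 1 / 2 * ln (1 + f)" "0 \<le> f \<and> f \<le> S" for x f S :: real
  proof -
    have "ln (1 + f) \<le> ln (1 + S)" using that by simp
    with that(1) show ?thesis by simp
  qed
  show ?thesis
  proof clarify
    fix R1 R2 assume "(R1, R2) \<in> rate_union f1 f2 f3 f4"
    then obtain \<rho>1 \<rho>2 where \<rho>: "\<rho>1 \<in> {0..1}" "\<rho>2 \<in> {0..1}" and R: "0 \<le> R1" "0 \<le> R2"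
      "R1 \<le> 1 / 2 * ln (1 + f1 \<rho>1)" "R2 \<le> 1 / 2 * ln (1 + f2 \<rho>2)" "R1 + R2 \<le> 1 / 2 * ln (1 + f3 \<rho>1 \<rho>2)"
      by (auto simp: rate_union_def)
    show "(R1, R2) \<in> mac_pentagon S1 S2 S"
      unfolding mac_pentagon_def
      using R(1,2) mono[OF R(3) assms(1)[OF \<rho>(1)]] mono[OF R(4) assms(2)[OF \<rho>(2)]] mono[OF R(5) assms(3)[OF \<rho>]]
      by simp
  qed
qed

text \<open>Zero correlation is the witness for every point at once: there each of the four bounds
  dominates its counterpart in the pentagon.\<close>

lemma pentagon_subset_rate_union:
  assumes "0 \<le> S1" "S1 \<le> f1 0" "0 \<le> S2" "S2 \<le> f2 0" "0 \<le> S" "S \<le> f3 0 0" "S \<le> f4 0 0"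
  shows "mac_pentagon S1 S2 S \<subseteq> rate_union f1 f2 f3 f4"
proof -
  have mono: "x \<le> 1 / 2 * ln (1 + f)" if "x \<le> 1 / 2 * ln (1 + S)" "0 \<le> S" "S \<le> f" for x f S :: real
  proof -
    have "ln (1 + S) \<le> ln (1 + f)" using that by simp
    with that(1) show ?thesis by simp
  qed
  show ?thesis
  proof clarify
    fix R1 R2 assume "(R1, R2) \<in> mac_pentagon S1 S2 S"
    then have R: "0 \<le> R1" "0 \<le> R2" "R1 \<le> 1 / 2 * ln (1 + S1)" "R2 \<le> 1 / 2 * ln (1 + S2)" "R1 + R2 \<le> 1 / 2 * ln (1 + S)"
      by (simp_all add: mac_pentagon_def)
    show "(R1, R2) \<in> rate_union f1 f2 f3 f4"
      unfolding rate_union_def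
      using R(1,2) mono[OF R(3) assms(1,2)] mono[OF R(4) assms(3,4)] mono[OF R(5) assms(5,6)] mono[OF R(5) assms(5,7)]
      by (intro UN_I[of "(0, 0)"]) auto
  qed
qed

text \<open>Lower both coordinates by \<open>\<eta>\<close>, stopping at zero. If both stay
  positive, the sum drops by more than it exceeded its bound; if one stops at zero, the sum
  constraint follows from the individual one, as \<open>S1 \<le> S\<close> and
  \<open>S2 \<le> S\<close>.\<close>

lemma pentagon_subset_neighbourhood:
  assumes S: "0 \<le> S1" "S1 \<le> S" "0 \<le> S2" "S2 \<le> S" and \<eta>: "0 < \<eta>" "2 * \<eta> < \<epsilon>"
    and le: "1 / 2 * ln (1 + S1') \<le> 1 / 2 * ln (1 + S1) + \<eta>" "1 / 2 * ln (1 + S2') \<le> 1 / 2 * ln (1 + S2) + \<eta>"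
      "1 / 2 * ln (1 + S') \<le> 1 / 2 * ln (1 + S) + \<eta>"
  shows "mac_pentagon S1' S2' S' \<subseteq> (\<Union>x\<in>mac_pentagon S1 S2 S. ball x \<epsilon>)"
proof clarify
  fix R1 R2 assume "(R1, R2) \<in> mac_pentagon S1' S2' S'"
  then have R: "0 \<le> R1" "0 \<le> R2" "R1 \<le> 1 / 2 * ln (1 + S1')" "R2 \<le> 1 / 2 * ln (1 + S2')" "R1 + R2 \<le> 1 / 2 * ln (1 + S')"
    by (auto simp: mac_pentagon_def)
  have ln: "0 \<le> ln (1 + S1)" "0 \<le> ln (1 + S2)" "ln (1 + S1) \<le> ln (1 + S)" "ln (1 + S2) \<le> ln (1 + S)"
    using S by auto
  let ?x = "(max (R1 - \<eta>) 0, max (R2 - \<eta>) 0)"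
  have "?x \<in> mac_pentagon S1 S2 S"
    unfolding mac_pentagon_def using R le ln \<eta> by (auto simp: max_def)
  moreover have "dist ?x (R1, R2) < \<epsilon>"
  proof -
    have "dist ?x (R1, R2) \<le> \<bar>max (R1 - \<eta>) 0 - R1\<bar> + \<bar>max (R2 - \<eta>) 0 - R2\<bar>"
      unfolding dist_Pair_Pair dist_real_def power2_abs by (rule sqrt_sum_squares_le_sum_abs)
    also have "\<dots> \<le> 2 * \<eta>" using R \<eta> by (auto simp: max_def)
    finally show ?thesis using \<eta> by simp
  qed
  ultimately show "(R1, R2) \<in> (\<Union>x\<in>mac_pentagon S1 S2 S. ball x \<epsilon>)"
    by (intro UN_I[of ?x]) auto
qed

section \<open>Limits of the bounds for very noisy cooperation links\<close>

lemma db_f1_tendsto: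
  "((\<lambda>(N1::real, N2::real). db_f1 h10 h12 P1 N N2 \<rho>1) \<longlongrightarrow> (1 - \<rho>1\<^sup>2) * h10 * P1 / N) (at_top \<times>\<^sub>F at_top)"
proof -
  have "((\<lambda>x. h12 / snd x) \<longlongrightarrow> 0) ((at_top :: real filter) \<times>\<^sub>F (at_top :: real filter))"
    by (intro tendsto_divide_0[OF tendsto_const] filterlim_at_top_imp_at_infinity filterlim_snd)
  then have "((\<lambda>x. (1 - \<rho>1\<^sup>2) * P1 * (h10 / N + h12 / snd x)) \<longlongrightarrow> (1 - \<rho>1\<^sup>2) * P1 * (h10 / N + 0))
      ((at_top :: real filter) \<times>\<^sub>F (at_top :: real filter))"
    by (intro tendsto_intros)
  then show ?thesis by (simp add: db_f1_def case_prod_beta' mult_ac)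
qed

lemma db_f2_tendsto:
  "((\<lambda>(N1::real, N2::real). db_f2 h20 h21 P2 N N1 \<rho>2) \<longlongrightarrow> (1 - \<rho>2\<^sup>2) * h20 * P2 / N) (at_top \<times>\<^sub>F at_top)"
proof -
  have "((\<lambda>x. h21 / fst x) \<longlongrightarrow> 0) ((at_top :: real filter) \<times>\<^sub>F (at_top :: real filter))"
    by (intro tendsto_divide_0[OF tendsto_const] filterlim_at_top_imp_at_infinity filterlim_fst)
  then have "((\<lambda>x. (1 - \<rho>2\<^sup>2) * P2 * (h20 / N + h21 / fst x)) \<longlongrightarrow> (1 - \<rho>2\<^sup>2) * P2 * (h20 / N + 0))
      ((at_top :: real filter) \<times>\<^sub>F (at_top :: real filter))"
    by (intro tendsto_intros)
  then show ?thesis by (simp add: db_f2_def case_prod_beta' mult_ac)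
qed

lemma eventually_pos_prod: "\<forall>\<^sub>F x in (at_top :: real filter) \<times>\<^sub>F (at_top :: real filter). 0 < fst x \<and> 0 < snd x"
  unfolding eventually_prod_filter
  by (intro exI[of _ "\<lambda>x. 0 < x"] conjI eventually_gt_at_top) auto

lemma db_f3_tendsto:
  assumes N: "0 < N"
  shows "((\<lambda>(N1::real, N2::real). db_f3 h10 h20 h12 h21 P1 P2 N N1 N2 \<rho>1 \<rho>2)
     \<longlongrightarrow> (1 - \<rho>1\<^sup>2) * h10 * P1 / N + (1 - \<rho>2\<^sup>2) * h20 * P2 / N) (at_top \<times>\<^sub>F at_top)"
proof -
  let ?F = "(at_top :: real filter) \<times>\<^sub>F (at_top :: real filter)"
  have 1: "((\<lambda>x. c / fst x) \<longlongrightarrow> 0) ?F" "((\<lambda>x. c / snd x) \<longlongrightarrow> 0) ?F" for c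
    by (intro tendsto_divide_0[OF tendsto_const] filterlim_at_top_imp_at_infinity filterlim_fst filterlim_snd)+
  have "((\<lambda>x. h12 / snd x * (h21 / fst x) + h20 * h12 / N / snd x + h10 * h21 / N / fst x) \<longlongrightarrow> 0 * 0 + 0 + 0) ?F"
    by (intro tendsto_add tendsto_mult 1)
  \<comment> \<open>Divided out, the fraction has one summand that decays in both variances and two
    that decay in one of them. The identity holds only eventually, since zero denominators have to
    be excluded.\<close>
  moreover have "\<forall>\<^sub>F x in ?F. h12 / snd x * (h21 / fst x) + h20 * h12 / N / snd x + h10 * h21 / N / fst x
      = (h12 * h21 * N + h20 * h12 * fst x + h10 * h21 * snd x) / (N * fst x * snd x)"
    using eventually_pos_prod by eventually_elim (use N in \<open>simp add: field_simps\<close>)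
  ultimately have 2: "((\<lambda>x. (h12 * h21 * N + h20 * h12 * fst x + h10 * h21 * snd x) / (N * fst x * snd x)) \<longlongrightarrow> 0) ?F"
    using tendsto_cong by force
  have "((\<lambda>x. db_f1 h10 h12 P1 N (snd x) \<rho>1 + db_f2 h20 h21 P2 N (fst x) \<rho>2
     + (1 - \<rho>1\<^sup>2) * (1 - \<rho>2\<^sup>2) * P1 * P2 * ((h12 * h21 * N + h20 * h12 * fst x + h10 * h21 * snd x) / (N * fst x * snd x)))
     \<longlongrightarrow> (1 - \<rho>1\<^sup>2) * h10 * P1 / N + (1 - \<rho>2\<^sup>2) * h20 * P2 / N + (1 - \<rho>1\<^sup>2) * (1 - \<rho>2\<^sup>2) * P1 * P2 * 0) ?F"
    by (intro tendsto_add tendsto_mult[OF tendsto_const] 2 db_f1_tendsto[unfolded case_prod_beta']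
        db_f2_tendsto[unfolded case_prod_beta'])
  then show ?thesis by (simp add: db_f3_def case_prod_beta')
qed

lemma DB_subset_pentagon:
  assumes h: "0 \<le> h10" "0 \<le> h20" "0 \<le> h12" "0 \<le> h21" and P: "0 \<le> P1" "0 \<le> P2"
    and N: "0 < N" "0 < N1" "0 < N2"
  shows "DB h10 h20 h12 h21 P1 P2 N N1 N2 \<subseteq> mac_pentagon (db_f1 h10 h12 P1 N N2 0) (db_f2 h20 h21 P2 N N1 0)
      (db_f3 h10 h20 h12 h21 P1 P2 N N1 N2 0 0)"
proof -
  have sq: "0 \<le> 1 - \<rho>\<^sup>2" "1 - \<rho>\<^sup>2 \<le> 1" if "\<rho> \<in> {0..1}" for \<rho> :: real
    using that power_le_one[of \<rho> 2] by auto
  have f1: "0 \<le> db_f1 h10 h12 P1 N N2 \<rho> \<and> db_f1 h10 h12 P1 N N2 \<rho> \<le> db_f1 h10 h12 P1 N N2 0"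
    if "\<rho> \<in> {0..1}" for \<rho>
  proof -
    have "0 \<le> P1 * (h10 / N + h12 / N2)" using h P N by simp
    from mult_right_mono[OF sq(2)[OF that] this] mult_nonneg_nonneg[OF sq(1)[OF that] this]
    show ?thesis by (simp add: db_f1_def mult.assoc)
  qed
  have f2: "0 \<le> db_f2 h20 h21 P2 N N1 \<rho> \<and> db_f2 h20 h21 P2 N N1 \<rho> \<le> db_f2 h20 h21 P2 N N1 0"
    if "\<rho> \<in> {0..1}" for \<rho>
  proof -
    have "0 \<le> P2 * (h20 / N + h21 / N1)" using h P N by simp
    from mult_right_mono[OF sq(2)[OF that] this] mult_nonneg_nonneg[OF sq(1)[OF that] this]
    show ?thesis by (simp add: db_f2_def mult.assoc)
  qed
  have f3: "0 \<le> db_f3 h10 h20 h12 h21 P1 P2 N N1 N2 \<rho> \<rho>' \<and>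
    db_f3 h10 h20 h12 h21 P1 P2 N N1 N2 \<rho> \<rho>' \<le> db_f3 h10 h20 h12 h21 P1 P2 N N1 N2 0 0"
    if \<rho>: "\<rho> \<in> {0..1}" "\<rho>' \<in> {0..1}" for \<rho> \<rho>'
  proof -
    let ?K = "P1 * P2 * ((h12 * h21 * N + h20 * h12 * N1 + h10 * h21 * N2) / (N * N1 * N2))"
    have K: "0 \<le> ?K" using h P N by (intro mult_nonneg_nonneg divide_nonneg_nonneg add_nonneg_nonneg) auto
    have q: "0 \<le> (1 - \<rho>\<^sup>2) * (1 - \<rho>'\<^sup>2)" "(1 - \<rho>\<^sup>2) * (1 - \<rho>'\<^sup>2) \<le> 1"
      using sq[OF \<rho>(1)] sq[OF \<rho>(2)] by (auto intro: mult_le_one)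
    have "0 \<le> (1 - \<rho>\<^sup>2) * (1 - \<rho>'\<^sup>2) * ?K" "(1 - \<rho>\<^sup>2) * (1 - \<rho>'\<^sup>2) * ?K \<le> 1 * ?K"
      using mult_nonneg_nonneg[OF q(1) K] mult_right_mono[OF q(2) K] by simp_all
    with f1[OF \<rho>(1)] f2[OF \<rho>(2)] show ?thesis
      by (auto simp: db_f3_def mult.assoc)
  qed
  show ?thesis
    unfolding DB_def by (intro rate_union_subset_pentagon f1 f2 f3)
qed

text \<open>At zero correlation the link terms \<open>h12 / N2\<close> and \<open>h21 / N1\<close>
  can only enlarge the first three bounds, and the fourth one equals the sum-rate parameter of the
  pentagon.\<close>

lemma pentagon_subset_DB:
  assumes h: "0 \<le> h10" "0 \<le> h20" "0 \<le> h12" "0 \<le> h21" and P: "0 \<le> P1" "0 \<le> P2"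
    and N: "0 < N" "0 < N1" "0 < N2"
  shows "mac_pentagon (h10 * P1 / N) (h20 * P2 / N) ((h10 * P1 + h20 * P2) / N) \<subseteq> DB h10 h20 h12 h21 P1 P2 N N1 N2"
  unfolding DB_def
proof (rule pentagon_subset_rate_union)
  show f1: "h10 * P1 / N \<le> db_f1 h10 h12 P1 N N2 0" using h P N by (simp add: db_f1_def distrib_left mult.commute)
  show f2: "h20 * P2 / N \<le> db_f2 h20 h21 P2 N N1 0" using h P N by (simp add: db_f2_def distrib_left mult.commute)
  have "0 \<le> P1 * P2 * ((h12 * h21 * N + h20 * h12 * N1 + h10 * h21 * N2) / (N * N1 * N2))"
    using h P N by (intro mult_nonneg_nonneg divide_nonneg_nonneg add_nonneg_nonneg) auto
  with f1 f2 show "(h10 * P1 + h20 * P2) / N \<le> db_f3 h10 h20 h12 h21 P1 P2 N N1 N2 0 0"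
    by (simp add: db_f3_def add_divide_distrib)
qed (use h P N in \<open>auto simp: db_f4_def\<close>)

theorem mainTheorem9:
  fixes h10 h20 h12 h21 P1 P2 N :: real
  assumes "0 \<le> h10" "0 \<le> h20" "0 \<le> h12" "0 \<le> h21"
    and "0 \<le> P1" "0 \<le> P2"
    and "0 < N"
  shows
    "(\<forall>\<rho>1\<in>{0..1}. \<forall>\<rho>2\<in>{0..1}.
        ((\<lambda>(N1::real, N2::real). db_f1 h10 h12 P1 N N2 \<rho>1) \<longlongrightarrow> (1 - \<rho>1\<^sup>2) * h10 * P1 / N)
          (at_top \<times>\<^sub>F at_top)
      \<and> ((\<lambda>(N1::real, N2::real). db_f2 h20 h21 P2 N N1 \<rho>2) \<longlongrightarrow> (1 - \<rho>2\<^sup>2) * h20 * P2 / N)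
          (at_top \<times>\<^sub>F at_top)
      \<and> ((\<lambda>(N1::real, N2::real). db_f3 h10 h20 h12 h21 P1 P2 N N1 N2 \<rho>1 \<rho>2)
          \<longlongrightarrow> (1 - \<rho>1\<^sup>2) * h10 * P1 / N + (1 - \<rho>2\<^sup>2) * h20 * P2 / N)
          (at_top \<times>\<^sub>F at_top))
    \<and> rate_union
        (\<lambda>\<rho>1. (1 - \<rho>1\<^sup>2) * h10 * P1 / N)
        (\<lambda>\<rho>2. (1 - \<rho>2\<^sup>2) * h20 * P2 / N)
        (\<lambda>\<rho>1 \<rho>2. (1 - \<rho>1\<^sup>2) * h10 * P1 / N + (1 - \<rho>2\<^sup>2) * h20 * P2 / N)
        (db_f4 h10 h20 P1 P2 N)
      = mac_capacity_region h10 h20 P1 P2 N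
    \<and> hausdorff_tendsto (\<lambda>(N1::real, N2::real). DB h10 h20 h12 h21 P1 P2 N N1 N2)
        (mac_capacity_region h10 h20 P1 P2 N) (at_top \<times>\<^sub>F at_top)"
proof (intro conjI ballI db_f1_tendsto db_f2_tendsto db_f3_tendsto)
  note h = assms(1-4) and P = assms(5,6) and N = assms(7)
  let ?S1 = "h10 * P1 / N" and ?S2 = "h20 * P2 / N" and ?S = "(h10 * P1 + h20 * P2) / N"
  let ?F = "(at_top :: real filter) \<times>\<^sub>F (at_top :: real filter)"
  note cap = gaussian_mac_capacity_region[OF N h(1,2) P]
  have S: "0 \<le> ?S1" "0 \<le> ?S2" "0 \<le> ?S" and Seq: "?S = ?S1 + ?S2"
    using h P N by (auto simp: add_divide_distrib)
  have frac: "0 \<le> (1 - \<rho>\<^sup>2) * h * P / N \<and> (1 - \<rho>\<^sup>2) * h * P / N \<le> h * P / N"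
    if "\<rho> \<in> {0..1}" "0 \<le> h" "0 \<le> P" for \<rho> h P :: real
  proof -
    have "0 \<le> 1 - \<rho>\<^sup>2" "1 - \<rho>\<^sup>2 \<le> 1" using that power_le_one[of \<rho> 2] by auto
    moreover have "0 \<le> h * P / N" using that N by simp
    ultimately show ?thesis
      using mult_right_mono[of "1 - \<rho>\<^sup>2" 1 "h * P / N"] mult_nonneg_nonneg[of "1 - \<rho>\<^sup>2" "h * P / N"]
      by (simp add: mult.assoc)
  qed
  show "rate_union (\<lambda>\<rho>1. (1 - \<rho>1\<^sup>2) * h10 * P1 / N) (\<lambda>\<rho>2. (1 - \<rho>2\<^sup>2) * h20 * P2 / N)
        (\<lambda>\<rho>1 \<rho>2. (1 - \<rho>1\<^sup>2) * h10 * P1 / N + (1 - \<rho>2\<^sup>2) * h20 * P2 / N) (db_f4 h10 h20 P1 P2 N)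
      = mac_capacity_region h10 h20 P1 P2 N"
    unfolding cap
  proof (rule equalityI)
    show "rate_union (\<lambda>\<rho>1. (1 - \<rho>1\<^sup>2) * h10 * P1 / N) (\<lambda>\<rho>2. (1 - \<rho>2\<^sup>2) * h20 * P2 / N)
        (\<lambda>\<rho>1 \<rho>2. (1 - \<rho>1\<^sup>2) * h10 * P1 / N + (1 - \<rho>2\<^sup>2) * h20 * P2 / N) (db_f4 h10 h20 P1 P2 N)
      \<subseteq> mac_pentagon ?S1 ?S2 ?S"
      unfolding Seq
      by (intro rate_union_subset_pentagon frac h P)
        (use frac h P in \<open>auto intro!: add_mono add_nonneg_nonneg\<close>)
    \<comment> \<open>At zero correlation the limiting third bound and the fourth bound coincide, so
      both sum constraints become the one of the pentagon.\<close>
    show "mac_pentagon ?S1 ?S2 ?S \<subseteq> rate_union (\<lambda>\<rho>1. (1 - \<rho>1\<^sup>2) * h10 * P1 / N) (\<lambda>\<rho>2. (1 - \<rho>2\<^sup>2) * h20 * P2 / N)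
        (\<lambda>\<rho>1 \<rho>2. (1 - \<rho>1\<^sup>2) * h10 * P1 / N + (1 - \<rho>2\<^sup>2) * h20 * P2 / N) (db_f4 h10 h20 P1 P2 N)"
      by (rule pentagon_subset_rate_union) (use S Seq in \<open>auto simp: db_f4_def\<close>)
  qed
  show "hausdorff_tendsto (\<lambda>(N1::real, N2::real). DB h10 h20 h12 h21 P1 P2 N N1 N2)
        (mac_capacity_region h10 h20 P1 P2 N) ?F"
    unfolding hausdorff_tendsto_def cap
  proof (intro allI impI)
    fix \<epsilon> :: real assume \<epsilon>: "0 < \<epsilon>"
    \<comment> \<open>Retreating by \<open>\<eta>\<close> in both coordinates moves a point by at
      most \<open>2 * \<eta>\<close>, which has to stay below \<open>\<epsilon>\<close>.\<close>
    define \<eta> where "\<eta> = \<epsilon> / 3"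
    have \<eta>: "0 < \<eta>" "2 * \<eta> < \<epsilon>" using \<epsilon> by (auto simp: \<eta>_def)
    \<comment> \<open>Upper estimates suffice: the opposite inclusion holds at all positive link
      noises, because every such \<open>DB\<close> contains the capacity pentagon.\<close>
    have ev: "\<forall>\<^sub>F x in ?F. 1 / 2 * ln (1 + f x) < 1 / 2 * ln (1 + L) + \<eta>"
      if "(f \<longlongrightarrow> L) ?F" "0 \<le> L" for f L
    proof (rule order_tendstoD(2))
      show "((\<lambda>x. 1 / 2 * ln (1 + f x)) \<longlongrightarrow> 1 / 2 * ln (1 + L)) ?F"
        using that by (intro tendsto_intros) auto
    qed (use \<eta> in simp)
    have "\<forall>\<^sub>F x in ?F. 1 / 2 * ln (1 + db_f1 h10 h12 P1 N (snd x) 0) < 1 / 2 * ln (1 + ?S1) + \<eta>"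
      using db_f1_tendsto[of h10 h12 P1 N 0] S by (intro ev) (auto simp: case_prod_beta')
    moreover have "\<forall>\<^sub>F x in ?F. 1 / 2 * ln (1 + db_f2 h20 h21 P2 N (fst x) 0) < 1 / 2 * ln (1 + ?S2) + \<eta>"
      using db_f2_tendsto[of h20 h21 P2 N 0] S by (intro ev) (auto simp: case_prod_beta')
    moreover have "\<forall>\<^sub>F x in ?F. 1 / 2 * ln (1 + db_f3 h10 h20 h12 h21 P1 P2 N (fst x) (snd x) 0 0) < 1 / 2 * ln (1 + ?S) + \<eta>"
      using db_f3_tendsto[OF N, of h10 h20 h12 h21 P1 P2 0 0] S by (intro ev) (auto simp: case_prod_beta' Seq)
    ultimately show "\<forall>\<^sub>F t in ?F.
        (case t of (N1, N2) \<Rightarrow> DB h10 h20 h12 h21 P1 P2 N N1 N2) \<subseteq> (\<Union>x\<in>mac_pentagon ?S1 ?S2 ?S. ball x \<epsilon>)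
      \<and> mac_pentagon ?S1 ?S2 ?S \<subseteq> (\<Union>x\<in>(case t of (N1, N2) \<Rightarrow> DB h10 h20 h12 h21 P1 P2 N N1 N2). ball x \<epsilon>)"
      using eventually_pos_prod
    proof eventually_elim
      case (elim x)
      let ?D = "DB h10 h20 h12 h21 P1 P2 N (fst x) (snd x)"
      have "?D \<subseteq> mac_pentagon (db_f1 h10 h12 P1 N (snd x) 0) (db_f2 h20 h21 P2 N (fst x) 0)
          (db_f3 h10 h20 h12 h21 P1 P2 N (fst x) (snd x) 0 0)"
        using elim by (intro DB_subset_pentagon h P N) auto
      also have "\<dots> \<subseteq> (\<Union>x\<in>mac_pentagon ?S1 ?S2 ?S. ball x \<epsilon>)"
        using elim S Seq by (intro pentagon_subset_neighbourhood[OF _ _ _ _ \<eta>]) auto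
      finally have 1: "?D \<subseteq> (\<Union>x\<in>mac_pentagon ?S1 ?S2 ?S. ball x \<epsilon>)" .
      have "mac_pentagon ?S1 ?S2 ?S \<subseteq> ?D"
        using elim by (intro pentagon_subset_DB h P N) auto
      then have "mac_pentagon ?S1 ?S2 ?S \<subseteq> (\<Union>x\<in>?D. ball x \<epsilon>)"
        using \<epsilon> by force
      with 1 show ?case by (simp add: case_prod_beta')
    qed
  qed
qed (rule assms)

end
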